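(* Let $0\le\beta\le\frac1{\mathrm e}$ and let $\lambda_1\le\lambda_2$ be the two roots in $[0,1]$ of $-\lambda\ln\lambda=\beta$ (with $0\ln 0=0$). Suppose there is a left-continuous non-increasing function $\theta:[\lambda_1,\lambda_2]\to[0,1]$, extended by $\theta(t)=0$ for $t\in(\lambda_2,1]$, such that $$\theta(\lambda_1)=1,\qquad \int_z^1\int_0^t \frac{1}{t}\,\theta(\max\{s,z\})^t\,\mathrm ds\,\mathrm dt\;\ge\;\alpha\cdot\theta(z)\quad\text{for all } z\in[\lambda_1,\lambda_2]$$ (with $0^t=0$ for $t>0$). Then for every number of values $n$ there is an algorithm for optimal stopping with a predicted prior that is $\alpha$-consistent and $\beta$-robust for the MaxExp objective.
   Context: Optimal stopping with a predicted prior: let $\mathcal D$ be the set of probability distributions on $[0,\infty)$ (identified with their cdfs). There are $n$ values $x_1,\dots,x_n$ drawn i.i.d. from an unknown prior $F\in\mathcal D$; each value $x_i$ has an arrival time $t_i$ drawn independently and uniformly from $[0,1]$, independent of the values. Values are revealed in increasing order of arrival time; upon seeing a value, an online algorithm must irrevocably accept it (and stop) or reject it; at most one value can be accepted. The algorithm knows $n$ and a predicted prior $\tilde F\in\mathcal D$ and may use the observed history and internal randomness. Let $x_{\mathrm{ALG}}$ be the accepted value ($0$ if none) and $x_{\mathrm{OPT}}=\max_i x_i$. For the MaxExp objective the competitive ratio is $\mathbb E[x_{\mathrm{ALG}}]/\mathbb E[x_{\mathrm{OPT}}]$; for the MaxProb objective it is $\Pr[x_{\mathrm{ALG}}=x_{\mathrm{OPT}}]$.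 An algorithm is $\Gamma$-competitive if its ratio is at least $\Gamma$. It is $\alpha$-consistent if for every $F\in\mathcal D$ it is $\alpha$-competitive when $\tilde F=F$, and $\beta$-robust if for every $F\in\mathcal D$ it is $\beta$-competitive regardless of which $\tilde F\in\mathcal D$ is given. *)

theory Defs
  imports "HOL-Probability.Probability"
begin

definition negxlnx :: "real \<Rightarrow> real" where
  "negxlnx l = (if l = 0 then 0 else - l * ln l)"

definition prior :: "real measure \<Rightarrow> bool" where
  "prior F \<longleftrightarrow> prob_space F \<and> sets F = sets borel \<and> emeasure F {..<0} = 0"

text \<open>Sample space for n values: values x (i.i.d. F), arrival times t (i.i.d. uniform on [0,1]),
  and the internal random seed r of the algorithm (uniform on [0,1]).\<close>
definition sample_space :: "nat \<Rightarrow> real measure \<Rightarrow> (((nat \<Rightarrow> real) \<times> (nat \<Rightarrow> real)) \<times> real) measure" where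
  "sample_space n F =
     (PiM {..<n} (\<lambda>_. F) \<Otimes>\<^sub>M PiM {..<n} (\<lambda>_. uniform_measure lborel {0..1}))
       \<Otimes>\<^sub>M uniform_measure lborel {0..1}"

text \<open>Indices in increasing order of arrival time (ties, a null event, broken by index).\<close>
definition arrival_order :: "nat \<Rightarrow> (nat \<Rightarrow> real) \<Rightarrow> nat list" where
  "arrival_order n t = sort_key t [0..<n]"

definition history :: "nat \<Rightarrow> (nat \<Rightarrow> real) \<Rightarrow> (nat \<Rightarrow> real) \<Rightarrow> (real \<times> real) list" where
  "history n x t = map (\<lambda>i. (t i, x i)) (arrival_order n t)"

text \<open>An online algorithm (for a fixed n and fixed prediction) is a decision rule
  A r h : given the seed r and the history h observed so far (whose last entry is the
  current value), accept (True) or reject.  The accepted value (0 if none):\<close>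
definition alg_value ::
  "(real \<Rightarrow> (real \<times> real) list \<Rightarrow> bool) \<Rightarrow> nat \<Rightarrow> (nat \<Rightarrow> real) \<Rightarrow> (nat \<Rightarrow> real) \<Rightarrow> real \<Rightarrow> real" where
  "alg_value A n x t r =
     (let h = history n x t in
      case find (\<lambda>k. A r (take (Suc k) h)) [0..<n] of
        None \<Rightarrow> 0
      | Some k \<Rightarrow> snd (h ! k))"

definition opt_value :: "nat \<Rightarrow> (nat \<Rightarrow> real) \<Rightarrow> real" where
  "opt_value n x = Max (insert 0 (x ` {..<n}))"

definition competitive ::
  "nat \<Rightarrow> (real \<Rightarrow> (real \<times> real) list \<Rightarrow> bool) \<Rightarrow> real measure \<Rightarrow> real \<Rightarrow> bool" where
  "competitive n A F \<Gamma> \<longleftrightarrow>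
     (\<integral>\<^sup>+ \<omega>. ennreal (alg_value A n (fst (fst \<omega>)) (snd (fst \<omega>)) (snd \<omega>)) \<partial>sample_space n F)
       \<ge> ennreal \<Gamma> * (\<integral>\<^sup>+ \<omega>. ennreal (opt_value n (fst (fst \<omega>))) \<partial>sample_space n F)"

text \<open>A (randomized) algorithm with a predicted prior: maps the prediction Ft to a
  decision rule; required to be measurable so that its value is a random variable.\<close>
definition online_alg :: "nat \<Rightarrow> (real measure \<Rightarrow> real \<Rightarrow> (real \<times> real) list \<Rightarrow> bool) \<Rightarrow> bool" where
  "online_alg n A \<longleftrightarrow>
     (\<forall>Ft F. prior Ft \<longrightarrow> prior F \<longrightarrow>
        (\<lambda>\<omega>. alg_value (A Ft) n (fst (fst \<omega>)) (snd (fst \<omega>)) (snd \<omega>))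
          \<in> borel_measurable (sample_space n F))"

text \<open>Competitive ratios are only meaningful for priors with finite mean.\<close>
definition consistent :: "nat \<Rightarrow> (real measure \<Rightarrow> real \<Rightarrow> (real \<times> real) list \<Rightarrow> bool) \<Rightarrow> real \<Rightarrow> bool" where
  "consistent n A \<alpha> \<longleftrightarrow>
     (\<forall>F. prior F \<and> integrable F (\<lambda>x. x) \<longrightarrow> competitive n (A F) F \<alpha>)"

definition robust :: "nat \<Rightarrow> (real measure \<Rightarrow> real \<Rightarrow> (real \<times> real) list \<Rightarrow> bool) \<Rightarrow> real \<Rightarrow> bool" where
  "robust n A \<beta> \<longleftrightarrow>
     (\<forall>F Ft. prior F \<and> integrable F (\<lambda>x. x) \<and> prior Ft \<longrightarrow> competitive n (A Ft) F \<beta>)"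

end

theory Submission
  imports Defs
begin

text \<open>Proof idea. Attach to every value \<open>x\<close> an independent uniform mark \<open>u\<close> (extracted from the bits of
  the seed) and order pairs \<open>(x, u)\<close> lexicographically; the mass \<open>p\<close> of the pairs below \<open>(x, u)\<close> is then
  uniform on \<open>[0,1]\<close> even if the prior has atoms. The algorithm accepts a pair arriving at time \<open>t\<close>
  iff it beats everything seen so far and its rank under the predicted prior exceeds
  \<open>\<theta>(t) powr (1 / (n - 1))\<close> (never before \<open>l1\<close>, always after \<open>l2\<close>).

  Condition on one item having rank \<open>p\<close> and arriving at an acceptable time \<open>t\<close>. It is selected as soon as
  the best earlier item is below it and was rejected. If a pair of rank below \<open>c(s)\<close> arriving at time \<open>s\<close> is
  always below it and rejected, splitting over the index of that earlier best item and integrating over its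
  rank bounds the selection probability below by
  \<open>(1/t) \<integral>\<^sub>0\<^sup>t (1 - t + t c(s)) ^ (n - 1) ds\<close>. The contribution of an item to the expected optimum has
  density \<open>p ^ (n - 1)\<close>, so both ratios follow by comparing densities. For robustness \<open>c = p\<close> up to the
  acceptance time \<open>z\<close> of the item, which yields \<open>- z ln z \<ge> \<beta>\<close>. For consistency \<open>c\<close> is the minimum
  of \<open>p\<close> and the cutoff, and weighted AM-GM reduces the bound to the assumed integral inequality.\<close>

section \<open>Independent uniform marks from one seed\<close>

text \<open>The decision rule sees a single real seed and arrival positions, never item indices, so
  the mark of an item is the one reserved for its arrival position. For tie-free times the positions
  are an injective relabelling of the items; hence the marks stay i.i.d. and independent of the
  times, and the items can be treated as i.i.d. triples. The exponent \<open>n - 1\<close> counts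
  competitors: with \<pi> = p ^ (n - 1) the rank test at time t in [l1, l2] reads \<theta>(t) <
  \<pi>, and AM-GM gives (1 - t + t c) ^ (n - 1) \<ge> (c ^ (n - 1)) powr t, where c ^ (n - 1) is
  the minimum of \<pi> and \<theta>(s). The assumed inequality speaks only about values \<theta>(z),
  whereas \<pi> may fall into a jump of \<theta>. With z the last time where \<theta> is at least
  \<pi>, the factor \<pi> / \<theta>(z) \<le> 1 is absorbed because it is at most its own t-th
  power. For robustness, acceptance uses ranks under one prior and the density uses ranks under
  another. Their only link is that both rank functions are monotone for the same lexicographic
  order; therefore records are defined by that order and not by rank.\<close>

definition unif :: "real measure" where "unif = uniform_measure lborel {0..1}"

lemma prob_space_unif: "prob_space unif"
  unfolding unif_def by (rule prob_space_uniform_measure) auto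

lemma sets_unif [measurable_cong]: "sets unif = sets borel"
  by (simp add: unif_def uniform_measure_def)

lemma space_unif [simp]: "space unif = UNIV"
  by (simp add: unif_def uniform_measure_def)

lemma nn_integral_unif:
  assumes [measurable]: "f \<in> borel_measurable borel"
  shows "(\<integral>\<^sup>+x. f x \<partial>unif) = (\<integral>\<^sup>+x. f x * indicator {0..1} x \<partial>lborel)"
  unfolding unif_def by (subst nn_integral_uniform_measure) (auto simp: divide_ennreal_def)

lemma AE_unif: "(AE x in unif. 0 \<le> x \<and> x \<le> 1)"
  unfolding unif_def by (rule AE_uniform_measureI) auto

lemma AE_unif_neq: "AE x in unif. x \<noteq> c"
  unfolding unif_def by (rule AE_uniform_measureI) (use AE_lborel_singleton[of c] in auto)

lemma emeasure_unif_atMost: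
  assumes "0 \<le> c" "c \<le> 1"
  shows "emeasure unif {..c} = ennreal c"
proof -
  have "{0..1} \<inter> {..c} = {0..c}" using assms by auto
  then show ?thesis using assms by (simp add: unif_def divide_ennreal_def)
qed

lemma emeasure_unif_lessThan:
  assumes "0 \<le> c" "c \<le> 1"
  shows "emeasure unif {..<c} = ennreal c"
proof -
  have "{0..1} \<inter> {..<c} = {0..<c}" using assms by auto
  then show ?thesis using assms by (simp add: unif_def divide_ennreal_def)
qed

lemma emeasure_unif_greaterThan:
  assumes "0 \<le> c" "c \<le> 1"
  shows "emeasure unif {c<..} = ennreal (1 - c)"
proof -
  have "{0..1} \<inter> {c<..} = {c<..1}" using assms by auto
  then show ?thesis using assms by (simp add: unif_def divide_ennreal_def)
qed

section \<open>Binary digits of a uniform number are fair coins\<close>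

definition bit0 :: "real \<Rightarrow> bool" where "bit0 r \<longleftrightarrow> 1/2 \<le> r"
text \<open>This is the shift on binary expansions. It fixes 1, whose digits are then all ones, so
  \<open>bval\<close> inverts \<open>bits\<close> on the closed interval.\<close>

definition doubling :: "real \<Rightarrow> real" where "doubling r = (if r < 1/2 then 2 * r else 2 * r - 1)"
definition bits :: "real \<Rightarrow> nat \<Rightarrow> bool" where "bits r j = bit0 ((doubling ^^ j) r)"
abbreviation coin :: "bool measure" where "coin \<equiv> measure_pmf (bernoulli_pmf (1/2))"
abbreviation coins :: "(nat \<Rightarrow> bool) measure" where "coins \<equiv> PiM UNIV (\<lambda>_. coin)"
definition bval :: "(nat \<Rightarrow> bool) \<Rightarrow> real" where
  "bval b = (\<Sum>j. of_bool (b j) * (1/2) ^ Suc j)"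

lemma doubling_measurable [measurable]: "doubling \<in> borel_measurable borel"
  unfolding doubling_def by measurable
lemma bit0_measurable [measurable]: "bit0 \<in> measurable borel (count_space UNIV)"
  unfolding bit0_def by measurable
lemma doubling_iter_measurable [measurable]: "(doubling ^^ j) \<in> borel_measurable borel"
  by (rule measurable_compose_n) measurable
lemma bits_measurable [measurable]: "(\<lambda>r. bits r j) \<in> measurable borel (count_space UNIV)"
  unfolding bits_def by measurable

text \<open>Affine substitution on each half of the unit interval: the leading digit is a fair coin,
  independent of the shifted number, which is uniform again.\<close>

lemma nn_integral_unif_doubling:
  assumes [measurable]: "\<And>b. f b \<in> borel_measurable borel"
  shows "(\<integral>\<^sup>+r. f (bit0 r) (doubling r) \<partial>unif)
     = (\<integral>\<^sup>+r. f False r \<partial>unif) / 2 + (\<integral>\<^sup>+r. f True r \<partial>unif) / 2"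
proof -
  have 1: "(\<integral>\<^sup>+r. f False (2*r) * indicator {0..<1/2} r \<partial>lborel) * 2 = (\<integral>\<^sup>+r. f False r \<partial>unif)"
  proof -
    \<comment> \<open>The endpoint 1 is dropped, as a null set, because the lower branch of
      \<open>doubling\<close> only covers the half-open interval.\<close>
    have "(\<integral>\<^sup>+r. f False r \<partial>unif) = (\<integral>\<^sup>+r. f False r * indicator {0..<1} r \<partial>lborel)"
      by (subst nn_integral_unif, measurable, rule nn_integral_cong_AE)
         (use AE_lborel_singleton[of 1] in \<open>auto simp: indicator_def elim!: eventually_mono\<close>)
    also have "\<dots> = 2 * (\<integral>\<^sup>+r. f False (0+2*r) * indicator {0..<1} (0+2*r) \<partial>lborel)"
      by (subst nn_integral_real_affine[where c=2 and t=0]) auto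
    also have "(\<lambda>r. f False (0+2*r) * indicator {0..<1} (0+2*r)) = (\<lambda>r::real. f False (2*r) * indicator {0..<1/2} r)"
      by (auto simp: fun_eq_iff indicator_def)
    finally show ?thesis by (simp add: mult.commute)
  qed
  have 2: "(\<integral>\<^sup>+r. f True (2*r-1) * indicator {1/2..1} r \<partial>lborel) * 2 = (\<integral>\<^sup>+r. f True r \<partial>unif)"
  proof -
    have "(\<integral>\<^sup>+r. f True r \<partial>unif) = (\<integral>\<^sup>+r. f True r * indicator {0..1} r \<partial>lborel)"
      by (subst nn_integral_unif) auto
    also have "\<dots> = 2 * (\<integral>\<^sup>+r. f True (-1+2*r) * indicator {0..1} (-1+2*r) \<partial>lborel)"
      by (subst nn_integral_real_affine[where c=2 and t="-1"]) auto
    also have "(\<lambda>r. f True (-1+2*r) * indicator {0..1} (-1+2*r)) = (\<lambda>r::real. f True (2*r-1) * indicator {1/2..1} r)"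
      by (auto simp: fun_eq_iff indicator_def)
    finally show ?thesis by (simp add: mult.commute)
  qed
  have half: "a = b / 2" if "a * 2 = b" for a b :: ennreal
    using that[symmetric] by (simp add: ennreal_mult_divide_eq)
  have "(\<integral>\<^sup>+r. f (bit0 r) (doubling r) \<partial>unif) = (\<integral>\<^sup>+r. f (bit0 r) (doubling r) * indicator {0..1} r \<partial>lborel)"
    by (subst nn_integral_unif) (auto simp: bit0_def)
  also have "\<dots> = (\<integral>\<^sup>+r. f False (2*r) * indicator {0..<1/2} r + f True (2*r-1) * indicator {1/2..1} r \<partial>lborel)"
    by (intro nn_integral_cong) (auto simp: bit0_def doubling_def indicator_def)
  also have "\<dots> = (\<integral>\<^sup>+r. f False (2*r) * indicator {0..<1/2} r \<partial>lborel) + (\<integral>\<^sup>+r. f True (2*r-1) * indicator {1/2..1} r \<partial>lborel)"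
    by (intro nn_integral_add) auto
  finally show ?thesis using half[OF 1] half[OF 2] by simp
qed

lemma doubling_range: "0 \<le> r \<Longrightarrow> r \<le> 1 \<Longrightarrow> 0 \<le> (doubling ^^ j) r \<and> (doubling ^^ j) r \<le> 1"
  by (induction j) (auto simp: doubling_def)

text \<open>After m digits the remainder is \<open>(1/2)^m\<close> times the m-th iterate of
  \<open>doubling\<close>, which stays in [0,1].\<close>

lemma bval_bits:
  assumes "0 \<le> r" "r \<le> 1"
  shows "bval (bits r) = r"
proof -
  have eq: "(\<Sum>j<m. of_bool (bits r j) * (1/2) ^ Suc j) = r - (1/2)^m * (doubling ^^ m) r" for m
  proof (induction m)
    case (Suc m)
    have "(doubling ^^ m) r = of_bool (bit0 ((doubling ^^ m) r)) / 2 + doubling ((doubling ^^ m) r) / 2"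
      by (cases "(doubling ^^ m) r < 1/2") (simp_all add: doubling_def bit0_def field_simps)
    then show ?case using Suc by (simp add: bits_def field_simps)
  qed simp
  have "(\<lambda>m. (1/2)^m * (doubling ^^ m) r) \<longlonglongrightarrow> 0"
  proof (rule tendsto_0_le[where K=1])
    show "(\<lambda>m. (1/2::real)^m) \<longlonglongrightarrow> 0" by (rule LIMSEQ_realpow_zero) auto
    show "\<forall>\<^sub>F m in sequentially. norm ((1/2)^m * (doubling ^^ m) r) \<le> norm ((1/2::real)^m) * 1"
      using doubling_range[OF assms] by (intro always_eventually) (auto simp: abs_mult mult_le_cancel_left1)
  qed
  then have "(\<lambda>m. r - (1/2)^m * (doubling ^^ m) r) \<longlonglongrightarrow> r - 0" by (intro tendsto_intros)
  then have "(\<lambda>j. of_bool (bits r j) * (1/2) ^ Suc j) sums r"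
    unfolding sums_def eq by simp
  then show ?thesis unfolding bval_def by (rule sums_unique[symmetric])
qed

text \<open>Induction peels off the first digit. The family \<open>A\<close> is generalized because
  the remaining digits are those of \<open>doubling r\<close> and are tested against the shifted
  family.\<close>

lemma emeasure_bits_prefix:
  "emeasure unif {r. \<forall>j<m. bits r j \<in> A j} = (\<Prod>j<m. emeasure coin (A j))"
proof (induction m arbitrary: A)
  case 0
  then show ?case using prob_space.emeasure_space_1[OF prob_space_unif] by simp
next
  case (Suc m)
  have *: "bits r (Suc j) = bits (doubling r) j" for r j
    by (simp add: bits_def funpow_swap1)
  let ?B = "{r. \<forall>j<m. bits r j \<in> A (Suc j)}"
  have [measurable]: "?B \<in> sets borel" by measurable
  have [measurable]: "{r. \<forall>j<Suc m. bits r j \<in> A j} \<in> sets borel" by measurable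
  have "emeasure unif {r. \<forall>j<Suc m. bits r j \<in> A j}
     = (\<integral>\<^sup>+r. indicator {r. \<forall>j<Suc m. bits r j \<in> A j} r \<partial>unif)"
    by (subst nn_integral_indicator) (auto simp: sets_unif)
  also have "\<dots> = (\<integral>\<^sup>+r. indicator (A 0) (bit0 r) * indicator ?B (doubling r) \<partial>unif)"
    by (intro nn_integral_cong)
       (auto simp: indicator_def All_less_Suc2 * bits_def[of _ 0])
  also have "\<dots> = (\<integral>\<^sup>+r. indicator (A 0) False * indicator ?B r \<partial>unif) / 2
       + (\<integral>\<^sup>+r. indicator (A 0) True * indicator ?B r \<partial>unif) / 2"
    by (rule nn_integral_unif_doubling[where f="\<lambda>b r. indicator (A 0) b * indicator ?B r"]) measurable
  also have "\<dots> = (indicator (A 0) False / 2 + indicator (A 0) True / 2) * emeasure unif ?B"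
    by (simp add: nn_integral_cmult sets_unif distrib_left distrib_right divide_ennreal_def mult_ac)
  also have "indicator (A 0) False / 2 + indicator (A 0) True / 2 = emeasure coin (A 0)"
  proof -
    have "emeasure coin (A 0) = (\<integral>\<^sup>+b. indicator (A 0) b \<partial>coin)" by simp
    also have "\<dots> = indicator (A 0) False / 2 + indicator (A 0) True / 2"
      by (subst nn_integral_bernoulli_pmf)
         (auto simp: indicator_def divide_ennreal_def divide_ennreal[symmetric] ennreal_1[symmetric] simp del: ennreal_1)
    finally show ?thesis ..
  qed
  finally show ?case using Suc.IH[of "\<lambda>j. A (Suc j)"] by (simp add: prod.lessThan_Suc_shift del: prod.lessThan_Suc)
qed

lemma distr_bits: "distr unif coins bits = coins"
proof -
  interpret C: product_prob_space "\<lambda>_::nat. coin" UNIV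
    by unfold_locales
  have [measurable]: "bits \<in> measurable unif coins"
    by (rule measurable_PiM_single') (auto simp: space_PiM)
  show ?thesis
  proof (rule C.PiM_eq)
    fix J :: "nat set" and F :: "nat \<Rightarrow> bool set"
    assume J: "finite J"
    then obtain m where m: "J \<subseteq> {..<m}"
      using finite_nat_iff_bounded by blast
    \<comment> \<open>A cylinder over an arbitrary finite \<open>J\<close> becomes a condition on a
      full prefix, with unconstrained coordinates contributing the factor 1.\<close>
    define A where "A j = (if j \<in> J then F j else UNIV)" for j
    have "emeasure (distr unif coins bits) (prod_emb UNIV (\<lambda>_. coin) J (\<Pi>\<^sub>E j\<in>J. F j))
       = emeasure unif (bits -` prod_emb UNIV (\<lambda>_. coin) J (\<Pi>\<^sub>E j\<in>J. F j) \<inter> space unif)"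
      by (rule emeasure_distr) (use J in \<open>auto intro!: sets_PiM_I\<close>)
    also have "bits -` prod_emb UNIV (\<lambda>_. coin) J (\<Pi>\<^sub>E j\<in>J. F j) \<inter> space unif = {r. \<forall>j<m. bits r j \<in> A j}"
      using m by (fastforce simp: prod_emb_def A_def space_PiM PiE_iff)
    also have "emeasure unif \<dots> = (\<Prod>j<m. emeasure coin (A j))"
      by (rule emeasure_bits_prefix)
    also have "\<dots> = (\<Prod>j\<in>J. emeasure coin (F j))"
      using m measure_pmf.emeasure_space_1[of "bernoulli_pmf (1/2)"]
      by (intro prod.mono_neutral_cong_right) (auto simp: A_def)
    finally show "emeasure (distr unif coins bits) (prod_emb UNIV (\<lambda>_. coin) J (\<Pi>\<^sub>E j\<in>J. F j))
       = (\<Prod>j\<in>J. emeasure coin (F j))" .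
  qed simp
qed

lemma bval_measurable [measurable]: "bval \<in> borel_measurable coins"
  unfolding bval_def by measurable

text \<open>Pulled back along \<open>bits\<close>, this is the statement that \<open>bval\<close>
  inverts \<open>bits\<close> almost everywhere.\<close>

lemma distr_bval: "distr coins unif bval = unif"
proof -
  have m: "bits \<in> measurable unif coins"
    by (rule measurable_PiM_single') (auto simp: space_PiM)
  have "distr coins unif bval = distr (distr unif coins bits) unif bval"
    by (simp only: distr_bits)
  also have "\<dots> = distr unif unif (bval \<circ> bits)"
    by (rule distr_distr) (use m in measurable)
  also have "\<dots> = distr unif unif (\<lambda>r. r)"
  proof (rule distr_cong_AE)
    show "AE r in unif. (bval \<circ> bits) r = r"
      using AE_unif by eventually_elim (simp add: bval_bits)
    show "bval \<circ> bits \<in> measurable unif unif"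
      by (rule measurable_comp[OF m]) measurable
  qed auto
  finally show ?thesis by simp
qed

text \<open>\<open>prod_encode\<close> partitions the digit positions into infinitely many infinite
  blocks; the k-th block supplies the k-th mark.\<close>

definition seed :: "real \<Rightarrow> nat \<Rightarrow> real" where
  "seed r k = bval (\<lambda>j. bits r (prod_encode (k, j)))"

lemma seed_measurable [measurable]: "(\<lambda>r. seed r k) \<in> borel_measurable borel"
  unfolding seed_def bval_def by measurable

text \<open>Disjoint blocks of independent coins are independent, and each block, reindexed by j, is
  again a sequence of fair coins, so its \<open>bval\<close> is uniform.\<close>

lemma distr_seed: "distr unif (PiM UNIV (\<lambda>_. unif)) seed = PiM UNIV (\<lambda>_. unif)"
proof -
  interpret C: prob_space coins
    by (intro prob_space_PiM) unfold_locales
  have [measurable]: "bits \<in> measurable unif coins"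
    by (rule measurable_PiM_single') (auto simp: space_PiM)
  have comp: "distr coins coin (\<lambda>b. b i) = coin" for i
    by (rule distr_PiM_component) (auto intro: prob_space_measure_pmf)
  have coords: "C.indep_vars (\<lambda>_. coin) (\<lambda>j b. b j) UNIV"
    by (subst C.indep_vars_iff_distr_eq_PiM) (auto simp: comp restrict_UNIV)
  define K where "K k = range (\<lambda>j. prod_encode (k, j))" for k
  have "C.indep_vars (\<lambda>k. PiM (K k) (\<lambda>_. coin)) (\<lambda>k b. restrict (\<lambda>i. b i) (K k)) UNIV"
    by (rule C.indep_vars_restrict[OF coords]) (auto simp: disjoint_family_on_def K_def)
  then have "C.indep_vars (\<lambda>_. unif) (\<lambda>k b. bval (\<lambda>j. restrict (\<lambda>i. b i) (K k) (prod_encode (k, j)))) UNIV"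
  proof (rule C.indep_vars_compose2)
    fix k
    have "(\<lambda>b j. b (prod_encode (k, j))) \<in> measurable (PiM (K k) (\<lambda>_. coin)) coins"
    proof (rule measurable_PiM_single')
      show "(\<lambda>b. b (prod_encode (k, j))) \<in> measurable (PiM (K k) (\<lambda>_. coin)) coin" for j
        by (rule measurable_component_singleton) (auto simp: K_def)
    qed (auto simp: space_PiM)
    then show "(\<lambda>b. bval (\<lambda>j. b (prod_encode (k, j)))) \<in> measurable (PiM (K k) (\<lambda>_. coin)) unif"
      by measurable
  qed
  then have ind: "C.indep_vars (\<lambda>_. unif) (\<lambda>k b. bval (\<lambda>j. b (prod_encode (k, j)))) UNIV"
    by (simp add: K_def)
  have [measurable]: "(\<lambda>b j. b (prod_encode (k, j))) \<in> measurable coins coins" for k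
    by (rule measurable_PiM_single') (auto simp: space_PiM)
  have rv: "(\<lambda>b. bval (\<lambda>j. b (prod_encode (k, j)))) \<in> measurable coins unif" for k
    by measurable
  have marg: "distr coins unif (\<lambda>b. bval (\<lambda>j. b (prod_encode (k, j)))) = unif" for k
  proof -
    have "distr coins coins (\<lambda>b j. b (prod_encode (k, j))) = coins"
      using distr_PiM_reindex[of UNIV "\<lambda>_. coin" "\<lambda>j. prod_encode (k, j)" UNIV]
      by (simp add: prob_space_measure_pmf inj_on_def restrict_UNIV)
    then have "distr (distr coins coins (\<lambda>b j. b (prod_encode (k, j)))) unif bval = unif"
      using distr_bval by simp
    then show ?thesis by (subst (asm) distr_distr) (auto simp: comp_def)
  qed
  have "distr unif (PiM UNIV (\<lambda>_. unif)) seed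
     = distr unif (PiM UNIV (\<lambda>_. unif)) ((\<lambda>b k. bval (\<lambda>j. b (prod_encode (k, j)))) \<circ> bits)"
    by (simp add: seed_def[abs_def] comp_def)
  also have "\<dots> = distr (distr unif coins bits) (PiM UNIV (\<lambda>_. unif)) (\<lambda>b k. bval (\<lambda>j. b (prod_encode (k, j))))"
    by (rule distr_distr[symmetric]) (auto intro!: measurable_PiM_single' simp: space_PiM)
  also have "\<dots> = distr coins (PiM UNIV (\<lambda>_. unif)) (\<lambda>b. \<lambda>k\<in>UNIV. bval (\<lambda>j. b (prod_encode (k, j))))"
    by (simp add: distr_bits restrict_UNIV)
  also have "\<dots> = PiM UNIV (\<lambda>k. distr coins unif (\<lambda>b. bval (\<lambda>j. b (prod_encode (k, j)))))"
    using ind C.indep_vars_iff_distr_eq_PiM[where X="\<lambda>k b. bval (\<lambda>j. b (prod_encode (k, j)))" and M'="\<lambda>_. unif" and I=UNIV, OF _ rv] by simp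
  finally show ?thesis by (simp add: marg)
qed

text \<open>Later used with \<open>f\<close> the arrival rank at fixed times: attaching marks by
  position gives the items i.i.d. marks.\<close>

lemma distr_seed_perm:
  assumes "inj_on f I"
  shows "distr unif (PiM I (\<lambda>_. unif)) (\<lambda>r. \<lambda>i\<in>I. seed r (f i)) = PiM I (\<lambda>_. unif)"
proof -
  have "PiM I (\<lambda>_. unif) = distr (PiM UNIV (\<lambda>_. unif)) (PiM I (\<lambda>_. unif)) (\<lambda>u. \<lambda>i\<in>I. u (f i))"
    using distr_PiM_reindex[of UNIV "\<lambda>_. unif" f I] assms by (simp add: prob_space_unif)
  also have "\<dots> = distr (distr unif (PiM UNIV (\<lambda>_. unif)) seed) (PiM I (\<lambda>_. unif)) (\<lambda>u. \<lambda>i\<in>I. u (f i))"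
    by (simp only: distr_seed)
  also have "\<dots> = distr unif (PiM I (\<lambda>_. unif)) (\<lambda>r. \<lambda>i\<in>I. seed r (f i))"
    by (subst distr_distr)
       (auto simp: comp_def space_PiM cong: restrict_cong intro!: measurable_restrict measurable_PiM_single')
  finally show ?thesis ..
qed


text \<open>Regroups two independent vectors into one vector of independent pairs. It is applied
  twice, to join marks to values and then times to the result. Each induction step splits off one
  coordinate of both vectors and swaps two integrals.\<close>

lemma nn_integral_PiM_pair:
  assumes I: "finite I" and M: "\<And>i. prob_space (M i)" and N: "\<And>i. prob_space (N i)"
    and f: "f \<in> borel_measurable (PiM I (\<lambda>i. M i \<Otimes>\<^sub>M N i))"
  shows "(\<integral>\<^sup>+x. (\<integral>\<^sup>+y. f (\<lambda>i\<in>I. (x i, y i)) \<partial>PiM I N) \<partial>PiM I M)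
     = (\<integral>\<^sup>+z. f z \<partial>PiM I (\<lambda>i. M i \<Otimes>\<^sub>M N i))"
proof -
  interpret M: prob_space "M i" for i by (rule M)
  interpret N: prob_space "N i" for i by (rule N)
  interpret MN: pair_prob_space "M i" "N i" for i ..
  interpret PM: product_prob_space M I ..
  interpret PN: product_prob_space N I ..
  interpret P: product_prob_space "\<lambda>i. M i \<Otimes>\<^sub>M N i" I ..
  show ?thesis using I f
  proof (induction I arbitrary: f rule: finite_induct)
    case empty
    then show ?case
      by (simp add: PiM_empty nn_integral_count_space_finite restrict_def)
  next
    case (insert i I)
    note [measurable] = insert.prems
    interpret PMI: prob_space "PiM I M" by (intro prob_space_PiM M)
    interpret PNI: prob_space "PiM I N" by (intro prob_space_PiM N)
    interpret PNI': prob_space "PiM (insert i I) N" by (intro prob_space_PiM N)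
    interpret P': prob_space "PiM I (\<lambda>i. M i \<Otimes>\<^sub>M N i)"
      by (intro prob_space_PiM) (rule MN.prob_space_axioms)
    have [measurable]: "(\<lambda>z. \<lambda>j\<in>insert i I. (fst z j, snd z j)) \<in> measurable (PiM (insert i I) M \<Otimes>\<^sub>M PiM (insert i I) N) (PiM (insert i I) (\<lambda>i. M i \<Otimes>\<^sub>M N i))"
      by (rule measurable_restrict) measurable
    have eq: "(\<lambda>j\<in>insert i I. ((x(i := a)) j, (y(i := b)) j)) = (\<lambda>j\<in>I. (x j, y j))(i := (a, b))" for x y a b
      using insert.hyps by (auto simp: fun_eq_iff)
    have [measurable]: "(\<lambda>z. (\<lambda>j\<in>I. (fst (fst z) j, snd (fst z) j))(i := snd z)) \<in>
        measurable ((PiM I M \<Otimes>\<^sub>M PiM I N) \<Otimes>\<^sub>M (M i \<Otimes>\<^sub>M N i)) (PiM (insert i I) (\<lambda>i. M i \<Otimes>\<^sub>M N i))"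
      by (rule measurable_fun_upd[where J=I]) (auto intro!: measurable_restrict)
    define g where "g x y a b = f ((\<lambda>j\<in>I. (x j, y j))(i := (a, b)))" for x y a b
    have [measurable]: "(\<lambda>z. g (fst (fst z)) (snd (fst z)) (fst (snd z)) (snd (snd z)))
        \<in> borel_measurable ((PiM I M \<Otimes>\<^sub>M PiM I N) \<Otimes>\<^sub>M (M i \<Otimes>\<^sub>M N i))"
      unfolding g_def by simp measurable
    have g' [measurable (raw)]: "(\<lambda>z. g (p z) (q z) (r z) (s z)) \<in> borel_measurable L"
      if "p \<in> measurable L (PiM I M)" "q \<in> measurable L (PiM I N)" "r \<in> measurable L (M i)" "s \<in> measurable L (N i)"
      for p q r s and L :: "'z measure"
    proof -
      have "(\<lambda>z. ((p z, q z), (r z, s z))) \<in> measurable L ((PiM I M \<Otimes>\<^sub>M PiM I N) \<Otimes>\<^sub>M (M i \<Otimes>\<^sub>M N i))"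
        using that by measurable
      from measurable_compose[OF this, of "\<lambda>z. g (fst (fst z)) (snd (fst z)) (fst (snd z)) (snd (snd z))" borel]
      show ?thesis by simp
    qed
    have "(\<integral>\<^sup>+x. (\<integral>\<^sup>+y. f (\<lambda>j\<in>insert i I. (x j, y j)) \<partial>PiM (insert i I) N) \<partial>PiM (insert i I) M)
      = (\<integral>\<^sup>+a. (\<integral>\<^sup>+x. (\<integral>\<^sup>+y. f (\<lambda>j\<in>insert i I. ((x(i:=a)) j, y j)) \<partial>PiM (insert i I) N) \<partial>PiM I M) \<partial>M i)"
      using insert.hyps by (intro PM.product_nn_integral_insert_rev) auto
    also have "\<dots> = (\<integral>\<^sup>+a. (\<integral>\<^sup>+x. (\<integral>\<^sup>+b. (\<integral>\<^sup>+y. g x y a b \<partial>PiM I N) \<partial>N i) \<partial>PiM I M) \<partial>M i)"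
    proof (intro nn_integral_cong)
      fix a x assume ax [measurable, simp]: "a \<in> space (M i)" "x \<in> space (PiM I M)"
      have "(\<integral>\<^sup>+y. f (\<lambda>j\<in>insert i I. ((x(i:=a)) j, y j)) \<partial>PiM (insert i I) N)
        = (\<integral>\<^sup>+b. (\<integral>\<^sup>+y. f (\<lambda>j\<in>insert i I. ((x(i:=a)) j, (y(i:=b)) j)) \<partial>PiM I N) \<partial>N i)"
        using insert.hyps ax
        by (intro PN.product_nn_integral_insert_rev)
           (auto intro!: measurable_compose[OF _ insert.prems] measurable_restrict measurable_Pair measurable_const simp: space_PiM PiE_iff)
      then show "(\<integral>\<^sup>+y. f (\<lambda>j\<in>insert i I. ((x(i:=a)) j, y j)) \<partial>PiM (insert i I) N)
        = (\<integral>\<^sup>+b. (\<integral>\<^sup>+y. g x y a b \<partial>PiM I N) \<partial>N i)"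
        unfolding eq g_def .
    qed
    also have "\<dots> = (\<integral>\<^sup>+a. (\<integral>\<^sup>+b. (\<integral>\<^sup>+x. (\<integral>\<^sup>+y. g x y a b \<partial>PiM I N) \<partial>PiM I M) \<partial>N i) \<partial>M i)"
    proof (intro nn_integral_cong)
      fix a assume [measurable, simp]: "a \<in> space (M i)"
      interpret Q: pair_sigma_finite "PiM I M" "N i" ..
      show "(\<integral>\<^sup>+x. (\<integral>\<^sup>+b. (\<integral>\<^sup>+y. g x y a b \<partial>PiM I N) \<partial>N i) \<partial>PiM I M) = (\<integral>\<^sup>+b. (\<integral>\<^sup>+x. (\<integral>\<^sup>+y. g x y a b \<partial>PiM I N) \<partial>PiM I M) \<partial>N i)"
        by (rule Q.Fubini'[symmetric]) measurable
    qed
    also have "\<dots> = (\<integral>\<^sup>+a. (\<integral>\<^sup>+b. (\<integral>\<^sup>+z. f (z(i := (a, b))) \<partial>PiM I (\<lambda>i. M i \<Otimes>\<^sub>M N i)) \<partial>N i) \<partial>M i)"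
    proof (intro nn_integral_cong)
      fix a b assume ab: "a \<in> space (M i)" "b \<in> space (N i)"
      have "(\<lambda>z. z(i := (a, b))) \<in> measurable (PiM I (\<lambda>i. M i \<Otimes>\<^sub>M N i)) (PiM (insert i I) (\<lambda>i. M i \<Otimes>\<^sub>M N i))"
        using ab by (intro measurable_fun_upd[where J=I]) (auto simp: space_pair_measure)
      from insert.IH[OF measurable_compose[OF this insert.prems]]
      show "(\<integral>\<^sup>+x. (\<integral>\<^sup>+y. g x y a b \<partial>PiM I N) \<partial>PiM I M) = (\<integral>\<^sup>+z. f (z(i := (a, b))) \<partial>PiM I (\<lambda>i. M i \<Otimes>\<^sub>M N i))"
        unfolding g_def .
    qed
    also have "\<dots> = (\<integral>\<^sup>+c. (\<integral>\<^sup>+z. f (z(i := c)) \<partial>PiM I (\<lambda>i. M i \<Otimes>\<^sub>M N i)) \<partial>(M i \<Otimes>\<^sub>M N i))"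
    proof -
      have "(\<lambda>p. (snd p)(i := fst p)) \<in> measurable ((M i \<Otimes>\<^sub>M N i) \<Otimes>\<^sub>M PiM I (\<lambda>i. M i \<Otimes>\<^sub>M N i)) (PiM (insert i I) (\<lambda>i. M i \<Otimes>\<^sub>M N i))"
        by (rule measurable_fun_upd[where J=I]) auto
      from measurable_compose[OF this insert.prems]
      have [measurable]: "(\<lambda>p. f ((snd p)(i := fst p))) \<in> borel_measurable ((M i \<Otimes>\<^sub>M N i) \<Otimes>\<^sub>M PiM I (\<lambda>i. M i \<Otimes>\<^sub>M N i))" .
      have "(\<lambda>c. \<integral>\<^sup>+z. (\<lambda>p. f ((snd p)(i := fst p))) (c, z) \<partial>PiM I (\<lambda>i. M i \<Otimes>\<^sub>M N i)) \<in> borel_measurable (M i \<Otimes>\<^sub>M N i)"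
        by (rule P'.borel_measurable_nn_integral_fst) measurable
      from N.nn_integral_fst[OF this] show ?thesis by simp
    qed
    also have "\<dots> = (\<integral>\<^sup>+z. f z \<partial>PiM (insert i I) (\<lambda>i. M i \<Otimes>\<^sub>M N i))"
      using insert.hyps by (intro P.product_nn_integral_insert_rev[symmetric]) auto
    finally show ?case .
  qed
qed

section \<open>Lexicographic rank\<close>

definition lexlt :: "real \<times> real \<Rightarrow> real \<times> real \<Rightarrow> bool" where
  "lexlt w w' \<longleftrightarrow> fst w < fst w' \<or> fst w = fst w' \<and> snd w < snd w'"

text \<open>The mark is clamped to \<open>[0,1]\<close> so that the rank is monotone for all pairs, not just almost all.\<close>
definition lexrank :: "real measure \<Rightarrow> real \<times> real \<Rightarrow> real" where
  "lexrank F w = measure F {..<fst w} + max 0 (min 1 (snd w)) * measure F {fst w}"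

lemma lexlt_irrefl: "\<not> lexlt w w"
  by (simp add: lexlt_def)

lemma lexlt_trans: "lexlt w w' \<Longrightarrow> lexlt w' w'' \<Longrightarrow> lexlt w w''"
  by (auto simp: lexlt_def)

context
  fixes F :: "real measure"
  assumes prior: "prior F"
begin

interpretation F: prob_space F using prior by (simp add: prior_def)

lemma sets_prior: "sets F = sets borel" using prior by (simp add: prior_def)

interpretation real_distribution F
  by standard (simp add: sets_prior)

interpretation U: prob_space unif by (rule prob_space_unif)

interpretation W: pair_prob_space F unif ..

lemma lexrank_le_cdf: "lexrank F w \<le> cdf F (fst w)"
proof -
  have "cdf F (fst w) = measure F ({..<fst w} \<union> {fst w})"
    unfolding cdf_def by (rule arg_cong[where f="measure F"]) auto
  also have "\<dots> = measure F {..<fst w} + measure F {fst w}"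
    by (rule F.finite_measure_Union) (auto simp: sets_prior)
  moreover have "max 0 (min 1 (snd w)) * measure F {fst w} \<le> 1 * measure F {fst w}"
    by (rule mult_right_mono) auto
  ultimately show ?thesis by (simp add: lexrank_def)
qed

lemma lexrank_ge: "measure F {..<fst w} \<le> lexrank F w"
  by (simp add: lexrank_def)

lemma lexrank_nonneg: "0 \<le> lexrank F w"
  by (simp add: lexrank_def)

lemma lexrank_le_1: "lexrank F w \<le> 1"
  using lexrank_le_cdf[of w] cdf_bounded_prob[of "fst w"] by linarith

lemma lexrank_mono: assumes "lexlt w w'" shows "lexrank F w \<le> lexrank F w'"
proof (cases "fst w < fst w'")
  case True
  have "cdf F (fst w) \<le> measure F {..<fst w'}"
    unfolding cdf_def by (rule F.finite_measure_mono) (use True in \<open>auto simp: sets_prior\<close>)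
  then show ?thesis using lexrank_le_cdf[of w] lexrank_ge[of w'] by linarith
next
  case False
  then show ?thesis using assms
    by (auto simp: lexlt_def lexrank_def intro!: mult_right_mono)
qed

lemma lexrank_measurable: "lexrank F \<in> borel_measurable borel"
proof -
  have [measurable]: "(\<lambda>x. measure F {..<x}) \<in> borel_measurable borel"
    by (intro borel_measurable_mono monoI F.finite_measure_mono) (auto simp: sets_prior)
  have [measurable]: "(\<lambda>x. measure F {..x}) \<in> borel_measurable borel"
    by (intro borel_measurable_mono monoI F.finite_measure_mono) (auto simp: sets_prior)
  have "measure F {x} = measure F {..x} - measure F {..<x}" for x
  proof -
    have "measure F {..x} = measure F ({..<x} \<union> {x})"
      by (rule arg_cong[where f="measure F"]) auto
    also have "\<dots> = measure F {..<x} + measure F {x}"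
      by (rule F.finite_measure_Union) (auto simp: sets_prior)
    finally show ?thesis by simp
  qed
  then show ?thesis unfolding lexrank_def[abs_def] borel_prod[symmetric] by simp measurable
qed

lemma measure_lex_section:
  assumes "A \<in> sets borel"
  shows "measure (F \<Otimes>\<^sub>M unif) ({..<x} \<times> UNIV \<union> {x} \<times> A) = measure F {..<x} + measure F {x} * measure unif A"
proof -
  have "measure (F \<Otimes>\<^sub>M unif) ({..<x} \<times> UNIV \<union> {x} \<times> A)
     = measure (F \<Otimes>\<^sub>M unif) ({..<x} \<times> UNIV) + measure (F \<Otimes>\<^sub>M unif) ({x} \<times> A)"
    by (rule W.P.finite_measure_Union) (use assms in \<open>auto simp: sets_prior sets_unif intro!: pair_measureI\<close>)
  also have "measure (F \<Otimes>\<^sub>M unif) ({..<x} \<times> UNIV) = measure F {..<x} * measure unif UNIV"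
    by (simp add: measure_def U.emeasure_pair_measure_Times sets_prior sets_unif enn2real_mult)
  also have "measure (F \<Otimes>\<^sub>M unif) ({x} \<times> A) = measure F {x} * measure unif A"
    using assms by (simp add: measure_def U.emeasure_pair_measure_Times sets_prior sets_unif enn2real_mult)
  finally show ?thesis using U.prob_space by simp
qed

lemma measure_unif_lessThan: "measure unif {..<c} = max 0 (min 1 c)"
proof (cases "c < 0 \<or> 1 < c")
  case True
  then have "{0..1} \<inter> {..<c} = (if c < 0 then {} else {0..1})" by auto
  then have "emeasure unif {..<c} = (if c < 0 then 0 else 1)"
    unfolding unif_def by (simp add: divide_ennreal_def)
  then show ?thesis using True by (auto simp: measure_def)
next
  case False
  then show ?thesis by (simp add: measure_def emeasure_unif_lessThan)
qed

text \<open>The clamp in \<open>lexrank\<close> is exactly the distribution function of the mark, so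
  the rank is the lexicographic distribution function.\<close>

lemma emeasure_lexlt: "emeasure (F \<Otimes>\<^sub>M unif) {w'. lexlt w' w} = ennreal (lexrank F w)"
proof -
  have "{w'. lexlt w' w} = {..<fst w} \<times> UNIV \<union> {fst w} \<times> {..<snd w}"
    by (auto simp: lexlt_def)
  then show ?thesis
    by (simp add: W.P.emeasure_eq_measure measure_lex_section measure_unif_lessThan lexrank_def mult.commute)
qed

text \<open>At the a-quantile of the values everything to the left has rank at most a and everything
  to the right has rank at least a; only the quantile itself needs care, and there the mark splits a
  possible atom at the right mass. The strict and weak versions are enough to pin down the
  distribution afterwards.\<close>

lemma lexrank_quantile_bounds:
  assumes a: "0 < a" "a < 1"
  shows "measure (F \<Otimes>\<^sub>M unif) {w. lexrank F w < a} \<le> a"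
    and "a \<le> measure (F \<Otimes>\<^sub>M unif) {w. lexrank F w \<le> a}"
proof -
  have [measurable]: "lexrank F \<in> borel_measurable (F \<Otimes>\<^sub>M unif)"
    using lexrank_measurable by (simp add: measurable_cong_sets[OF sets_pair_measure_cong[OF sets_prior sets_unif] refl] borel_prod)
  have sp: "space (F \<Otimes>\<^sub>M unif) = UNIV" by (simp add: space_pair_measure)
  have Pi: "{w. lexrank F w < a} \<in> sets (F \<Otimes>\<^sub>M unif)" "{w. lexrank F w \<le> a} \<in> sets (F \<Otimes>\<^sub>M unif)"
  proof -
    have "{w \<in> space (F \<Otimes>\<^sub>M unif). lexrank F w < a} \<in> sets (F \<Otimes>\<^sub>M unif)"
      "{w \<in> space (F \<Otimes>\<^sub>M unif). lexrank F w \<le> a} \<in> sets (F \<Otimes>\<^sub>M unif)" by measurable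
    then show "{w. lexrank F w < a} \<in> sets (F \<Otimes>\<^sub>M unif)" "{w. lexrank F w \<le> a} \<in> sets (F \<Otimes>\<^sub>M unif)"
      by (simp_all add: sp)
  qed
  define S where "S = {x. a \<le> cdf F x}"
  \<comment> \<open>The generalized inverse of the distribution function at \<open>a\<close>. Right
    continuity gives \<open>a \<le> cdf F x0\<close>, and the left limit gives
    \<open>measure F {..<x0} \<le> a\<close>.\<close>
  define x0 where "x0 = Inf S"
  have ne: "S \<noteq> {}"
  proof -
    have "eventually (\<lambda>x. a < cdf F x) at_top"
      using order_tendstoD(1)[OF cdf_lim_at_top_prob a(2)] .
    then obtain x where "a < cdf F x" unfolding eventually_at_top_linorder by blast
    then show ?thesis unfolding S_def by (auto intro: less_imp_le)
  qed
  obtain b where b: "\<forall>x\<le>b. cdf F x < a"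
    using order_tendstoD(2)[OF cdf_lim_at_bot a(1)] unfolding eventually_at_bot_linorder by blast
  have bdd: "bdd_below S"
    using b unfolding S_def by (intro bdd_belowI[of _ b]) (smt (verit) mem_Collect_eq)
  have below: "cdf F x < a" if "x < x0" for x
    using that cInf_lower[OF _ bdd, of x] unfolding x0_def S_def by force
  have above: "a \<le> cdf F x" if "x0 < x" for x
  proof -
    from cInf_lessD[OF ne, of x] that obtain y where "y \<in> S" "y < x" unfolding x0_def by auto
    then show ?thesis using cdf_nondecreasing[of y x] by (simp add: S_def)
  qed
  have at: "a \<le> cdf F x0"
  proof -
    have "(cdf F \<longlongrightarrow> cdf F x0) (at_right x0)"
      using cdf_is_right_cont[of x0] by (simp add: continuous_within)
    then show ?thesis
      by (rule tendsto_lowerbound) (use above in \<open>auto intro!: eventually_at_rightI[of x0 "x0+1"]\<close>)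
  qed
  have left: "measure F {..<x0} \<le> a"
    using cdf_at_left[of x0]
    by (rule tendsto_upperbound) (use below in \<open>auto intro!: eventually_at_leftI[of "x0-1"] less_imp_le\<close>)
  have split: "cdf F x0 = measure F {..<x0} + measure F {x0}"
  proof -
    have "cdf F x0 = measure F ({..<x0} \<union> {x0})"
      unfolding cdf_def by (rule arg_cong[where f="measure F"]) auto
    also have "\<dots> = measure F {..<x0} + measure F {x0}"
      by (rule F.finite_measure_Union) (auto simp: sets_prior)
    finally show ?thesis .
  qed
  have hi: "a \<le> lexrank F w" if "x0 < fst w" for w
  proof -
    have "cdf F x0 \<le> measure F {..<fst w}"
      unfolding cdf_def by (rule F.finite_measure_mono) (use that in \<open>auto simp: sets_prior\<close>)
    then show ?thesis using at lexrank_ge[of w] by linarith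
  qed
  have le_x0: "fst w < x0 \<or> fst w = x0" if "lexrank F w < a" for w
    using hi[of w] that by linarith
  have lo: "lexrank F w < a" if "fst w < x0" for w
    using below[OF that] lexrank_le_cdf[of w] by linarith
  have lo': "lexrank F w \<le> a" if "fst w < x0" for w
    using lo[OF that] by simp
  have sets: "{..<x0} \<times> UNIV \<union> {x0} \<times> A \<in> sets (F \<Otimes>\<^sub>M unif)" if "A \<in> sets borel" for A
    using that by (auto simp: sets_prior sets_unif)
  have "measure (F \<Otimes>\<^sub>M unif) {w. lexrank F w < a} \<le> a \<and> a \<le> measure (F \<Otimes>\<^sub>M unif) {w. lexrank F w \<le> a}"
  proof (cases "measure F {x0} = 0")
    case True
    have "measure (F \<Otimes>\<^sub>M unif) {w. lexrank F w < a} \<le> measure (F \<Otimes>\<^sub>M unif) ({..<x0} \<times> UNIV \<union> {x0} \<times> UNIV)"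
      by (rule W.P.finite_measure_mono) (use le_x0 sets[of UNIV] in \<open>fastforce+\<close>)
    also have "\<dots> \<le> a" using left True by (subst measure_lex_section) auto
    finally have 1: "measure (F \<Otimes>\<^sub>M unif) {w. lexrank F w < a} \<le> a" .
    have "a \<le> measure (F \<Otimes>\<^sub>M unif) ({..<x0} \<times> UNIV \<union> {x0} \<times> {})"
      using at split True by (subst measure_lex_section) auto
    also have "\<dots> \<le> measure (F \<Otimes>\<^sub>M unif) {w. lexrank F w \<le> a}"
      by (rule W.P.finite_measure_mono) (use lo' Pi in auto)
    finally show ?thesis using 1 by simp
  next
    case False
    then have pos: "0 < measure F {x0}" by (simp add: zero_less_measure_iff)
    \<comment> \<open>The mark level inside the atom at which the accumulated mass is exactly
      \<open>a\<close>.\<close>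
    define c where "c = (a - measure F {..<x0}) / measure F {x0}"
    have c: "0 \<le> c" "c \<le> 1" using pos left at split by (auto simp: c_def divide_le_eq)
    have ca: "measure F {..<x0} + c * measure F {x0} = a" using pos by (simp add: c_def)
    have m: "measure (F \<Otimes>\<^sub>M unif) ({..<x0} \<times> UNIV \<union> {x0} \<times> {..c}) = a"
      using c ca by (subst measure_lex_section) (auto simp: measure_def[of unif] emeasure_unif_atMost mult.commute)
    have "snd w \<le> c" if "lexrank F w < a" "fst w = x0" for w
    proof -
      have "max 0 (min 1 (snd w)) * measure F {x0} < c * measure F {x0}"
        using that ca by (simp add: lexrank_def)
      then have "max 0 (min 1 (snd w)) < c" using pos by simp
      then show ?thesis using c by (auto simp: max_def min_def split: if_splits)
    qed
    then have "{w. lexrank F w < a} \<subseteq> {..<x0} \<times> UNIV \<union> {x0} \<times> {..c}"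
      using le_x0 by fastforce
    then have 1: "measure (F \<Otimes>\<^sub>M unif) {w. lexrank F w < a} \<le> a"
      unfolding m[symmetric] by (rule W.P.finite_measure_mono) (simp add: sets)
    have "lexrank F w \<le> a" if "snd w \<le> c" "fst w = x0" for w
    proof -
      have "max 0 (min 1 (snd w)) * measure F {x0} \<le> c * measure F {x0}"
        using that c pos by (intro mult_right_mono) auto
      then show ?thesis using that ca by (simp add: lexrank_def)
    qed
    then have "{..<x0} \<times> UNIV \<union> {x0} \<times> {..c} \<subseteq> {w. lexrank F w \<le> a}"
      using lo' by fastforce
    then have "a \<le> measure (F \<Otimes>\<^sub>M unif) {w. lexrank F w \<le> a}"
      unfolding m[symmetric] using Pi(2) m by (intro W.P.finite_measure_mono) auto
    then show ?thesis using 1 by simp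
  qed
  then show "measure (F \<Otimes>\<^sub>M unif) {w. lexrank F w < a} \<le> a"
    and "a \<le> measure (F \<Otimes>\<^sub>M unif) {w. lexrank F w \<le> a}" by auto
qed

text \<open>The probability integral transform; randomizing within atoms by the mark makes it exact
  for every prior.\<close>

lemma distr_lexrank: "distr (F \<Otimes>\<^sub>M unif) borel (lexrank F) = unif"
proof (rule cdf_unique)
  have [measurable]: "lexrank F \<in> borel_measurable (F \<Otimes>\<^sub>M unif)"
    using lexrank_measurable by (simp add: measurable_cong_sets[OF sets_pair_measure_cong[OF sets_prior sets_unif] refl] borel_prod)
  interpret D: prob_space "distr (F \<Otimes>\<^sub>M unif) borel (lexrank F)"
    by (rule W.P.prob_space_distr) measurable
  show "real_distribution (distr (F \<Otimes>\<^sub>M unif) borel (lexrank F))" by standard simp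
  show "real_distribution unif" by standard (simp add: sets_unif)
  have sp: "space (F \<Otimes>\<^sub>M unif) = UNIV" by (simp add: space_pair_measure)
  have M: "cdf (distr (F \<Otimes>\<^sub>M unif) borel (lexrank F)) a = measure (F \<Otimes>\<^sub>M unif) {w. lexrank F w \<le> a}" for a
    unfolding cdf_def by (subst measure_distr) (auto simp: sp vimage_def)
  have Pi: "{w. lexrank F w < a} \<in> sets (F \<Otimes>\<^sub>M unif)" for a
  proof -
    have "{w \<in> space (F \<Otimes>\<^sub>M unif). lexrank F w < a} \<in> sets (F \<Otimes>\<^sub>M unif)" by measurable
    then show ?thesis by (simp add: sp)
  qed
  show "cdf (distr (F \<Otimes>\<^sub>M unif) borel (lexrank F)) = cdf unif"
  proof
    fix a :: real
    consider "a < 0" | "0 \<le> a" "a < 1" | "1 \<le> a" by linarith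
    then show "cdf (distr (F \<Otimes>\<^sub>M unif) borel (lexrank F)) a = cdf unif a"
    proof cases
      case 1
      then have empty: "{w. lexrank F w \<le> a} = {}" using lexrank_nonneg by (auto simp: not_le intro: less_le_trans)
      moreover have "{0..1} \<inter> {..a} = {}" using 1 by auto
      ultimately show ?thesis unfolding M empty by (simp add: cdf_def measure_def unif_def)
    next
      case 3
      then have "{w. lexrank F w \<le> a} = UNIV" using lexrank_le_1 by (auto intro: order_trans)
      moreover have "{0..1} \<inter> {..a} = {0..1}" using 3 by auto
      ultimately show ?thesis unfolding M using W.P.prob_space sp
        by (simp add: cdf_def measure_def[of "uniform_measure _ _"] unif_def divide_ennreal_def)
    next
      case 2
      \<comment> \<open>The available upper bound concerns the strict sublevel set, so it is used at
        every b > a and b then decreases to a.\<close>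
      have "measure (F \<Otimes>\<^sub>M unif) {w. lexrank F w \<le> a} \<le> a"
      proof (rule dense_ge_bounded[of a 1])
        fix b assume b: "a < b" "b < 1"
        have "measure (F \<Otimes>\<^sub>M unif) {w. lexrank F w \<le> a} \<le> measure (F \<Otimes>\<^sub>M unif) {w. lexrank F w < b}"
          by (rule W.P.finite_measure_mono) (use b Pi in auto)
        then show "measure (F \<Otimes>\<^sub>M unif) {w. lexrank F w \<le> a} \<le> b"
          using lexrank_quantile_bounds(1)[of b] b 2 by linarith
      qed (use 2 in simp)
      moreover have "a \<le> measure (F \<Otimes>\<^sub>M unif) {w. lexrank F w \<le> a}"
        using lexrank_quantile_bounds(2)[of a] 2 by (cases "a = 0") auto
      ultimately show ?thesis unfolding M using 2
        by (simp add: cdf_def measure_def[of unif] emeasure_unif_atMost)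
    qed
  qed
qed
end

section \<open>The threshold algorithm\<close>

definition accepts :: "(real \<Rightarrow> real) \<Rightarrow> real measure \<Rightarrow> real \<times> real \<Rightarrow> real \<Rightarrow> bool" where
  "accepts Q Ft w t \<longleftrightarrow> Q t < lexrank Ft w"

text \<open>Marks are indexed by the position \<open>j\<close> in the history, since this is all
  that an online rule can observe; \<open>length h - 1\<close> is the position of the current
  value.\<close>

definition threshold_rule :: "(real \<Rightarrow> real) \<Rightarrow> real measure \<Rightarrow> real \<Rightarrow> (real \<times> real) list \<Rightarrow> bool" where
  "threshold_rule Q Ft r h =
     (let k = length h - 1; w = (\<lambda>j. (snd (h ! j), seed r j))
      in accepts Q Ft (w k) (fst (h ! k)) \<and> (\<forall>j<k. lexlt (w j) (w k)))"

definition arrival_rank :: "nat \<Rightarrow> (nat \<Rightarrow> real) \<Rightarrow> nat \<Rightarrow> nat" where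
  "arrival_rank n t i = card {j. j < n \<and> t j < t i}"

text \<open>Value and mark form the first component, the arrival time is the second.\<close>

type_synonym item = "(real \<times> real) \<times> real"

definition candidate :: "(real \<Rightarrow> real) \<Rightarrow> real measure \<Rightarrow> nat \<Rightarrow> (nat \<Rightarrow> item) \<Rightarrow> nat \<Rightarrow> bool" where
  "candidate Q Ft n e i \<longleftrightarrow> accepts Q Ft (fst (e i)) (snd (e i)) \<and>
     (\<forall>j<n. snd (e j) < snd (e i) \<longrightarrow> lexlt (fst (e j)) (fst (e i)))"

definition selected :: "(real \<Rightarrow> real) \<Rightarrow> real measure \<Rightarrow> nat \<Rightarrow> (nat \<Rightarrow> item) \<Rightarrow> nat \<Rightarrow> bool" where
  "selected Q Ft n e i \<longleftrightarrow> i < n \<and> candidate Q Ft n e i \<and>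
     (\<forall>j<n. snd (e j) < snd (e i) \<longrightarrow> \<not> candidate Q Ft n e j)"

text \<open>Without ties the sorted times are strictly increasing, so comparing times is the same as
  comparing positions. The last claim translates an index into the position under which its mark is
  stored.\<close>

lemma arrival_order_nth:
  assumes inj: "inj_on t {..<n}"
  defines "\<sigma> \<equiv> arrival_order n t"
  shows "length \<sigma> = n" "set \<sigma> = {..<n}" "distinct \<sigma>"
    and "\<And>j k. j < n \<Longrightarrow> k < n \<Longrightarrow> t (\<sigma> ! j) < t (\<sigma> ! k) \<longleftrightarrow> j < k"
    and "\<And>k. k < n \<Longrightarrow> arrival_rank n t (\<sigma> ! k) = k"
proof -
  show len: "length \<sigma> = n" and set: "set \<sigma> = {..<n}" and dist: "distinct \<sigma>"
    by (auto simp: \<sigma>_def arrival_order_def)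
  have "sorted (map t \<sigma>)" by (simp add: \<sigma>_def arrival_order_def)
  moreover have "distinct (map t \<sigma>)" using inj dist by (simp add: distinct_map set)
  ultimately have "sorted_wrt (<) (map t \<sigma>)" by (simp add: strict_sorted_iff)
  then have less: "t (\<sigma> ! j) < t (\<sigma> ! k)" if "j < k" "k < n" for j k
    using that len by (auto simp: sorted_wrt_iff_nth_less)
  show iff: "t (\<sigma> ! j) < t (\<sigma> ! k) \<longleftrightarrow> j < k" if "j < n" "k < n" for j k
    using less[of j k] less[of k j] that by (cases j k rule: linorder_cases) auto
  fix k assume k: "k < n"
  have "{j. j < n \<and> t j < t (\<sigma> ! k)} = (!) \<sigma> ` {..<k}"
  proof safe
    fix j assume j: "j < n" "t j < t (\<sigma> ! k)"
    then obtain l where "l < n" "j = \<sigma> ! l" using set len by (metis in_set_conv_nth lessThan_iff)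
    then show "j \<in> (!) \<sigma> ` {..<k}" using iff[of l k] j k by auto
  next
    fix l assume "l < k"
    then show "\<sigma> ! l < n" "t (\<sigma> ! l) < t (\<sigma> ! k)"
      using k iff[of l k] set len nth_mem[of l \<sigma>] by auto
  qed
  moreover have "inj_on ((!) \<sigma>) {..<k}"
    using dist len k by (auto simp: inj_on_def nth_eq_iff_index_eq)
  ultimately show "arrival_rank n t (\<sigma> ! k) = k"
    by (simp add: arrival_rank_def card_image)
qed

lemma arrival_rank_inj: "inj_on t {..<n} \<Longrightarrow> inj_on (arrival_rank n t) {..<n}"
proof (rule inj_onI)
  fix i j assume inj: "inj_on t {..<n}" and ij: "i \<in> {..<n}" "j \<in> {..<n}" "arrival_rank n t i = arrival_rank n t j"
  note A = arrival_order_nth[OF inj]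
  obtain k l where "k < n" "l < n" "i = arrival_order n t ! k" "j = arrival_order n t ! l"
    using ij A(1,2) by (metis in_set_conv_nth)
  then show "i = j" using ij(3) A(5) by simp
qed

text \<open>A translation from positions to indices: at position k the rule tests precisely whether
  item \<open>\<sigma> ! k\<close> is a candidate, and the position found by \<open>find\<close> is
  that of the earliest candidate.\<close>

lemma alg_value_selected:
  fixes x t :: "nat \<Rightarrow> real" and r :: real and n :: nat
  defines "e \<equiv> \<lambda>i. ((x i, seed r (arrival_rank n t i)), t i)"
  assumes inj: "inj_on t {..<n}" and sel: "selected Q Ft n e i"
  shows "alg_value (threshold_rule Q Ft) n x t r = x i"
proof -
  note A = arrival_order_nth[OF inj]
  define \<sigma> where "\<sigma> = arrival_order n t"
  define h where "h = history n x t"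
  have h: "length h = n" "\<And>k. k < n \<Longrightarrow> h ! k = (t (\<sigma> ! k), x (\<sigma> ! k))"
    using A(1) by (auto simp: h_def history_def \<sigma>_def)
  have dec: "threshold_rule Q Ft r (take (Suc k) h) \<longleftrightarrow> candidate Q Ft n e (\<sigma> ! k)" if k: "k < n" for k
  proof -
    have len: "length (take (Suc k) h) - 1 = k" using k h(1) by simp
    have nth: "take (Suc k) h ! j = (t (\<sigma> ! j), x (\<sigma> ! j))" if "j \<le> k" for j
      using that k h by simp
    have e: "e (\<sigma> ! j) = ((x (\<sigma> ! j), seed r j), t (\<sigma> ! j))" if "j < n" for j
      using that A(5) by (simp add: e_def \<sigma>_def)
    have "(\<forall>j<k. lexlt (x (\<sigma> ! j), seed r j) (x (\<sigma> ! k), seed r k)) \<longleftrightarrow>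
      (\<forall>j<n. snd (e j) < snd (e (\<sigma> ! k)) \<longrightarrow> lexlt (fst (e j)) (fst (e (\<sigma> ! k))))" (is "?L \<longleftrightarrow> ?R")
    proof
      assume ?L
      show ?R
      proof safe
        fix j assume j: "j < n" "snd (e j) < snd (e (\<sigma> ! k))"
        obtain l where l: "l < n" "j = \<sigma> ! l" using A(1,2) j unfolding \<sigma>_def by (metis in_set_conv_nth lessThan_iff)
        have "l < k" using A(4)[of l k] l k j by (simp add: e_def \<sigma>_def)
        then show "lexlt (fst (e j)) (fst (e (\<sigma> ! k)))" using \<open>?L\<close> e[of l] e[of k] k l by simp
      qed
    next
      assume R: ?R
      show ?L
      proof safe
        fix j assume j: "j < k"
        have "\<sigma> ! j < n" using A(1,2) j k nth_mem[of j \<sigma>] unfolding \<sigma>_def by auto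
        then show "lexlt (x (\<sigma> ! j), seed r j) (x (\<sigma> ! k), seed r k)"
          using R j k A(4)[of j k] e[of j] e[of k] by (auto simp: \<sigma>_def)
      qed
    qed
    then show ?thesis using e[of k] k
      unfolding threshold_rule_def candidate_def Let_def len by (simp add: nth h(2))
  qed
  obtain k where k: "k < n" "i = \<sigma> ! k"
    using A(1,2) sel unfolding selected_def \<sigma>_def by (metis in_set_conv_nth lessThan_iff)
  have "find (\<lambda>k. threshold_rule Q Ft r (take (Suc k) h)) [0..<n] = Some k"
    unfolding find_Some_iff
  proof (intro exI[of _ k] conjI allI impI)
    show "k < length [0..<n]" "k = [0..<n] ! k" using k by auto
    show "threshold_rule Q Ft r (take (Suc ([0..<n] ! k)) h)"
      using dec[of k] k sel by (simp add: selected_def)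
    fix j assume j: "j < k"
    have "\<sigma> ! j < n" using A(1,2) j k nth_mem[of j \<sigma>] unfolding \<sigma>_def by auto
    then have "\<not> candidate Q Ft n e (\<sigma> ! j)"
      using sel A(4)[of j k] j k by (auto simp: selected_def e_def \<sigma>_def)
    then show "\<not> threshold_rule Q Ft r (take (Suc ([0..<n] ! j)) h)"
      using dec[of j] j k by simp
  qed
  then show ?thesis using k h(2)[of k] by (simp add: alg_value_def h_def)
qed

lemma selected_unique:
  assumes "inj_on (\<lambda>i. snd (e i)) {..<n}" "selected Q Ft n e i" "selected Q Ft n e j"
  shows "i = j"
  using assms by (cases "snd (e i)" "snd (e j)" rule: linorder_cases) (auto simp: selected_def inj_on_def)

text \<open>A sufficient condition for selecting item \<open>c\<close> against competitors \<open>J\<close>: either all of them arrive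
  later, or the best earlier one, \<open>j\<close>, is below \<open>c\<close> and rejected. The condition depends on the seed only
  through the marks, and the cases for different \<open>j\<close> are disjoint.\<close>
definition blocked :: "(real \<Rightarrow> real) \<Rightarrow> real measure \<Rightarrow> item \<Rightarrow> nat set \<Rightarrow> (nat \<Rightarrow> item) \<Rightarrow> nat \<Rightarrow> bool" where
  "blocked Q Ft c J e j \<longleftrightarrow> snd (e j) < snd c \<and> \<not> accepts Q Ft (fst (e j)) (snd (e j)) \<and>
     lexlt (fst (e j)) (fst c) \<and> (\<forall>k\<in>J - {j}. snd c < snd (e k) \<or> lexlt (fst (e k)) (fst (e j)))"

definition winning :: "(real \<Rightarrow> real) \<Rightarrow> real measure \<Rightarrow> item \<Rightarrow> nat set \<Rightarrow> (nat \<Rightarrow> item) \<Rightarrow> bool" where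
  "winning Q Ft c J e \<longleftrightarrow> accepts Q Ft (fst c) (snd c) \<and>
     ((\<forall>k\<in>J. snd c < snd (e k)) \<or> (\<exists>j\<in>J. blocked Q Ft c J e j))"

text \<open>The rejected blocker j shields item i from every other earlier item k. If k comes after
  j it is not a record, being below j. If k comes before j it has a smaller rank and faces a cutoff
  at least as high, so it is rejected because j is.\<close>

lemma winning_selected:
  assumes Ft: "prior Ft" and Q: "antimono Q" and i: "i < n"
    and inj: "inj_on (\<lambda>i. snd (e i)) {..<n}"
    and win: "winning Q Ft (e i) ({..<n} - {i}) e"
  shows "selected Q Ft n e i"
proof (cases "\<forall>k\<in>{..<n} - {i}. snd (e i) < snd (e k)")
  case True
  then have "\<not> snd (e k) < snd (e i)" if "k < n" for k
    using that by (cases "k = i") (auto dest: less_asym)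
  then show ?thesis using win i by (auto simp: selected_def candidate_def winning_def)
next
  case False
  then obtain j where j: "j < n" "j \<noteq> i" and b: "blocked Q Ft (e i) ({..<n} - {i}) e j"
    using win by (auto simp: winning_def)
  have bj: "snd (e j) < snd (e i)" "\<not> accepts Q Ft (fst (e j)) (snd (e j))" "lexlt (fst (e j)) (fst (e i))"
    using b by (auto simp: blocked_def)
  have bk: "lexlt (fst (e k)) (fst (e j))" if "k < n" "snd (e k) < snd (e i)" "k \<noteq> j" for k
  proof -
    have "k \<in> {..<n} - {i} - {j}" using that by auto
    then have "snd (e i) < snd (e k) \<or> lexlt (fst (e k)) (fst (e j))"
      using b unfolding blocked_def by blast
    then show ?thesis using that(2) by auto
  qed
  have "lexlt (fst (e k)) (fst (e i))" if "k < n" "snd (e k) < snd (e i)" for k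
    using bk[OF that] bj(3) lexlt_trans by (cases "k = j") blast+
  moreover have "\<not> candidate Q Ft n e k" if k: "k < n" "snd (e k) < snd (e i)" for k
  proof
    assume c: "candidate Q Ft n e k"
    have "k \<noteq> j" using c bj(2) by (auto simp: candidate_def)
    then have l: "lexlt (fst (e k)) (fst (e j))" using bk[OF k] by simp
    have "snd (e j) \<noteq> snd (e k)" using inj \<open>k \<noteq> j\<close> k j by (auto simp: inj_on_def)
    \<comment> \<open>First case: k is no record after j. Second case: antitonicity of
      \<open>Q\<close> together with monotonicity of the predicted rank transfers the acceptance of
      k to j.\<close>
    then consider "snd (e j) < snd (e k)" | "snd (e k) < snd (e j)" by linarith
    then show False
    proof cases
      case 1
      then have "lexlt (fst (e j)) (fst (e k))" using c j by (auto simp: candidate_def)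
      then show False using l lexlt_trans lexlt_irrefl by blast
    next
      case 2
      have "Q (snd (e j)) \<le> Q (snd (e k))" using 2 Q by (auto simp: antimono_def)
      also have "\<dots> < lexrank Ft (fst (e k))" using c by (simp add: candidate_def accepts_def)
      also have "\<dots> \<le> lexrank Ft (fst (e j))" by (rule lexrank_mono[OF Ft l])
      finally show False using bj(2) by (simp add: accepts_def)
    qed
  qed
  ultimately show ?thesis using win i by (auto simp: selected_def candidate_def winning_def)
qed

text \<open>Winning items are selected and the selected item is unique, so at most one summand
  survives, and it equals the value obtained by the rule.\<close>

lemma alg_value_ge_winning:
  fixes x t :: "nat \<Rightarrow> real" and r :: real and n :: nat
  defines "e \<equiv> \<lambda>i. ((x i, seed r (arrival_rank n t i)), t i)"
  assumes Ft: "prior Ft" and Q: "antimono Q" and inj: "inj_on t {..<n}"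
  shows "(\<Sum>i<n. ennreal (x i) * indicator {e. winning Q Ft (e i) ({..<n} - {i}) e} e)
    \<le> ennreal (alg_value (threshold_rule Q Ft) n x t r)"
proof (cases "\<exists>i<n. winning Q Ft (e i) ({..<n} - {i}) e")
  case True
  have inj': "inj_on (\<lambda>i. snd (e i)) {..<n}" using inj by (simp add: e_def)
  obtain i where i: "i < n" "winning Q Ft (e i) ({..<n} - {i}) e" using True by blast
  have sel: "selected Q Ft n e i" using winning_selected[of Ft Q i n e] Ft Q inj' i by simp
  have "(\<Sum>i<n. ennreal (x i) * indicator {e. winning Q Ft (e i) ({..<n} - {i}) e} e)
     = (\<Sum>j<n. if j = i then ennreal (x i) else 0)"
  proof (rule sum.cong[OF refl])
    fix j assume j: "j \<in> {..<n}"
    have "winning Q Ft (e j) ({..<n} - {j}) e \<longleftrightarrow> j = i"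
      using i j selected_unique[of e n Q Ft i j] winning_selected[of Ft Q j n e] Ft Q inj' sel by auto
    then show "ennreal (x j) * indicator {e. winning Q Ft (e j) ({..<n} - {j}) e} e = (if j = i then ennreal (x i) else 0)"
      by (simp add: indicator_def)
  qed
  also have "\<dots> = ennreal (x i)" using i by simp
  finally show ?thesis
    using alg_value_selected[OF inj sel[unfolded e_def]] by simp
qed auto

section \<open>Measurability and change of sample space\<close>

text \<open>Indices outside \<open>I\<close> are included: there the coordinate is the constant
  \<open>undefined\<close>. This permits measurability statements quantified over all
  indices.\<close>

lemma component_borel_measurable:
  assumes "\<And>i. sets (M i) = sets (borel :: real measure)"
  shows "(\<lambda>x. x i) \<in> borel_measurable (PiM I M)"
proof (cases "i \<in> I")
  case True
  then have "(\<lambda>x. x i) \<in> measurable (PiM I M) (M i)" by measurable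
  then show ?thesis using assms measurable_cong_sets by blast
next
  case False
  then have "(\<lambda>x. x i) \<in> borel_measurable (PiM I M) \<longleftrightarrow> (\<lambda>x. undefined :: real) \<in> borel_measurable (PiM I M)"
    by (intro measurable_cong) (auto simp: space_PiM PiE_def extensional_def)
  then show ?thesis by simp
qed

lemma arrival_order_measurable [measurable (raw)]:
  assumes [measurable]: "\<And>i. (\<lambda>\<omega>. t \<omega> i) \<in> borel_measurable M"
  shows "(\<lambda>\<omega>. arrival_order n (t \<omega>)) \<in> measurable M (count_space UNIV)"
proof -
  have ins: "(\<lambda>\<omega>. insort_key (t \<omega>) i ys) \<in> measurable M (count_space UNIV)" for i ys
    by (induction ys) auto
  have "(\<lambda>\<omega>. sort_key (t \<omega>) xs) \<in> measurable M (count_space UNIV)" for xs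
  proof (induction xs)
    case (Cons i xs)
    have "(\<lambda>\<omega>. insort_key (t \<omega>) i (sort_key (t \<omega>) xs)) \<in> measurable M (count_space UNIV)"
      by (rule measurable_compose_countable[where g="\<lambda>\<omega>. sort_key (t \<omega>) xs" and f="\<lambda>ys \<omega>. insort_key (t \<omega>) i ys", OF ins Cons])
    then show ?case by simp
  qed simp
  then show ?thesis by (simp add: arrival_order_def)
qed

lemma arrival_rank_measurable [measurable (raw)]:
  assumes [measurable]: "\<And>i. (\<lambda>\<omega>. t \<omega> i) \<in> borel_measurable M"
  shows "(\<lambda>\<omega>. arrival_rank n (t \<omega>) i) \<in> measurable M (count_space UNIV)"
  unfolding arrival_rank_def
proof (induction n)
  case (Suc n)
  have "{j. j < Suc n \<and> t \<omega> j < t \<omega> i} = (if t \<omega> n < t \<omega> i then insert n {j. j < n \<and> t \<omega> j < t \<omega> i} else {j. j < n \<and> t \<omega> j < t \<omega> i})" for \<omega>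
    by (auto simp: less_Suc_eq)
  then have "card {j. j < Suc n \<and> t \<omega> j < t \<omega> i} = (if t \<omega> n < t \<omega> i then Suc (card {j. j < n \<and> t \<omega> j < t \<omega> i}) else card {j. j < n \<and> t \<omega> j < t \<omega> i})" for \<omega>
    by simp
  then show ?case using Suc by simp
qed simp

lemma lexlt_pred [measurable (raw)]:
  assumes [measurable]: "f \<in> borel_measurable M" "g \<in> borel_measurable M" "f' \<in> borel_measurable M" "g' \<in> borel_measurable M"
  shows "Measurable.pred M (\<lambda>\<omega>. lexlt (f \<omega>, g \<omega>) (f' \<omega>, g' \<omega>))"
  unfolding lexlt_def by simp

lemma lexlt_pred_pair:
  assumes [measurable]: "f \<in> measurable M (borel \<Otimes>\<^sub>M borel)" "g \<in> measurable M (borel \<Otimes>\<^sub>M borel)"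
  shows "Measurable.pred M (\<lambda>\<omega>. lexlt (f \<omega>) (g \<omega>))"
  unfolding lexlt_def by measurable

lemma antimono_borel_measurable:
  fixes Q :: "real \<Rightarrow> real"
  assumes "antimono Q" shows "Q \<in> borel_measurable borel"
proof -
  have "(\<lambda>x. - Q x) \<in> borel_measurable borel"
    by (rule borel_measurable_mono) (use assms in \<open>auto simp: mono_def antimono_def\<close>)
  from borel_measurable_uminus[OF this] show ?thesis by simp
qed

lemma accepts_pred:
  assumes Ft: "prior Ft" and Q: "antimono Q"
    and [measurable]: "w \<in> measurable M (borel \<Otimes>\<^sub>M borel)" "t \<in> borel_measurable M"
  shows "Measurable.pred M (\<lambda>\<omega>. accepts Q Ft (w \<omega>) (t \<omega>))"
proof -
  note [measurable] = antimono_borel_measurable[OF Q] lexrank_measurable[OF Ft, folded borel_prod]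
  show ?thesis unfolding accepts_def by measurable
qed

text \<open>The arrival order takes values in a countable type. Once it is frozen to a list
  \<sigma>, the outcome is a finite case distinction over measurable tests.\<close>

lemma alg_value_measurable:
  assumes Ft: "prior Ft" and Q: "antimono Q"
    and [measurable]: "\<And>i. (\<lambda>\<omega>. x \<omega> i) \<in> borel_measurable M" "\<And>i. (\<lambda>\<omega>. t \<omega> i) \<in> borel_measurable M"
      "r \<in> borel_measurable M"
  shows "(\<lambda>\<omega>. alg_value (threshold_rule Q Ft) n (x \<omega>) (t \<omega>) (r \<omega>)) \<in> borel_measurable M"
proof -
  define h where "h \<sigma> \<omega> = map (\<lambda>i. (t \<omega> i, x \<omega> i)) \<sigma>" for \<sigma> \<omega>
  define acc where "acc \<sigma> k \<omega> \<longleftrightarrow> accepts Q Ft (x \<omega> (\<sigma> ! k), seed (r \<omega>) k) (t \<omega> (\<sigma> ! k)) \<and>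
    (\<forall>j<k. lexlt (x \<omega> (\<sigma> ! j), seed (r \<omega>) j) (x \<omega> (\<sigma> ! k), seed (r \<omega>) k))" for \<sigma> k \<omega>
  define f where "f \<sigma> \<omega> = (case find (\<lambda>k. acc \<sigma> k \<omega>) [0..<n] of None \<Rightarrow> 0 | Some k \<Rightarrow> x \<omega> (\<sigma> ! k))" for \<sigma> \<omega>
  have [measurable]: "Measurable.pred M (acc \<sigma> k)" for \<sigma> k
  proof -
    have [measurable]: "Measurable.pred M (\<lambda>\<omega>. accepts Q Ft (x \<omega> (\<sigma> ! k), seed (r \<omega>) k) (t \<omega> (\<sigma> ! k)))"
      by (rule accepts_pred[OF Ft Q]) measurable
    show ?thesis unfolding acc_def[abs_def] by measurable
  qed
  have [measurable]: "(\<lambda>\<omega>. find (\<lambda>k. acc \<sigma> k \<omega>) ks) \<in> measurable M (count_space UNIV)" for \<sigma> ks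
    by (induction ks) auto
  have "(\<lambda>\<omega>. case k of None \<Rightarrow> 0 | Some k \<Rightarrow> x \<omega> (\<sigma> ! k)) \<in> borel_measurable M" for k \<sigma>
    by (cases k) auto
  from measurable_compose_countable[OF this]
  have "f \<sigma> \<in> borel_measurable M" for \<sigma>
    unfolding f_def[abs_def] by measurable
  from measurable_compose_countable[OF this arrival_order_measurable[of t]]
  have "(\<lambda>\<omega>. f (arrival_order n (t \<omega>)) \<omega>) \<in> borel_measurable M" by measurable
  also have "(\<lambda>\<omega>. f (arrival_order n (t \<omega>)) \<omega>) = (\<lambda>\<omega>. alg_value (threshold_rule Q Ft) n (x \<omega>) (t \<omega>) (r \<omega>))"
  proof
    fix \<omega>
    define \<sigma> where "\<sigma> = arrival_order n (t \<omega>)"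
    have len: "length \<sigma> = n" by (simp add: \<sigma>_def arrival_order_def)
    have acc: "threshold_rule Q Ft (r \<omega>) (take (Suc k) (h \<sigma> \<omega>)) \<longleftrightarrow> acc \<sigma> k \<omega>" if "k < n" for k
    proof -
      have "length (take (Suc k) (h \<sigma> \<omega>)) - 1 = k" "\<And>j. j \<le> k \<Longrightarrow> take (Suc k) (h \<sigma> \<omega>) ! j = (t \<omega> (\<sigma> ! j), x \<omega> (\<sigma> ! j))"
        using that len by (auto simp: h_def)
      then show ?thesis unfolding threshold_rule_def acc_def Let_def by simp
    qed
    have "find (\<lambda>k. threshold_rule Q Ft (r \<omega>) (take (Suc k) (h \<sigma> \<omega>))) [0..<n] = find (\<lambda>k. acc \<sigma> k \<omega>) [0..<n]"
      by (rule find_cong) (use acc in auto)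
    moreover have "snd (h \<sigma> \<omega> ! k) = x \<omega> (\<sigma> ! k)" if "find (\<lambda>k. acc \<sigma> k \<omega>) [0..<n] = Some k" for k
      using that len by (auto simp: h_def find_Some_iff)
    ultimately show "f (arrival_order n (t \<omega>)) \<omega> = alg_value (threshold_rule Q Ft) n (x \<omega>) (t \<omega>) (r \<omega>)"
      by (auto simp: f_def alg_value_def history_def \<sigma>_def[symmetric] h_def[symmetric] split: option.splits)
  qed
  finally show ?thesis .
qed

text \<open>For two indices, fix all coordinates but one: by atomlessness the free one almost surely
  avoids the fixed value. Used both for arrival times and for marks.\<close>

lemma AE_PiM_inj_on:
  fixes f :: "'a \<Rightarrow> real"
  assumes I: "finite I" and V: "prob_space V" and [measurable]: "f \<in> borel_measurable V"
    and atomless: "\<And>c. AE v in V. f v \<noteq> c"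
  shows "AE e in PiM I (\<lambda>_. V). inj_on (\<lambda>i. f (e i)) I"
proof -
  interpret V: prob_space V by (rule V)
  interpret P: product_prob_space "\<lambda>_. V" I ..
  have "AE e in PiM I (\<lambda>_. V). f (e i) \<noteq> f (e j)" if ij: "i \<in> I" "j \<in> I" "i \<noteq> j" for i j
  proof -
    have II: "insert i (I - {i}) = I" using ij by auto
    have [measurable]: "{e \<in> space (PiM I (\<lambda>_. V)). f (e i) = f (e j)} \<in> sets (PiM I (\<lambda>_. V))"
      using ij by measurable
    have "emeasure (PiM I (\<lambda>_. V)) {e \<in> space (PiM I (\<lambda>_. V)). f (e i) = f (e j)}
      = (\<integral>\<^sup>+e. indicator {e \<in> space (PiM I (\<lambda>_. V)). f (e i) = f (e j)} e \<partial>PiM (insert i (I - {i})) (\<lambda>_. V))"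
      unfolding II by simp
    also have "\<dots> = (\<integral>\<^sup>+e. \<integral>\<^sup>+v. indicator {e \<in> space (PiM I (\<lambda>_. V)). f (e i) = f (e j)} (e(i := v)) \<partial>V \<partial>PiM (I - {i}) (\<lambda>_. V))"
    proof (rule P.product_nn_integral_insert)
      show "indicator {e \<in> space (PiM I (\<lambda>_. V)). f (e i) = f (e j)} \<in> borel_measurable (PiM (insert i (I - {i})) (\<lambda>_. V))"
        unfolding II by measurable
    qed (use I in auto)
    also have "\<dots> = (\<integral>\<^sup>+e. 0 \<partial>PiM (I - {i}) (\<lambda>_. V))"
    proof (rule nn_integral_cong)
      fix e
      have "(\<integral>\<^sup>+v. indicator {e \<in> space (PiM I (\<lambda>_. V)). f (e i) = f (e j)} (e(i := v)) \<partial>V) = (\<integral>\<^sup>+v. 0 \<partial>V)"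
        by (rule nn_integral_cong_AE) (use atomless[of "f (e j)"] ij in \<open>auto elim!: eventually_mono\<close>)
      then show "(\<integral>\<^sup>+v. indicator {e \<in> space (PiM I (\<lambda>_. V)). f (e i) = f (e j)} (e(i := v)) \<partial>V) = 0" by simp
    qed
    finally have "emeasure (PiM I (\<lambda>_. V)) {e \<in> space (PiM I (\<lambda>_. V)). f (e i) = f (e j)} = 0" by simp
    then show ?thesis by (intro AE_I[where N="{e \<in> space (PiM I (\<lambda>_. V)). f (e i) = f (e j)}"]) auto
  qed
  then have "AE e in PiM I (\<lambda>_. V). \<forall>i\<in>I. \<forall>j\<in>I. i \<noteq> j \<longrightarrow> f (e i) \<noteq> f (e j)"
    using I by (intro AE_finite_allI) auto
  then show ?thesis by eventually_elim (auto simp: inj_on_def)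
qed

abbreviation item_space :: "real measure \<Rightarrow> item measure" where
  "item_space F \<equiv> (F \<Otimes>\<^sub>M unif) \<Otimes>\<^sub>M unif"

text \<open>Replaces the given sample space by i.i.d. items. The mark of item i depends on the times
  through its arrival rank, so the seed has to be integrated out at fixed times before the
  coordinates can be regrouped.\<close>

lemma nn_integral_sample_space:
  assumes F: "prior F" and h [measurable]: "h \<in> borel_measurable (PiM {..<n} (\<lambda>_. item_space F))"
  shows "(\<integral>\<^sup>+\<omega>. h (\<lambda>i\<in>{..<n}. ((fst (fst \<omega>) i, seed (snd \<omega>) (arrival_rank n (snd (fst \<omega>)) i)), snd (fst \<omega>) i)) \<partial>sample_space n F)
    = (\<integral>\<^sup>+e. h e \<partial>PiM {..<n} (\<lambda>_. item_space F))"
proof -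
  have sF [measurable_cong]: "sets F = sets borel" using F by (simp add: prior_def)
  have spF: "space F = UNIV" using sets_eq_imp_space_eq[OF sF] by simp
  have pF: "prob_space F" using F by (simp add: prior_def)
  interpret F: prob_space F by (rule pF)
  interpret U: prob_space unif by (rule prob_space_unif)
  interpret W: pair_prob_space F unif ..
  interpret V: pair_prob_space "F \<Otimes>\<^sub>M unif" unif ..
  let ?I = "{..<n}"
  define X where "X = PiM ?I (\<lambda>_. F)"
  define T where "T = PiM ?I (\<lambda>_. unif)"
  define PW where "PW = PiM ?I (\<lambda>_. F \<Otimes>\<^sub>M unif)"
  define PV where "PV = PiM ?I (\<lambda>_. item_space F)"
  interpret X: prob_space X unfolding X_def by (intro prob_space_PiM pF)
  interpret T: prob_space T unfolding T_def by (intro prob_space_PiM prob_space_unif)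
  interpret PW: prob_space PW unfolding PW_def by (intro prob_space_PiM W.prob_space_axioms)
  interpret XT: pair_prob_space X T ..
  interpret TW: pair_prob_space PW T ..
  have [measurable]: "h \<in> borel_measurable PV" unfolding PV_def by (rule h)
  have X [measurable]: "(\<lambda>x. x i) \<in> borel_measurable X" for i
    unfolding X_def by (rule component_borel_measurable) (rule sF)
  have T [measurable]: "(\<lambda>x. x i) \<in> borel_measurable T" for i
    unfolding T_def by (rule component_borel_measurable) (rule sets_unif)
  define g where "g x t r = h (\<lambda>i\<in>?I. ((x i, seed r (arrival_rank n t i)), t i))" for x t r
  have g [measurable (raw)]: "(\<lambda>z. g (x z) (t z) (r z)) \<in> borel_measurable L"
    if [measurable]: "x \<in> measurable L X" "t \<in> measurable L T" "r \<in> borel_measurable L" for x t r and L :: "'z measure"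
  proof -
    have [measurable]: "(\<lambda>z. x z i) \<in> borel_measurable L" "(\<lambda>z. t z i) \<in> borel_measurable L" for i
      using measurable_compose[OF that(1) X] measurable_compose[OF that(2) T] by auto
    have [measurable]: "(\<lambda>z. seed (r z) (arrival_rank n (t z) i)) \<in> borel_measurable L" for i
      by (rule measurable_compose_countable[where g="\<lambda>z. arrival_rank n (t z) i" and f="\<lambda>k z. seed (r z) k"]) measurable
    have "(\<lambda>z. \<lambda>i\<in>?I. ((x z i, seed (r z) (arrival_rank n (t z) i)), t z i)) \<in> measurable L PV"
      unfolding PV_def by (rule measurable_restrict) measurable
    then show ?thesis unfolding g_def by measurable
  qed
  have "(\<integral>\<^sup>+\<omega>. g (fst (fst \<omega>)) (snd (fst \<omega>)) (snd \<omega>) \<partial>sample_space n F)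
     = (\<integral>\<^sup>+p. \<integral>\<^sup>+r. g (fst p) (snd p) r \<partial>unif \<partial>(X \<Otimes>\<^sub>M T))"
    unfolding sample_space_def unif_def[symmetric] X_def[symmetric] T_def[symmetric]
    by (subst U.nn_integral_fst[symmetric]) auto
  also have "\<dots> = (\<integral>\<^sup>+t. \<integral>\<^sup>+x. \<integral>\<^sup>+r. g x t r \<partial>unif \<partial>X \<partial>T)"
    by (subst XT.nn_integral_snd[symmetric]) auto
  \<comment> \<open>For tie-free t the arrival ranks are injective, so the seed contributes i.i.d.
    uniform marks, which are then merged with the values.\<close>
  also have "\<dots> = (\<integral>\<^sup>+t. \<integral>\<^sup>+w. h (\<lambda>i\<in>?I. (w i, t i)) \<partial>PW \<partial>T)"
  proof (rule nn_integral_cong_AE)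
    have "AE t in T. inj_on (\<lambda>i. t i) ?I"
      unfolding T_def by (rule AE_PiM_inj_on[where f="\<lambda>x. x"]) (auto intro: prob_space_unif AE_unif_neq measurable_ident_sets[OF sets_unif])
    then show "AE t in T. (\<integral>\<^sup>+x. \<integral>\<^sup>+r. g x t r \<partial>unif \<partial>X) = (\<integral>\<^sup>+w. h (\<lambda>i\<in>?I. (w i, t i)) \<partial>PW)"
      using AE_space
    proof eventually_elim
      fix t assume inj: "inj_on t ?I" and t: "t \<in> space T"
      have [measurable]: "(\<lambda>w. \<lambda>i\<in>?I. (w i, t i)) \<in> measurable PW PV"
        unfolding PV_def PW_def by (rule measurable_restrict) measurable
      have [measurable]: "(\<lambda>u. \<lambda>i\<in>?I. ((x i, u i), t i)) \<in> measurable T PV" for x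
        unfolding T_def PV_def
        by (auto intro!: measurable_restrict measurable_Pair measurable_const measurable_component_singleton simp: spF)
      have "(\<integral>\<^sup>+r. g x t r \<partial>unif) = (\<integral>\<^sup>+u. h (\<lambda>i\<in>?I. ((x i, u i), t i)) \<partial>T)" for x
      proof -
        have "(\<integral>\<^sup>+u. h (\<lambda>i\<in>?I. ((x i, u i), t i)) \<partial>T)
          = (\<integral>\<^sup>+u. h (\<lambda>i\<in>?I. ((x i, u i), t i)) \<partial>distr unif T (\<lambda>r. \<lambda>i\<in>?I. seed r (arrival_rank n t i)))"
          using distr_seed_perm[OF arrival_rank_inj[OF inj]] by (simp add: T_def)
        also have "\<dots> = (\<integral>\<^sup>+r. h (\<lambda>i\<in>?I. ((x i, (\<lambda>i\<in>?I. seed r (arrival_rank n t i)) i), t i)) \<partial>unif)"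
        proof (rule nn_integral_distr)
          show "(\<lambda>r. \<lambda>i\<in>?I. seed r (arrival_rank n t i)) \<in> measurable unif T"
            unfolding T_def by (rule measurable_restrict) measurable
        qed measurable
        also have "\<dots> = (\<integral>\<^sup>+r. g x t r \<partial>unif)"
          unfolding g_def by (intro nn_integral_cong arg_cong[where f=h]) auto
        finally show ?thesis ..
      qed
      then have "(\<integral>\<^sup>+x. \<integral>\<^sup>+r. g x t r \<partial>unif \<partial>X)
         = (\<integral>\<^sup>+x. \<integral>\<^sup>+u. h (\<lambda>i\<in>?I. ((\<lambda>i\<in>?I. (x i, u i)) i, t i)) \<partial>T \<partial>X)"
        by (auto intro!: nn_integral_cong arg_cong[where f=h])
      also have "\<dots> = (\<integral>\<^sup>+w. h (\<lambda>i\<in>?I. (w i, t i)) \<partial>PW)"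
        unfolding X_def T_def PW_def
        by (rule nn_integral_PiM_pair[where f="\<lambda>w. h (\<lambda>i\<in>?I. (w i, t i))"])
           (auto intro: pF prob_space_unif simp flip: PW_def)
      finally show "(\<integral>\<^sup>+x. \<integral>\<^sup>+r. g x t r \<partial>unif \<partial>X) = (\<integral>\<^sup>+w. h (\<lambda>i\<in>?I. (w i, t i)) \<partial>PW)" .
    qed
  qed
  also have "\<dots> = (\<integral>\<^sup>+w. \<integral>\<^sup>+t. h (\<lambda>i\<in>?I. (w i, t i)) \<partial>T \<partial>PW)"
  proof (rule TW.Fubini')
    have "(\<lambda>p. \<lambda>i\<in>?I. (fst p i, snd p i)) \<in> measurable (PW \<Otimes>\<^sub>M T) PV"
      unfolding PW_def T_def PV_def by (rule measurable_restrict) measurable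
    then have "(\<lambda>p. h (\<lambda>i\<in>?I. (fst p i, snd p i))) \<in> borel_measurable (PW \<Otimes>\<^sub>M T)" by measurable
    then show "(\<lambda>(w, t). h (\<lambda>i\<in>?I. (w i, t i))) \<in> borel_measurable (PW \<Otimes>\<^sub>M T)"
      by (simp add: split_beta)
  qed
  also have "\<dots> = (\<integral>\<^sup>+e. h e \<partial>PV)"
    unfolding PW_def T_def PV_def
    by (rule nn_integral_PiM_pair) (auto intro: W.prob_space_axioms prob_space_unif)
  finally show ?thesis by (simp add: g_def PV_def)
qed

section \<open>Selection probability\<close>

lemma emeasure_PiM_all:
  assumes J: "finite J" and V: "prob_space V" and [measurable]: "Measurable.pred V P"
  shows "emeasure (PiM J (\<lambda>_. V)) {e \<in> space (PiM J (\<lambda>_. V)). \<forall>k\<in>J. P (e k)}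
    = emeasure V {v \<in> space V. P v} ^ card J"
proof -
  interpret V: prob_space V by (rule V)
  interpret P: product_prob_space "\<lambda>_. V" J ..
  have "{e \<in> space (PiM J (\<lambda>_. V)). \<forall>k\<in>J. P (e k)} = PiE J (\<lambda>_. {v \<in> space V. P v})"
    by (auto simp: space_PiM PiE_iff extensional_def)
  then show ?thesis using J by (simp add: P.emeasure_PiM)
qed

lemma nn_integral_unif_affine_power:
  assumes t: "0 < t" "t \<le> 1" and c: "0 \<le> c" "c \<le> 1"
  shows "(\<integral>\<^sup>+a. ennreal ((1 - t + t * a) ^ m) * indicator {..<c} a \<partial>unif)
    = ennreal (((1 - t + t * c) ^ Suc m - (1 - t) ^ Suc m) / (real (Suc m) * t))"
proof -
  have "(\<integral>\<^sup>+a. ennreal ((1 - t + t * a) ^ m) * indicator {..<c} a \<partial>unif)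
     = (\<integral>\<^sup>+a. ennreal ((1 - t + t * a) ^ m) * indicator {..<c} a * indicator {0..1} a \<partial>lborel)"
    by (rule nn_integral_unif) measurable
  also have "\<dots> = (\<integral>\<^sup>+a. ennreal ((1 - t + t * a) ^ m) * indicator {0..c} a \<partial>lborel)"
    by (rule nn_integral_cong_AE)
       (use AE_lborel_singleton[of c] c in \<open>auto simp: indicator_def elim!: eventually_mono\<close>)
  also have "\<dots> = ennreal ((1 - t + t * c) ^ Suc m / (real (Suc m) * t) - (1 - t + t * 0) ^ Suc m / (real (Suc m) * t))"
  proof (rule nn_integral_FTC_Icc[where F="\<lambda>a. (1 - t + t * a) ^ Suc m / (real (Suc m) * t)"])
    fix a assume a: "a \<in> {0..c}"
    show "((\<lambda>a. (1 - t + t * a) ^ Suc m / (real (Suc m) * t)) has_real_derivative (1 - t + t * a) ^ m) (at a)"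
      using t by (auto intro!: derivative_eq_intros simp: divide_simps simp del: power_Suc)
    show "0 \<le> (1 - t + t * a) ^ m" using t a by (intro zero_le_power) auto
  qed (use c in auto)
  finally show ?thesis by (simp add: diff_divide_distrib)
qed

locale prior_values =
  fixes F :: "real measure"
  assumes F: "prior F"
begin

sublocale F: prob_space F using F by (simp add: prior_def)
sublocale U: prob_space unif by (rule prob_space_unif)
sublocale W: pair_prob_space F unif ..
sublocale V: pair_prob_space "F \<Otimes>\<^sub>M unif" unif ..

lemma sets_F [measurable_cong]: "sets F = sets borel" using F by (simp add: prior_def)

lemma space_F [simp]: "space F = UNIV"
  using sets_eq_imp_space_eq[OF sets_F] by simp

lemma space_item [simp]: "space (F \<Otimes>\<^sub>M unif) = UNIV" "space (item_space F) = UNIV"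
  by (simp_all add: space_pair_measure)

lemma items_borel [measurable]: "fst \<in> measurable (item_space F) (borel \<Otimes>\<^sub>M borel)" "snd \<in> borel_measurable (item_space F)"
  by measurable

lemma lexrank_measurable_W [measurable]: "lexrank F \<in> borel_measurable (F \<Otimes>\<^sub>M unif)"
  using lexrank_measurable[OF F] by (simp add: measurable_cong_sets[OF sets_pair_measure_cong[OF sets_F sets_unif] refl] borel_prod)

text \<open>The complementary split "below at any time" or "not below but late" has disjoint parts
  of mass p and (1 - p)(1 - t).\<close>

lemma emeasure_later_or_below:
  assumes t: "0 \<le> t" "t \<le> 1"
  shows "emeasure (item_space F) {v. t < snd v \<or> lexlt (fst v) w} = ennreal (1 - t + t * lexrank F w)"
proof -
  let ?p = "lexrank F w"
  have [measurable]: "Measurable.pred (F \<Otimes>\<^sub>M unif) (\<lambda>w'. lexlt w' w)"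
    by (rule lexlt_pred_pair) (auto simp: space_pair_measure intro!: measurable_const)
  have L [measurable]: "{w'. lexlt w' w} \<in> sets (F \<Otimes>\<^sub>M unif)"
    using measurable_sets_Collect by (metis (no_types, lifting) \<open>Measurable.pred (F \<Otimes>\<^sub>M unif) (\<lambda>w'. lexlt w' w)\<close> predE space_item(1) Collect_cong UNIV_I)
  have L' [measurable]: "{w'. \<not> lexlt w' w} \<in> sets (F \<Otimes>\<^sub>M unif)"
    using sets.compl_sets[OF L] by (simp add: Compl_eq_Diff_UNIV[symmetric] Collect_neg_eq)
  have mL: "measure (F \<Otimes>\<^sub>M unif) {w'. lexlt w' w} = ?p"
    using emeasure_lexlt[OF F, of w] lexrank_nonneg[OF F, of w] by (simp add: measure_def)
  have "{w'. \<not> lexlt w' w} = space (F \<Otimes>\<^sub>M unif) - {w'. lexlt w' w}" by auto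
  then have mL': "measure (F \<Otimes>\<^sub>M unif) {w'. \<not> lexlt w' w} = 1 - ?p"
    using W.P.prob_compl[OF L] mL by simp
  have "{v. t < snd v \<or> lexlt (fst v) w} = {w'. lexlt w' w} \<times> UNIV \<union> {w'. \<not> lexlt w' w} \<times> {t<..}"
    by auto
  then have "measure (item_space F) {v. t < snd v \<or> lexlt (fst v) w}
     = measure (item_space F) ({w'. lexlt w' w} \<times> UNIV) + measure (item_space F) ({w'. \<not> lexlt w' w} \<times> {t<..})"
    using L L' by (auto intro!: V.P.finite_measure_Union simp: sets_unif)
  also have "measure (item_space F) ({w'. lexlt w' w} \<times> UNIV) = ?p * 1"
    using L mL U.emeasure_space_1 by (simp add: measure_def U.emeasure_pair_measure_Times sets_unif enn2real_mult)
  also have "measure (item_space F) ({w'. \<not> lexlt w' w} \<times> {t<..}) = (1 - ?p) * (1 - t)"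
    using L' mL' t by (simp add: measure_def U.emeasure_pair_measure_Times sets_unif enn2real_mult emeasure_unif_greaterThan)
  finally have "measure (item_space F) {v. t < snd v \<or> lexlt (fst v) w} = 1 - t + t * ?p"
    by (simp add: algebra_simps)
  then show ?thesis by (simp add: V.P.emeasure_eq_measure)
qed

text \<open>The true rank of a pair is uniform by \<open>distr_lexrank\<close>, so at each arrival
  time s the integral over pairs becomes an elementary integral over a in [0, c(s)).\<close>

lemma nn_integral_below_c:
  assumes t: "0 < t" "t \<le> 1" and [measurable]: "c \<in> borel_measurable borel" and c: "\<And>s. 0 \<le> c s \<and> c s \<le> 1"
  shows "(\<integral>\<^sup>+v. ennreal ((1 - t + t * lexrank F (fst v)) ^ m) * indicator {v. 0 \<le> snd v \<and> snd v < t \<and> lexrank F (fst v) < c (snd v)} v \<partial>item_space F)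
    = (\<integral>\<^sup>+s. ennreal (((1 - t + t * c s) ^ Suc m - (1 - t) ^ Suc m) / (real (Suc m) * t)) * indicator {0..t} s \<partial>lborel)"
proof -
  define f where "f s a = (if 0 \<le> s \<and> s < t \<and> a < c s then ennreal ((1 - t + t * a) ^ m) else 0)" for s a
  have [measurable]: "case_prod f \<in> borel_measurable (borel \<Otimes>\<^sub>M borel)"
    unfolding f_def split_beta by measurable
  have f_meas [measurable (raw)]: "(\<lambda>z. f (x z) (y z)) \<in> borel_measurable L"
    if [measurable]: "x \<in> borel_measurable L" "y \<in> borel_measurable L" for x y and L :: "'z measure"
    unfolding f_def by measurable
  have "(\<integral>\<^sup>+v. ennreal ((1 - t + t * lexrank F (fst v)) ^ m) * indicator {v. 0 \<le> snd v \<and> snd v < t \<and> lexrank F (fst v) < c (snd v)} v \<partial>item_space F)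
     = (\<integral>\<^sup>+v. f (snd v) (lexrank F (fst v)) \<partial>item_space F)"
    by (intro nn_integral_cong) (auto simp: f_def indicator_def)
  also have "\<dots> = (\<integral>\<^sup>+s. \<integral>\<^sup>+w. f s (lexrank F w) \<partial>(F \<Otimes>\<^sub>M unif) \<partial>unif)"
    by (subst V.nn_integral_snd[symmetric]) auto
  also have "\<dots> = (\<integral>\<^sup>+s. \<integral>\<^sup>+a. f s a \<partial>unif \<partial>unif)"
  proof (rule nn_integral_cong)
    fix s
    have "(\<integral>\<^sup>+a. f s a \<partial>unif) = (\<integral>\<^sup>+a. f s a \<partial>distr (F \<Otimes>\<^sub>M unif) borel (lexrank F))"
      by (simp only: distr_lexrank[OF F])
    also have "\<dots> = (\<integral>\<^sup>+w. f s (lexrank F w) \<partial>(F \<Otimes>\<^sub>M unif))"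
      by (rule nn_integral_distr) measurable
    finally show "(\<integral>\<^sup>+w. f s (lexrank F w) \<partial>(F \<Otimes>\<^sub>M unif)) = (\<integral>\<^sup>+a. f s a \<partial>unif)" ..
  qed
  also have "\<dots> = (\<integral>\<^sup>+s. ennreal (((1 - t + t * c s) ^ Suc m - (1 - t) ^ Suc m) / (real (Suc m) * t)) * indicator {0..<t} s \<partial>unif)"
  proof (rule nn_integral_cong)
    fix s
    have "(\<integral>\<^sup>+a. f s a \<partial>unif) = (\<integral>\<^sup>+a. ennreal ((1 - t + t * a) ^ m) * indicator {..<c s} a \<partial>unif) * indicator {0..<t} s"
      by (cases "0 \<le> s \<and> s < t") (auto simp: f_def indicator_def intro!: nn_integral_cong)
    then show "(\<integral>\<^sup>+a. f s a \<partial>unif) = ennreal (((1 - t + t * c s) ^ Suc m - (1 - t) ^ Suc m) / (real (Suc m) * t)) * indicator {0..<t} s"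
      using t c[of s] by (simp only: nn_integral_unif_affine_power)
  qed
  also have "\<dots> = (\<integral>\<^sup>+s. ennreal (((1 - t + t * c s) ^ Suc m - (1 - t) ^ Suc m) / (real (Suc m) * t)) * indicator {0..<t} s * indicator {0..1} s \<partial>lborel)"
    by (rule nn_integral_unif) measurable
  also have "\<dots> = (\<integral>\<^sup>+s. ennreal (((1 - t + t * c s) ^ Suc m - (1 - t) ^ Suc m) / (real (Suc m) * t)) * indicator {0..t} s \<partial>lborel)"
    by (rule nn_integral_cong_AE)
       (use AE_lborel_singleton[of t] t in \<open>auto simp: indicator_def elim!: eventually_mono\<close>)
  finally show ?thesis .
qed


end

locale threshold_setting = prior_values F for F :: "real measure" +
  fixes Ft :: "real measure" and Q :: "real \<Rightarrow> real"
  assumes Ft: "prior Ft" and Q: "antimono Q"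
begin

lemma blocked_pred:
  assumes J: "finite J" "j \<in> J"
    and e: "\<And>k. k \<in> J \<Longrightarrow> (\<lambda>z. e z k) \<in> measurable M (item_space F)"
    and c [measurable]: "c \<in> measurable M (item_space F)"
  shows "Measurable.pred M (\<lambda>z. blocked Q Ft (c z) J (e z) j)"
proof -
  have comp: "(\<lambda>z. fst (e z k)) \<in> measurable M (borel \<Otimes>\<^sub>M borel)"
    "(\<lambda>z. snd (e z k)) \<in> borel_measurable M" if "k \<in> J" for k
    using measurable_compose[OF e[OF that] items_borel(1)] measurable_compose[OF e[OF that] items_borel(2)] by auto
  have [measurable]: "(\<lambda>z. fst (c z)) \<in> measurable M (borel \<Otimes>\<^sub>M borel)" "(\<lambda>z. snd (c z)) \<in> borel_measurable M"
    using measurable_compose[OF c items_borel(1)] measurable_compose[OF c items_borel(2)] by auto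
  note [measurable] = comp[OF J(2)]
  have lx: "Measurable.pred M (\<lambda>z. lexlt (fst (e z k)) (fst (e z j)))" if "k \<in> J" for k
    by (rule lexlt_pred_pair) (use comp that J in auto)
  have "Measurable.pred M (\<lambda>z. snd (c z) < snd (e z k) \<or> lexlt (fst (e z k)) (fst (e z j)))" if k: "k \<in> J" for k
  proof -
    note [measurable] = comp[OF k] lx[OF k]
    show ?thesis by measurable
  qed
  then have [measurable]: "Measurable.pred M (\<lambda>z. \<forall>k\<in>J - {j}. snd (c z) < snd (e z k) \<or> lexlt (fst (e z k)) (fst (e z j)))"
    using J by (intro pred_intros_finite) auto
  have [measurable]: "Measurable.pred M (\<lambda>z. lexlt (fst (e z j)) (fst (c z)))"
    by (rule lexlt_pred_pair) measurable
  have [measurable]: "Measurable.pred M (\<lambda>z. accepts Q Ft (fst (e z j)) (snd (e z j)))"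
    by (rule accepts_pred[OF Ft Q]) measurable
  show ?thesis unfolding blocked_def by measurable
qed

lemma winning_pred:
  assumes J: "finite J"
    and e: "\<And>k. k \<in> J \<Longrightarrow> (\<lambda>z. e z k) \<in> measurable M (item_space F)"
    and c [measurable]: "c \<in> measurable M (item_space F)"
  shows "Measurable.pred M (\<lambda>z. winning Q Ft (c z) J (e z))"
proof -
  have [measurable]: "(\<lambda>z. fst (c z)) \<in> measurable M (borel \<Otimes>\<^sub>M borel)" "(\<lambda>z. snd (c z)) \<in> borel_measurable M"
    using measurable_compose[OF c items_borel(1)] measurable_compose[OF c items_borel(2)] by auto
  have "Measurable.pred M (\<lambda>z. snd (c z) < snd (e z k))" if "k \<in> J" for k
    using measurable_compose[OF e[OF that] items_borel(2)] by measurable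
  then have [measurable]: "Measurable.pred M (\<lambda>z. \<forall>k\<in>J. snd (c z) < snd (e z k))"
    using J by (intro pred_intros_finite) auto
  have [measurable]: "Measurable.pred M (\<lambda>z. \<exists>j\<in>J. blocked Q Ft (c z) J (e z) j)"
    using J blocked_pred[OF J _ e c] by (intro pred_intros_finite) auto
  have [measurable]: "Measurable.pred M (\<lambda>z. accepts Q Ft (fst (c z)) (snd (c z)))"
    by (rule accepts_pred[OF Ft Q]) measurable
  show ?thesis unfolding winning_def by measurable
qed

text \<open>Fix competitor j at time s with rank a < c(s). By \<open>rej\<close> it is below w and
  rejected, and each of the other competitors is, independently, later than t or below j with
  probability 1 - t + t a. Integrating the resulting power over a and s gives the bound. The
  predicted prior enters through \<open>rej\<close> only.\<close>

lemma emeasure_blocked_ge: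
  assumes J: "finite J" "j \<in> J" and t: "0 < t" "t \<le> 1"
    and [measurable]: "c \<in> borel_measurable borel" and c: "\<And>s. 0 \<le> c s \<and> c s \<le> 1"
    and rej: "\<And>s w'. 0 \<le> s \<Longrightarrow> s < t \<Longrightarrow> lexrank F w' < c s \<Longrightarrow> lexlt w' w \<and> \<not> accepts Q Ft w' s"
  shows "(\<integral>\<^sup>+s. ennreal (((1 - t + t * c s) ^ card J - (1 - t) ^ card J) / (real (card J) * t)) * indicator {0..t} s \<partial>lborel)
    \<le> emeasure (PiM J (\<lambda>_. item_space F)) {e \<in> space (PiM J (\<lambda>_. item_space F)). blocked Q Ft (w, t) J e j}"
proof -
  let ?V = "item_space F"
  let ?B = "{e \<in> space (PiM J (\<lambda>_. ?V)). blocked Q Ft (w, t) J e j}"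
  let ?J = "J - {j}"
  interpret P: product_prob_space "\<lambda>_. ?V" J ..
  have JJ: "insert j ?J = J" using J by auto
  have cJ: "card J = Suc (card ?J)" using J by (metis card.remove)
  have [measurable]: "?B \<in> sets (PiM J (\<lambda>_. ?V))"
    using blocked_pred[of J j "\<lambda>e. e" "PiM J (\<lambda>_. ?V)" "\<lambda>_. (w, t)"] J by measurable
  have sp: "e(j := v) \<in> space (PiM J (\<lambda>_. ?V))" if "e \<in> space (PiM ?J (\<lambda>_. ?V))" for e v
    using that J by (auto simp: space_PiM PiE_iff extensional_def)
  have [measurable]: "Measurable.pred ?V (\<lambda>v. t < snd v \<or> lexlt (fst v) w')" for w'
  proof -
    have [measurable]: "Measurable.pred ?V (\<lambda>v. lexlt (fst v) w')"
      by (rule lexlt_pred_pair) (auto simp: space_pair_measure intro!: items_borel measurable_const)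
    show ?thesis using items_borel(2) by measurable
  qed
  have "(\<integral>\<^sup>+v. ennreal ((1 - t + t * lexrank F (fst v)) ^ card ?J) * indicator {v. 0 \<le> snd v \<and> snd v < t \<and> lexrank F (fst v) < c (snd v)} v \<partial>?V)
    \<le> (\<integral>\<^sup>+v. \<integral>\<^sup>+e. indicator ?B (e(j := v)) \<partial>PiM ?J (\<lambda>_. ?V) \<partial>?V)"
  proof (rule nn_integral_mono)
    fix v
    show "ennreal ((1 - t + t * lexrank F (fst v)) ^ card ?J) * indicator {v. 0 \<le> snd v \<and> snd v < t \<and> lexrank F (fst v) < c (snd v)} v
      \<le> (\<integral>\<^sup>+e. indicator ?B (e(j := v)) \<partial>PiM ?J (\<lambda>_. ?V))"
    proof (cases "0 \<le> snd v \<and> snd v < t \<and> lexrank F (fst v) < c (snd v)")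
      case True
      let ?A = "{e \<in> space (PiM ?J (\<lambda>_. ?V)). \<forall>k\<in>?J. t < snd (e k) \<or> lexlt (fst (e k)) (fst v)}"
      have "emeasure (PiM ?J (\<lambda>_. ?V)) ?A = emeasure ?V {v' \<in> space ?V. t < snd v' \<or> lexlt (fst v') (fst v)} ^ card ?J"
        by (rule emeasure_PiM_all) (use J in \<open>auto intro: V.prob_space_axioms\<close>)
      also have "\<dots> = ennreal (1 - t + t * lexrank F (fst v)) ^ card ?J"
        using t by (simp add: emeasure_later_or_below)
      also have "\<dots> = ennreal ((1 - t + t * lexrank F (fst v)) ^ card ?J)"
        using t lexrank_nonneg[OF F, of "fst v"] by (intro ennreal_power) auto
      finally have "ennreal ((1 - t + t * lexrank F (fst v)) ^ card ?J) = emeasure (PiM ?J (\<lambda>_. ?V)) ?A" ..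
      also have "\<dots> = (\<integral>\<^sup>+e. indicator ?A e \<partial>PiM ?J (\<lambda>_. ?V))"
      proof (rule nn_integral_indicator[symmetric])
        have "finite ?J" using J by simp
        then show "?A \<in> sets (PiM ?J (\<lambda>_. ?V))" by measurable
      qed
      also have "\<dots> \<le> (\<integral>\<^sup>+e. indicator ?B (e(j := v)) \<partial>PiM ?J (\<lambda>_. ?V))"
      proof (rule nn_integral_mono)
        fix e assume e: "e \<in> space (PiM ?J (\<lambda>_. ?V))"
        have "blocked Q Ft (w, t) J (e(j := v)) j" if "e \<in> ?A"
          using that True rej[of "snd v" "fst v"] by (auto simp: blocked_def)
        then show "indicator ?A e \<le> (indicator ?B (e(j := v)) :: ennreal)"
          using sp[OF e, of v] by (auto simp: indicator_def)
      qed
      finally show ?thesis using True by simp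
    qed simp
  qed
  also have "\<dots> = (\<integral>\<^sup>+e. indicator ?B e \<partial>PiM (insert j ?J) (\<lambda>_. ?V))"
  proof (rule P.product_nn_integral_insert_rev[symmetric])
    show "indicator ?B \<in> borel_measurable (PiM (insert j ?J) (\<lambda>_. ?V))" unfolding JJ by measurable
  qed (use J in auto)
  also have "\<dots> = emeasure (PiM J (\<lambda>_. ?V)) ?B" unfolding JJ by simp
  also have "(\<integral>\<^sup>+v. ennreal ((1 - t + t * lexrank F (fst v)) ^ card ?J) * indicator {v. 0 \<le> snd v \<and> snd v < t \<and> lexrank F (fst v) < c (snd v)} v \<partial>?V)
    = (\<integral>\<^sup>+s. ennreal (((1 - t + t * c s) ^ card J - (1 - t) ^ card J) / (real (card J) * t)) * indicator {0..t} s \<partial>lborel)"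
    unfolding cJ by (rule nn_integral_below_c) (use t c in auto)
  finally show ?thesis .
qed

text \<open>The blocking events of different j are disjoint, so summing them cancels the factor 1 /
  card J. The event that all competitors are late adds (1 - t) ^ card J, which is exactly the
  subtracted term averaged over s in [0,t].\<close>

lemma emeasure_winning_ge:
  assumes J: "finite J" and t: "0 < t" "t \<le> 1" and acc: "accepts Q Ft w t"
    and [measurable]: "c \<in> borel_measurable borel" and c: "\<And>s. 0 \<le> c s \<and> c s \<le> 1"
    and rej: "\<And>s w'. 0 \<le> s \<Longrightarrow> s < t \<Longrightarrow> lexrank F w' < c s \<Longrightarrow> lexlt w' w \<and> \<not> accepts Q Ft w' s"
  shows "(\<integral>\<^sup>+s. ennreal ((1 - t + t * c s) ^ card J / t) * indicator {0..t} s \<partial>lborel)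
    \<le> emeasure (PiM J (\<lambda>_. item_space F)) {e \<in> space (PiM J (\<lambda>_. item_space F)). winning Q Ft (w, t) J e}"
proof -
  let ?V = "item_space F"
  let ?P = "PiM J (\<lambda>_. ?V)"
  let ?N = "{e \<in> space ?P. \<forall>k\<in>J. t < snd (e k)}"
  let ?B = "\<lambda>j. {e \<in> space ?P. blocked Q Ft (w, t) J e j}"
  let ?m = "card J"
  have late [measurable]: "Measurable.pred ?V (\<lambda>v. t < snd v)" using items_borel(2) by measurable
  have N [measurable]: "?N \<in> sets ?P" using J by measurable
  have B: "?B j \<in> sets ?P" if "j \<in> J" for j
    using blocked_pred[of J j "\<lambda>e. e" ?P "\<lambda>_. (w, t)"] J that by measurable
  have eN: "emeasure ?P ?N = ennreal ((1 - t) ^ ?m)"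
  proof -
    have "{v \<in> space ?V. t < snd v} = UNIV \<times> {t<..}" by auto
    moreover have "UNIV \<in> sets (F \<Otimes>\<^sub>M unif)"
      using sets.top[of "F \<Otimes>\<^sub>M unif"] by (simp del: sets.top)
    ultimately have "emeasure ?V {v \<in> space ?V. t < snd v} = ennreal (1 - t)"
      using W.P.emeasure_space_1 t
      by (simp add: U.emeasure_pair_measure_Times sets_unif emeasure_unif_greaterThan)
    moreover have "emeasure ?P ?N = emeasure ?V {v \<in> space ?V. t < snd v} ^ ?m"
      by (rule emeasure_PiM_all) (use J in \<open>auto intro: V.prob_space_axioms\<close>)
    ultimately show ?thesis using t by (simp add: ennreal_power)
  qed
  define f where "f s = ennreal (((1 - t + t * c s) ^ ?m - (1 - t) ^ ?m) / t) * indicator {0..t} s" for s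
  have [measurable]: "f \<in> borel_measurable lborel" unfolding f_def by measurable
  have pw: "(1 - t) ^ ?m \<le> (1 - t + t * c s) ^ ?m" for s
    using t c[of s] by (intro power_mono) auto
  have "(\<integral>\<^sup>+s. f s \<partial>lborel) \<le> (\<Sum>j\<in>J. emeasure ?P (?B j))"
  \<comment> \<open>Without competitors both powers are 1 and \<open>f\<close> vanishes; otherwise
    the division by \<open>?m\<close> in the bound for a single blocker is harmless.\<close>
  proof (cases "?m = 0")
    case False
    have "(\<integral>\<^sup>+s. f s \<partial>lborel) = (\<integral>\<^sup>+s. of_nat ?m * (ennreal (((1 - t + t * c s) ^ ?m - (1 - t) ^ ?m) / (real ?m * t)) * indicator {0..t} s) \<partial>lborel)"
    proof (rule nn_integral_cong)
      fix s
      have "ennreal (((1 - t + t * c s) ^ ?m - (1 - t) ^ ?m) / t) = ennreal (real ?m * (((1 - t + t * c s) ^ ?m - (1 - t) ^ ?m) / (real ?m * t)))"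
        using False by simp
      also have "\<dots> = of_nat ?m * ennreal (((1 - t + t * c s) ^ ?m - (1 - t) ^ ?m) / (real ?m * t))"
        using pw[of s] t by (subst ennreal_mult) (auto simp: ennreal_of_nat_eq_real_of_nat)
      finally show "f s = of_nat ?m * (ennreal (((1 - t + t * c s) ^ ?m - (1 - t) ^ ?m) / (real ?m * t)) * indicator {0..t} s)"
        by (simp add: f_def mult.assoc)
    qed
    also have "\<dots> = (\<Sum>j\<in>J. \<integral>\<^sup>+s. ennreal (((1 - t + t * c s) ^ ?m - (1 - t) ^ ?m) / (real ?m * t)) * indicator {0..t} s \<partial>lborel)"
      by (subst nn_integral_cmult) auto
    also have "\<dots> \<le> (\<Sum>j\<in>J. emeasure ?P (?B j))"
      by (intro sum_mono emeasure_blocked_ge) (use J t c rej in auto)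
    finally show ?thesis .
  qed (simp add: f_def)
  moreover have "emeasure ?P (\<Union>j\<in>J. ?B j) = (\<Sum>j\<in>J. emeasure ?P (?B j))"
  proof (rule sum_emeasure[symmetric])
    show "disjoint_family_on ?B J"
      unfolding disjoint_family_on_def
    proof (intro ballI impI)
      fix i j assume ij: "i \<in> J" "j \<in> J" "i \<noteq> j"
      \<comment> \<open>Two distinct blockers both arrive before t, hence each would have to lie
        below the other.\<close>
      have "False" if "blocked Q Ft (w, t) J e i" "blocked Q Ft (w, t) J e j" for e
      proof -
        have "lexlt (fst (e j)) (fst (e i))" "lexlt (fst (e i)) (fst (e j))"
          using that ij by (force simp: blocked_def)+
        then show False using lexlt_trans lexlt_irrefl by blast
      qed
      then show "?B i \<inter> ?B j = {}" by blast
    qed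
  qed (use B J in auto)
  ultimately have fB: "(\<integral>\<^sup>+s. f s \<partial>lborel) \<le> emeasure ?P (\<Union>j\<in>J. ?B j)" by simp
  have const: "(\<integral>\<^sup>+s. ennreal ((1 - t) ^ ?m / t) * indicator {0..t} s \<partial>lborel) = ennreal ((1 - t) ^ ?m)"
    using t by (simp add: nn_integral_cmult ennreal_mult[symmetric])
  have "(\<integral>\<^sup>+s. ennreal ((1 - t + t * c s) ^ ?m / t) * indicator {0..t} s \<partial>lborel)
     = (\<integral>\<^sup>+s. ennreal ((1 - t) ^ ?m / t) * indicator {0..t} s + f s \<partial>lborel)"
  proof (rule nn_integral_cong)
    fix s
    have "ennreal ((1 - t + t * c s) ^ ?m / t) = ennreal ((1 - t) ^ ?m / t) + ennreal (((1 - t + t * c s) ^ ?m - (1 - t) ^ ?m) / t)"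
      using pw[of s] t by (subst ennreal_plus[symmetric]) (auto simp: diff_divide_distrib intro!: divide_right_mono)
    then show "ennreal ((1 - t + t * c s) ^ ?m / t) * indicator {0..t} s = ennreal ((1 - t) ^ ?m / t) * indicator {0..t} s + f s"
      by (simp add: f_def distrib_right)
  qed
  also have "\<dots> = emeasure ?P ?N + (\<integral>\<^sup>+s. f s \<partial>lborel)"
    by (subst nn_integral_add) (auto simp: const eN)
  also have "\<dots> \<le> emeasure ?P ?N + emeasure ?P (\<Union>j\<in>J. ?B j)"
    by (rule add_left_mono) (rule fB)
  also have "\<dots> = emeasure ?P (?N \<union> (\<Union>j\<in>J. ?B j))"
    by (rule plus_emeasure) (use B J in \<open>auto simp: blocked_def\<close>)
  also have "?N \<union> (\<Union>j\<in>J. ?B j) = {e \<in> space ?P. winning Q Ft (w, t) J e}"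
    using acc by (auto simp: winning_def)
  finally show ?thesis .
qed
end

text \<open>Lets coordinate i outside \<open>J\<close> be overwritten by the item under
  consideration without affecting the event.\<close>

lemma winning_cong:
  assumes "\<And>k. k \<in> J \<Longrightarrow> e k = e' k"
  shows "winning Q Ft c J e \<longleftrightarrow> winning Q Ft c J e'"
proof -
  have "blocked Q Ft c J e j \<longleftrightarrow> blocked Q Ft c J e' j" if "j \<in> J" for j
    using assms that by (auto simp: blocked_def)
  then show ?thesis using assms by (auto simp: winning_def)
qed

section \<open>Contribution of a single item to the two expectations\<close>

context threshold_setting
begin

lemma nn_integral_item_fst:
  assumes [measurable]: "f \<in> borel_measurable (F \<Otimes>\<^sub>M unif)"
  shows "(\<integral>\<^sup>+v. f (fst v) \<partial>item_space F) = (\<integral>\<^sup>+w. f w \<partial>(F \<Otimes>\<^sub>M unif))"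
  by (subst U.nn_integral_fst[symmetric]) (auto simp: U.emeasure_space_1[simplified])

lemma winning_prob_measurable:
  assumes J: "finite J"
  shows "(\<lambda>v. emeasure (PiM J (\<lambda>_. item_space F)) {e \<in> space (PiM J (\<lambda>_. item_space F)). winning Q Ft v J e})
    \<in> borel_measurable (item_space F)" (is "?pr \<in> _")
proof -
  let ?V = "item_space F"
  let ?P = "PiM J (\<lambda>_. ?V)"
  interpret PJ: prob_space ?P by (intro prob_space_PiM V.prob_space_axioms)
  have "Measurable.pred (?V \<Otimes>\<^sub>M ?P) (\<lambda>z. winning Q Ft (fst z) J (snd z))"
    by (rule winning_pred[OF J]) auto
  then have "(\<lambda>z. indicator {z. winning Q Ft (fst z) J (snd z)} z :: ennreal) \<in> borel_measurable (?V \<Otimes>\<^sub>M ?P)"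
    by (simp add: measurable_If indicator_def of_bool_def)
  from PJ.borel_measurable_nn_integral_fst[OF this]
  have "(\<lambda>v. \<integral>\<^sup>+e. indicator {z. winning Q Ft (fst z) J (snd z)} (v, e) \<partial>?P) \<in> borel_measurable ?V" .
  also have "(\<lambda>v. \<integral>\<^sup>+e. indicator {z. winning Q Ft (fst z) J (snd z)} (v, e) \<partial>?P) = ?pr"
  proof
    fix v :: item
    have "Measurable.pred ?P (\<lambda>e. winning Q Ft v J e)"
      by (rule winning_pred[OF J]) (auto simp: space_item)
    then have "{e \<in> space ?P. winning Q Ft v J e} \<in> sets ?P" by measurable
    then have "?pr v = (\<integral>\<^sup>+e. indicator {e \<in> space ?P. winning Q Ft v J e} e \<partial>?P)"
      by (rule nn_integral_indicator[symmetric])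
    then show "(\<integral>\<^sup>+e. indicator {z. winning Q Ft (fst z) J (snd z)} (v, e) \<partial>?P) = ?pr v"
      by (auto simp: indicator_def intro!: nn_integral_cong)
  qed
  finally show ?thesis .
qed

text \<open>Fubini with item i outermost: its value factors out, and what remains is the winning
  probability averaged over its arrival time, which \<open>dens\<close> bounds below.\<close>

lemma nn_integral_winning_ge:
  assumes J: "finite J" "i \<notin> J"
    and dens: "\<And>w. ennreal (\<gamma> * lexrank F w ^ card J) \<le>
      (\<integral>\<^sup>+t. emeasure (PiM J (\<lambda>_. item_space F)) {e \<in> space (PiM J (\<lambda>_. item_space F)). winning Q Ft (w, t) J e} \<partial>unif)"
  shows "(\<integral>\<^sup>+w. ennreal (fst w) * ennreal (\<gamma> * lexrank F w ^ card J) \<partial>(F \<Otimes>\<^sub>M unif))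
    \<le> (\<integral>\<^sup>+e. ennreal (fst (fst (e i))) * indicator {e. winning Q Ft (e i) J e} e \<partial>PiM (insert i J) (\<lambda>_. item_space F))"
proof -
  let ?V = "item_space F"
  let ?P = "PiM J (\<lambda>_. ?V)"
  interpret PJ: prob_space ?P by (intro prob_space_PiM V.prob_space_axioms)
  interpret P: product_prob_space "\<lambda>_. ?V" J ..
  define pr where "pr v = emeasure ?P {e \<in> space ?P. winning Q Ft v J e}" for v
  have pr [measurable]: "pr \<in> borel_measurable ?V"
    unfolding pr_def by (rule winning_prob_measurable[OF J(1)])
  have "Measurable.pred (PiM (insert i J) (\<lambda>_. ?V)) (\<lambda>e. winning Q Ft (e i) J e)"
    by (rule winning_pred[OF J(1)]) auto
  then have [measurable]: "(\<lambda>e. indicator {e. winning Q Ft (e i) J e} e :: ennreal) \<in> borel_measurable (PiM (insert i J) (\<lambda>_. ?V))"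
    by (simp add: measurable_If indicator_def of_bool_def)
  have win_upd: "winning Q Ft v J (e(i := v)) \<longleftrightarrow> winning Q Ft v J e" for v e
    by (rule winning_cong) (use J in auto)
  have "(\<integral>\<^sup>+e. ennreal (fst (fst (e i))) * indicator {e. winning Q Ft (e i) J e} e \<partial>PiM (insert i J) (\<lambda>_. ?V))
     = (\<integral>\<^sup>+v. \<integral>\<^sup>+e. ennreal (fst (fst ((e(i := v)) i))) * indicator {e. winning Q Ft (e i) J e} (e(i := v)) \<partial>?P \<partial>?V)"
    by (rule P.product_nn_integral_insert_rev) (use J in auto)
  also have "\<dots> = (\<integral>\<^sup>+v. ennreal (fst (fst v)) * pr v \<partial>?V)"
  proof (rule nn_integral_cong)
    fix v :: item
    have "Measurable.pred ?P (\<lambda>e. winning Q Ft v J e)"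
      by (rule winning_pred[OF J(1)]) (auto simp: space_item)
    then have [measurable]: "{e \<in> space ?P. winning Q Ft v J e} \<in> sets ?P" by measurable
    have "(\<integral>\<^sup>+e. ennreal (fst (fst ((e(i := v)) i))) * indicator {e. winning Q Ft (e i) J e} (e(i := v)) \<partial>?P)
      = (\<integral>\<^sup>+e. ennreal (fst (fst v)) * indicator {e \<in> space ?P. winning Q Ft v J e} e \<partial>?P)"
      by (intro nn_integral_cong) (auto simp: indicator_def win_upd)
    also have "\<dots> = ennreal (fst (fst v)) * pr v"
      unfolding pr_def by (subst nn_integral_cmult) auto
    finally show "(\<integral>\<^sup>+e. ennreal (fst (fst ((e(i := v)) i))) * indicator {e. winning Q Ft (e i) J e} (e(i := v)) \<partial>?P)
      = ennreal (fst (fst v)) * pr v" .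
  qed
  also have "\<dots> = (\<integral>\<^sup>+w. \<integral>\<^sup>+t. ennreal (fst w) * pr (w, t) \<partial>unif \<partial>(F \<Otimes>\<^sub>M unif))"
    by (subst U.nn_integral_fst[symmetric]) auto
  also have "\<dots> = (\<integral>\<^sup>+w. ennreal (fst w) * (\<integral>\<^sup>+t. pr (w, t) \<partial>unif) \<partial>(F \<Otimes>\<^sub>M unif))"
    by (intro nn_integral_cong nn_integral_cmult) (auto simp: space_pair_measure space_F)
  finally show ?thesis
    using dens by (auto simp: pr_def intro!: nn_integral_mono mult_left_mono)
qed

text \<open>Given item i, each competitor is below it with probability equal to its rank,
  independently; hence the power with exponent \<open>card J\<close>.\<close>

lemma nn_integral_best:
  assumes J: "finite J" "i \<notin> J"
  shows "(\<integral>\<^sup>+e. ennreal (fst (fst (e i))) * indicator {e. \<forall>k\<in>J. lexlt (fst (e k)) (fst (e i))} e \<partial>PiM (insert i J) (\<lambda>_. item_space F))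
    = (\<integral>\<^sup>+w. ennreal (fst w) * ennreal (lexrank F w ^ card J) \<partial>(F \<Otimes>\<^sub>M unif))"
proof -
  let ?V = "item_space F"
  let ?P = "PiM J (\<lambda>_. ?V)"
  interpret P: product_prob_space "\<lambda>_. ?V" J ..
  have "Measurable.pred (PiM (insert i J) (\<lambda>_. ?V)) (\<lambda>e. lexlt (fst (e k)) (fst (e i)))" if "k \<in> J" for k
    by (rule lexlt_pred_pair) (use that in \<open>auto intro!: measurable_compose[OF _ items_borel(1)]\<close>)
  then have "Measurable.pred (PiM (insert i J) (\<lambda>_. ?V)) (\<lambda>e. \<forall>k\<in>J. lexlt (fst (e k)) (fst (e i)))"
    using J by (intro pred_intros_finite) auto
  then have [measurable]: "(\<lambda>e. indicator {e. \<forall>k\<in>J. lexlt (fst (e k)) (fst (e i))} e :: ennreal) \<in> borel_measurable (PiM (insert i J) (\<lambda>_. ?V))"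
    by (simp add: measurable_If indicator_def of_bool_def)
  have "(\<integral>\<^sup>+e. ennreal (fst (fst (e i))) * indicator {e. \<forall>k\<in>J. lexlt (fst (e k)) (fst (e i))} e \<partial>PiM (insert i J) (\<lambda>_. ?V))
     = (\<integral>\<^sup>+v. \<integral>\<^sup>+e. ennreal (fst (fst ((e(i := v)) i))) * indicator {e. \<forall>k\<in>J. lexlt (fst (e k)) (fst (e i))} (e(i := v)) \<partial>?P \<partial>?V)"
    by (rule P.product_nn_integral_insert_rev) (use J in auto)
  also have "\<dots> = (\<integral>\<^sup>+v. ennreal (fst (fst v)) * ennreal (lexrank F (fst v) ^ card J) \<partial>?V)"
  proof (rule nn_integral_cong)
    fix v :: item
    let ?A = "{e \<in> space ?P. \<forall>k\<in>J. lexlt (fst (e k)) (fst v)}"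
    have lx [measurable]: "Measurable.pred ?V (\<lambda>v'. lexlt (fst v') (fst v))"
      by (rule lexlt_pred_pair) (auto simp: space_pair_measure intro!: items_borel measurable_const)
    have [measurable]: "?A \<in> sets ?P" using J by measurable
    have lt: "{w'. lexlt w' (fst v)} \<in> sets (F \<Otimes>\<^sub>M unif)"
    proof -
      have "Measurable.pred (F \<Otimes>\<^sub>M unif) (\<lambda>w'. lexlt w' (fst v))"
        by (rule lexlt_pred_pair) (auto simp: space_pair_measure intro!: measurable_const)
      then have "{w' \<in> space (F \<Otimes>\<^sub>M unif). lexlt w' (fst v)} \<in> sets (F \<Otimes>\<^sub>M unif)" by measurable
      then show ?thesis by (simp add: space_item)
    qed
    have "{v' \<in> space ?V. lexlt (fst v') (fst v)} = {w'. lexlt w' (fst v)} \<times> UNIV"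
      by (auto simp: space_item)
    then have "emeasure ?V {v' \<in> space ?V. lexlt (fst v') (fst v)} = ennreal (lexrank F (fst v))"
      using lt U.emeasure_space_1 by (simp add: U.emeasure_pair_measure_Times sets_unif emeasure_lexlt[OF F])
    moreover have "emeasure ?P ?A = emeasure ?V {v' \<in> space ?V. lexlt (fst v') (fst v)} ^ card J"
      by (rule emeasure_PiM_all) (use J in \<open>auto intro: V.prob_space_axioms\<close>)
    ultimately have A: "emeasure ?P ?A = ennreal (lexrank F (fst v) ^ card J)"
      by (simp add: ennreal_power lexrank_nonneg[OF F])
    have "(\<integral>\<^sup>+e. ennreal (fst (fst ((e(i := v)) i))) * indicator {e. \<forall>k\<in>J. lexlt (fst (e k)) (fst (e i))} (e(i := v)) \<partial>?P)
      = (\<integral>\<^sup>+e. ennreal (fst (fst v)) * indicator ?A e \<partial>?P)"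
      by (intro nn_integral_cong) (use J in \<open>auto simp: indicator_def\<close>)
    also have "\<dots> = ennreal (fst (fst v)) * ennreal (lexrank F (fst v) ^ card J)"
      by (subst nn_integral_cmult) (auto simp: A)
    finally show "(\<integral>\<^sup>+e. ennreal (fst (fst ((e(i := v)) i))) * indicator {e. \<forall>k\<in>J. lexlt (fst (e k)) (fst (e i))} (e(i := v)) \<partial>?P)
      = ennreal (fst (fst v)) * ennreal (lexrank F (fst v) ^ card J)" .
  qed
  also have "\<dots> = (\<integral>\<^sup>+w. ennreal (fst w) * ennreal (lexrank F w ^ card J) \<partial>(F \<Otimes>\<^sub>M unif))"
    by (rule nn_integral_item_fst[where f="\<lambda>w. ennreal (fst w) * ennreal (lexrank F w ^ card J)"]) measurable
  finally show ?thesis .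
qed
end

section \<open>Competitive ratio from densities\<close>

lemma opt_value_Suc: "opt_value (Suc n) x = max (x n) (opt_value n x)"
  by (simp add: opt_value_def lessThan_Suc insert_commute[of 0])

lemma opt_value_cong: "(\<And>i. i < n \<Longrightarrow> x i = y i) \<Longrightarrow> opt_value n x = opt_value n y"
  unfolding opt_value_def by (metis image_cong lessThan_iff)

lemma opt_value_measurable:
  assumes "\<And>i. i < n \<Longrightarrow> (\<lambda>\<omega>. x \<omega> i) \<in> borel_measurable M"
  shows "(\<lambda>\<omega>. opt_value n (x \<omega>)) \<in> borel_measurable M"
  using assms
proof (induction n)
  case 0
  then show ?case by (simp add: opt_value_def)
next
  case (Suc n)
  then show ?case unfolding opt_value_Suc by (intro borel_measurable_max) auto
qed

text \<open>Among the indices of maximal value, the one with the largest mark is lexicographically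
  best; distinct marks make it strictly so.\<close>

lemma opt_value_le_best:
  assumes inj: "inj_on (\<lambda>i. snd (fst (e i))) {..<n}"
  shows "ennreal (opt_value n (\<lambda>i. fst (fst (e i))))
    \<le> (\<Sum>i<n. ennreal (fst (fst (e i))) * indicator {e. \<forall>k\<in>{..<n} - {i}. lexlt (fst (e k)) (fst (e i))} e)"
proof (cases "n = 0")
  case False
  define x where "x i = fst (fst (e i))" for i
  define u where "u i = snd (fst (e i))" for i
  define S where "S = {i. i < n \<and> x i = Max (x ` {..<n})}"
  have "Max (x ` {..<n}) \<in> x ` {..<n}" using False by (intro Max_in) auto
  then have S: "finite S" "S \<noteq> {}" by (auto simp: S_def)
  then have "Max (u ` S) \<in> u ` S" by (intro Max_in) auto
  then obtain i where i: "i \<in> S" "u i = Max (u ` S)" by force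
  have best: "lexlt (fst (e k)) (fst (e i))" if "k < n" "k \<noteq> i" for k
  proof (cases "k \<in> S")
    case True
    then have "u k \<le> u i" using S i by simp
    moreover have "u k \<noteq> u i" using inj that i by (auto simp: u_def inj_on_def S_def)
    ultimately have "u k < u i" "x k = x i" using True i(1) by (simp_all add: S_def)
    then show ?thesis by (simp add: lexlt_def u_def x_def)
  next
    case False
    have "x k \<le> Max (x ` {..<n})" using that by (intro Max_ge) auto
    moreover have "x k \<noteq> Max (x ` {..<n})" "x i = Max (x ` {..<n})" using False i that by (auto simp: S_def)
    ultimately have "x k < x i" by linarith
    then show ?thesis by (simp add: lexlt_def x_def)
  qed
  have "opt_value n x = max 0 (x i)"
  proof -
    have "Max (insert 0 (x ` {..<n})) = max 0 (Max (x ` {..<n}))"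
      using False by (intro Max_insert) (auto simp: lessThan_empty_iff)
    then show ?thesis using i by (simp add: opt_value_def S_def)
  qed
  \<comment> \<open>A negative maximum is cut to 0 on both sides, by \<open>opt_value\<close> on the
    left and by \<open>ennreal\<close> on the right.\<close>
  then have "ennreal (opt_value n x) = ennreal (x i) * indicator {e. \<forall>k\<in>{..<n} - {i}. lexlt (fst (e k)) (fst (e i))} e"
    using best by (auto simp: max_def ennreal_neg)
  also have "\<dots> \<le> (\<Sum>i<n. ennreal (x i) * indicator {e. \<forall>k\<in>{..<n} - {i}. lexlt (fst (e k)) (fst (e i))} e)"
    by (rule member_le_sum) (use i in \<open>auto simp: S_def\<close>)
  finally show ?thesis by (simp add: x_def[abs_def])
qed (simp add: opt_value_def)

context threshold_setting
begin

text \<open>Reduces competitiveness to a density comparison valid for every w separately. By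
  symmetry each item contributes at most the same amount \<open>K\<close> to the optimum and at
  least \<gamma> times \<open>K\<close> to the algorithm.\<close>

lemma competitive_threshold_rule:
  assumes dens: "\<And>w (J :: nat set). finite J \<Longrightarrow> card J = n - 1 \<Longrightarrow>
    ennreal (\<gamma> * lexrank F w ^ (n - 1)) \<le>
      (\<integral>\<^sup>+t. emeasure (PiM J (\<lambda>_. item_space F)) {e \<in> space (PiM J (\<lambda>_. item_space F)). winning Q Ft (w, t) J e} \<partial>unif)"
  shows "competitive n (threshold_rule Q Ft) F \<gamma>"
proof -
  let ?P = "PiM {..<n} (\<lambda>_. item_space F)"
  define ex where "ex \<omega> = (\<lambda>i\<in>{..<n}. ((fst (fst \<omega>) i, seed (snd \<omega>) (arrival_rank n (snd (fst \<omega>)) i)), snd (fst \<omega>) i))"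
    for \<omega> :: "((nat \<Rightarrow> real) \<times> (nat \<Rightarrow> real)) \<times> real"
  define J where "J i = {..<n} - {i}" for i :: nat
  have J: "finite (J i)" "i \<notin> J i" "insert i (J i) = {..<n}" "card (J i) = n - 1" if "i < n" for i
    using that by (auto simp: J_def)
  define win where "win i e = ennreal (fst (fst (e i))) * indicator {e. winning Q Ft (e i) (J i) e} e" for i and e :: "nat \<Rightarrow> item"
  define D where "D = {e :: nat \<Rightarrow> item. inj_on (\<lambda>i. snd (e i)) {..<n}}"
  define K where "K = (\<integral>\<^sup>+w. ennreal (fst w) * ennreal (lexrank F w ^ (n - 1)) \<partial>(F \<Otimes>\<^sub>M unif))"
  have win [measurable]: "win i \<in> borel_measurable ?P" if i: "i < n" for i
  proof -
    have "Measurable.pred ?P (\<lambda>e. winning Q Ft (e i) (J i) e)"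
      by (rule winning_pred) (use i in \<open>auto simp: J_def\<close>)
    then have "(\<lambda>e. indicator {e. winning Q Ft (e i) (J i) e} e :: ennreal) \<in> borel_measurable ?P"
      by (simp add: measurable_If indicator_def of_bool_def)
    moreover have "(\<lambda>e. ennreal (fst (fst (e i)))) \<in> borel_measurable ?P"
    proof -
      have "i \<in> {..<n}" using i by simp
      then show ?thesis by measurable
    qed
    ultimately show ?thesis unfolding win_def by (intro borel_measurable_times_ennreal)
  qed
  have "Measurable.pred ?P (\<lambda>e. inj_on (\<lambda>i. snd (e i)) {..<n})"
    unfolding inj_on_def
  proof (intro pred_intros_finite)
    fix i j assume ij: "i \<in> {..<n}" "j \<in> {..<n}"
    have eq: "Measurable.pred ?P (\<lambda>e. f e = g e)"
      if [measurable]: "f \<in> borel_measurable ?P" "g \<in> borel_measurable ?P" for f g :: "_ \<Rightarrow> real"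
      unfolding pred_def by measurable
    have "(\<lambda>e. snd (e i)) \<in> borel_measurable ?P" "(\<lambda>e. snd (e j)) \<in> borel_measurable ?P"
      using measurable_compose[OF measurable_component_singleton[OF ij(1)] items_borel(2)]
        measurable_compose[OF measurable_component_singleton[OF ij(2)] items_borel(2)] by auto
    from eq[OF this] show "Measurable.pred ?P (\<lambda>e. snd (e i) = snd (e j) \<longrightarrow> i = j)"
      by (cases "i = j") simp_all
  qed auto
  then have D [measurable]: "(\<lambda>e. indicator D e :: ennreal) \<in> borel_measurable ?P"
    by (simp add: D_def measurable_If indicator_def of_bool_def)
  have AED: "AE e in ?P. e \<in> D"
    unfolding D_def mem_Collect_eq
  proof (rule AE_PiM_inj_on)
    fix c
    have "AE v in item_space F. snd v \<noteq> c"
    proof (rule V.AE_pair_measure)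
      show "{v \<in> space (item_space F). snd v \<noteq> c} \<in> sets (item_space F)" by measurable
    qed (simp add: AE_unif_neq)
    then show "AE v in item_space F. snd v \<noteq> c" .
  qed (auto intro: V.prob_space_axioms)
  \<comment> \<open>The restriction to the almost sure set \<open>D\<close> of tie-free times is
    inserted here because the later comparison with the algorithm is pointwise and fails to be
    available at ties.\<close>
  have "(\<Sum>i<n. \<integral>\<^sup>+e. win i e \<partial>?P) = (\<integral>\<^sup>+e. (\<Sum>i<n. win i e) * indicator D e \<partial>?P)"
  proof -
    have "(\<integral>\<^sup>+e. (\<Sum>i<n. win i e) * indicator D e \<partial>?P) = (\<integral>\<^sup>+e. (\<Sum>i<n. win i e) \<partial>?P)"
      by (rule nn_integral_cong_AE) (use AED in \<open>auto elim!: eventually_mono\<close>)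
    also have "\<dots> = (\<Sum>i<n. \<integral>\<^sup>+e. win i e \<partial>?P)" by (rule nn_integral_sum) auto
    finally show ?thesis ..
  qed
  also have "\<dots> = (\<integral>\<^sup>+\<omega>. (\<Sum>i<n. win i (ex \<omega>)) * indicator D (ex \<omega>) \<partial>sample_space n F)"
  proof -
    have "(\<lambda>e. (\<Sum>i<n. win i e) * indicator D e) \<in> borel_measurable ?P"
      using win D by (intro borel_measurable_times_ennreal borel_measurable_sum) auto
    from nn_integral_sample_space[OF F this] show ?thesis by (simp add: ex_def)
  qed
  also have "\<dots> \<le> (\<integral>\<^sup>+\<omega>. ennreal (alg_value (threshold_rule Q Ft) n (fst (fst \<omega>)) (snd (fst \<omega>)) (snd \<omega>)) \<partial>sample_space n F)"
  proof (rule nn_integral_mono)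
    fix \<omega> :: "((nat \<Rightarrow> real) \<times> (nat \<Rightarrow> real)) \<times> real"
    define x t r where "x = fst (fst \<omega>)" and "t = snd (fst \<omega>)" and "r = snd \<omega>"
    define e where "e i = ((x i, seed r (arrival_rank n t i)), t i)" for i
    have ex: "ex \<omega> i = e i" if "i < n" for i
      using that by (simp add: ex_def e_def x_def t_def r_def)
    show "(\<Sum>i<n. win i (ex \<omega>)) * indicator D (ex \<omega>) \<le> ennreal (alg_value (threshold_rule Q Ft) n (fst (fst \<omega>)) (snd (fst \<omega>)) (snd \<omega>))"
    proof (cases "inj_on t {..<n}")
      case True
      have "win i (ex \<omega>) = ennreal (x i) * indicator {e. winning Q Ft (e i) ({..<n} - {i}) e} e" if "i < n" for i
      proof -
        have "winning Q Ft (e i) (J i) (ex \<omega>) \<longleftrightarrow> winning Q Ft (e i) (J i) e"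
          by (rule winning_cong) (auto simp: J_def ex)
        then show ?thesis using that by (simp add: win_def ex J_def indicator_def) (simp add: e_def)
      qed
      then have "(\<Sum>i<n. win i (ex \<omega>)) = (\<Sum>i<n. ennreal (x i) * indicator {e. winning Q Ft (e i) ({..<n} - {i}) e} e)"
        by (intro sum.cong) auto
      also have "\<dots> \<le> ennreal (alg_value (threshold_rule Q Ft) n x t r)"
        using alg_value_ge_winning[OF Ft Q True, of x r] by (simp add: e_def[abs_def])
      finally show ?thesis by (auto simp: x_def t_def r_def indicator_def)
    next
      case False
      have "inj_on (\<lambda>i. snd (ex \<omega> i)) {..<n} \<longleftrightarrow> inj_on t {..<n}"
        by (rule inj_on_cong) (simp add: ex e_def)
      then show ?thesis using False by (simp add: D_def)
    qed
  qed
  finally have alg: "(\<Sum>i<n. \<integral>\<^sup>+e. win i e \<partial>?P) \<le> (\<integral>\<^sup>+\<omega>. ennreal (alg_value (threshold_rule Q Ft) n (fst (fst \<omega>)) (snd (fst \<omega>)) (snd \<omega>)) \<partial>sample_space n F)" .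

  have "ennreal \<gamma> * K \<le> (\<integral>\<^sup>+e. win i e \<partial>?P)" if i: "i < n" for i
  proof (cases "0 \<le> \<gamma>")
    case True
    have "ennreal \<gamma> * K = (\<integral>\<^sup>+w. ennreal (fst w) * ennreal (\<gamma> * lexrank F w ^ card (J i)) \<partial>(F \<Otimes>\<^sub>M unif))"
      unfolding K_def J(4)[OF i] using True
      by (subst nn_integral_cmult[symmetric]) (auto simp: ennreal_mult lexrank_nonneg[OF F] mult_ac)
    also have "\<dots> \<le> (\<integral>\<^sup>+e. win i e \<partial>?P)"
      unfolding win_def J(3)[OF i, symmetric]
      using J[OF i] dens by (intro nn_integral_winning_ge) auto
    finally show ?thesis .
  qed (simp add: ennreal_neg)
  then have "(\<Sum>i<n. ennreal \<gamma> * K) \<le> (\<Sum>i<n. \<integral>\<^sup>+e. win i e \<partial>?P)"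
    by (intro sum_mono) auto
  then have "ennreal \<gamma> * (\<Sum>i<n. K) \<le> (\<integral>\<^sup>+\<omega>. ennreal (alg_value (threshold_rule Q Ft) n (fst (fst \<omega>)) (snd (fst \<omega>)) (snd \<omega>)) \<partial>sample_space n F)"
    using alg unfolding sum_distrib_left by (rule order_trans)
  moreover have "(\<integral>\<^sup>+\<omega>. ennreal (opt_value n (fst (fst \<omega>))) \<partial>sample_space n F) \<le> (\<Sum>i<n. K)"
  proof -
    have m: "(\<lambda>e. ennreal (opt_value n (\<lambda>i. fst (fst (e i))))) \<in> borel_measurable ?P"
      by (intro measurable_compose[OF opt_value_measurable] ) auto
    have "opt_value n (\<lambda>i. fst (fst (ex \<omega> i))) = opt_value n (fst (fst \<omega>))" for \<omega>
      by (rule opt_value_cong) (simp add: ex_def)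
    then have "(\<integral>\<^sup>+\<omega>. ennreal (opt_value n (fst (fst \<omega>))) \<partial>sample_space n F)
      = (\<integral>\<^sup>+e. ennreal (opt_value n (\<lambda>i. fst (fst (e i)))) \<partial>?P)"
      using nn_integral_sample_space[OF F m] by (simp add: ex_def[symmetric])
    also have "\<dots> \<le> (\<integral>\<^sup>+e. (\<Sum>i<n. ennreal (fst (fst (e i))) * indicator {e. \<forall>k\<in>J i. lexlt (fst (e k)) (fst (e i))} e) \<partial>?P)"
    proof (rule nn_integral_mono_AE)
      have "AE e in ?P. inj_on (\<lambda>i. snd (fst (e i))) {..<n}"
      proof (rule AE_PiM_inj_on[where f="\<lambda>v. snd (fst v)"])
        fix c
        show "AE v in item_space F. snd (fst v) \<noteq> c"
        proof (rule AE_distrD[where P="\<lambda>w. snd w \<noteq> c" and M'="F \<Otimes>\<^sub>M unif"])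
          have "AE w in F \<Otimes>\<^sub>M unif. snd w \<noteq> c"
          proof (rule W.AE_pair_measure)
            show "{w \<in> space (F \<Otimes>\<^sub>M unif). snd w \<noteq> c} \<in> sets (F \<Otimes>\<^sub>M unif)" by measurable
          qed (simp add: AE_unif_neq)
          then show "AE w in distr (item_space F) (F \<Otimes>\<^sub>M unif) fst. snd w \<noteq> c"
            by (subst U.distr_pair_fst)
        qed simp
      qed (auto intro: V.prob_space_axioms)
      then show "AE e in ?P. ennreal (opt_value n (\<lambda>i. fst (fst (e i))))
        \<le> (\<Sum>i<n. ennreal (fst (fst (e i))) * indicator {e. \<forall>k\<in>J i. lexlt (fst (e k)) (fst (e i))} e)"
        by eventually_elim (unfold J_def, rule opt_value_le_best)
    qed
    also have "\<dots> = (\<Sum>i<n. \<integral>\<^sup>+e. ennreal (fst (fst (e i))) * indicator {e. \<forall>k\<in>J i. lexlt (fst (e k)) (fst (e i))} e \<partial>?P)"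
    proof (rule nn_integral_sum)
      fix i assume i: "i \<in> {..<n}"
      have "Measurable.pred ?P (\<lambda>e. lexlt (fst (e k)) (fst (e i)))" if "k \<in> J i" for k
        by (rule lexlt_pred_pair) (use that i in \<open>auto simp: J_def intro!: measurable_compose[OF _ items_borel(1)]\<close>)
      then have "Measurable.pred ?P (\<lambda>e. \<forall>k\<in>J i. lexlt (fst (e k)) (fst (e i)))"
        using J[of i] i by (intro pred_intros_finite) auto
      then have "(\<lambda>e. indicator {e. \<forall>k\<in>J i. lexlt (fst (e k)) (fst (e i))} e :: ennreal) \<in> borel_measurable ?P"
        by (simp add: measurable_If indicator_def of_bool_def)
      moreover have "(\<lambda>e. ennreal (fst (fst (e i)))) \<in> borel_measurable ?P" using i by measurable
      ultimately show "(\<lambda>e. ennreal (fst (fst (e i))) * indicator {e. \<forall>k\<in>J i. lexlt (fst (e k)) (fst (e i))} e) \<in> borel_measurable ?P"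
        by (intro borel_measurable_times_ennreal)
    qed
    also have "\<dots> = (\<Sum>i<n. K)"
    proof (rule sum.cong[OF refl])
      fix i assume "i \<in> {..<n}"
      then show "(\<integral>\<^sup>+e. ennreal (fst (fst (e i))) * indicator {e. \<forall>k\<in>J i. lexlt (fst (e k)) (fst (e i))} e \<partial>?P) = K"
        using nn_integral_best[of "J i" i] J[of i] by (simp add: K_def)
    qed
    finally show ?thesis .
  qed
  ultimately show ?thesis
    unfolding competitive_def by (meson mult_left_mono order_trans zero_le)
qed
end

section \<open>Bounds on the averaged winning probability: at most one value, and robustness\<close>

context threshold_setting
begin

lemma not_accepts_mono:
  assumes "\<not> accepts Q Ft w t" "s \<le> t" "lexlt w' w \<or> w' = w"
  shows "\<not> accepts Q Ft w' s"
proof -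
  have "lexrank Ft w' \<le> lexrank Ft w" using assms(3) lexrank_mono[OF Ft, of w' w] by auto
  also have "\<dots> \<le> Q t" using assms(1) by (simp add: accepts_def)
  also have "\<dots> \<le> Q s" using assms(2) Q by (simp add: antimono_def)
  finally show ?thesis by (simp add: accepts_def)
qed

text \<open>The lexicographic order is total and ranks are monotone in it. This turns a condition on
  true ranks into an order relation, which any other prior's rank respects as well.\<close>

lemma lexlt_of_lexrank_less:
  assumes "lexrank F w' < lexrank F w" shows "lexlt w' w"
proof (rule ccontr)
  assume "\<not> lexlt w' w"
  then have "lexlt w w' \<or> w = w'" by (auto simp: lexlt_def prod_eq_iff)
  then have "lexrank F w \<le> lexrank F w'" using lexrank_mono[OF F, of w w'] by auto
  then show False using assms by simp
qed

text \<open>Arrival times up to z are discarded. After z acceptance is guaranteed, so the fixed-time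
  bound applies with the same \<open>c\<close> throughout.\<close>

lemma nn_integral_winning_prob_ge:
  fixes J :: "nat set"
  assumes J: "finite J" and z: "0 \<le> z" and acc: "\<And>t. z < t \<Longrightarrow> t \<le> 1 \<Longrightarrow> accepts Q Ft w t"
    and c: "c \<in> borel_measurable borel" "\<And>s. 0 \<le> c s \<and> c s \<le> 1"
    and rej: "\<And>s w'. 0 \<le> s \<Longrightarrow> lexrank F w' < c s \<Longrightarrow> lexlt w' w \<and> \<not> accepts Q Ft w' s"
  shows "(\<integral>\<^sup>+t. (\<integral>\<^sup>+s. ennreal ((1 - t + t * c s) ^ card J / t) * indicator {0..t} s \<partial>lborel) * indicator {z<..1} t \<partial>lborel)
    \<le> (\<integral>\<^sup>+t. emeasure (PiM J (\<lambda>_. item_space F)) {e \<in> space (PiM J (\<lambda>_. item_space F)). winning Q Ft (w, t) J e} \<partial>unif)"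
    (is "_ \<le> (\<integral>\<^sup>+t. ?pr (w, t) \<partial>unif)")
proof -
  have "(\<lambda>t. (w, t)) \<in> measurable borel (item_space F)"
    by (rule measurable_Pair) (auto intro!: measurable_const measurable_ident_sets sets_unif[symmetric])
  from measurable_compose[OF this winning_prob_measurable[OF J]]
  have "(\<integral>\<^sup>+t. ?pr (w, t) \<partial>unif) = (\<integral>\<^sup>+t. ?pr (w, t) * indicator {0..1} t \<partial>lborel)"
    by (rule nn_integral_unif)
  moreover have "(\<integral>\<^sup>+t. (\<integral>\<^sup>+s. ennreal ((1 - t + t * c s) ^ card J / t) * indicator {0..t} s \<partial>lborel) * indicator {z<..1} t \<partial>lborel)
    \<le> (\<integral>\<^sup>+t. ?pr (w, t) * indicator {0..1} t \<partial>lborel)"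
  proof (rule nn_integral_mono)
    fix t
    have "(\<integral>\<^sup>+s. ennreal ((1 - t + t * c s) ^ card J / t) * indicator {0..t} s \<partial>lborel) \<le> ?pr (w, t)" if "z < t" "t \<le> 1"
      by (rule emeasure_winning_ge) (use J c z that acc rej in auto)
    then show "(\<integral>\<^sup>+s. ennreal ((1 - t + t * c s) ^ card J / t) * indicator {0..t} s \<partial>lborel) * indicator {z<..1} t
      \<le> ?pr (w, t) * indicator {0..1} t"
      using z by (auto simp: indicator_def)
  qed
  ultimately show ?thesis by simp
qed

text \<open>For n \<le> 1 the exponent n - 1 is 0 and there are no competitors: accepting everything
  achieves ratio 1, while any waiting period would lose value.\<close>

lemma competitive_always:
  assumes n: "n \<le> 1" and Q0: "\<And>t. Q t < 0" and \<gamma>: "\<gamma> \<le> 1"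
  shows "competitive n (threshold_rule Q Ft) F \<gamma>"
proof (rule competitive_threshold_rule)
  fix w and J :: "nat set" assume J: "finite J" "card J = n - 1"
  then have J0: "card J = 0" "n - 1 = 0" using n by auto
  have "ennreal (\<gamma> * lexrank F w ^ (n - 1)) \<le> 1" using \<gamma> J0 by simp
  also have "1 = (\<integral>\<^sup>+t. indicator {0<..1} (t::real) \<partial>lborel)" by simp
  also have "\<dots> = (\<integral>\<^sup>+t. (\<integral>\<^sup>+s. ennreal ((1 - t + t * 0) ^ card J / t) * indicator {0..t} s \<partial>lborel) * indicator {0<..1} t \<partial>lborel)"
  proof (rule nn_integral_cong)
    fix t :: real
    show "indicator {0<..1} t = (\<integral>\<^sup>+s. ennreal ((1 - t + t * 0) ^ card J / t) * indicator {0..t} s \<partial>lborel) * indicator {0<..1} t"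
      unfolding J0 by (cases "0 < t \<and> t \<le> 1") (auto simp: nn_integral_cmult ennreal_mult[symmetric])
  qed
  also have "\<dots> \<le> (\<integral>\<^sup>+t. emeasure (PiM J (\<lambda>_. item_space F)) {e \<in> space (PiM J (\<lambda>_. item_space F)). winning Q Ft (w, t) J e} \<partial>unif)"
  proof (rule nn_integral_winning_prob_ge[OF J(1)])
    show "accepts Q Ft w t" for t
      using Q0[of t] lexrank_nonneg[OF Ft, of w] by (simp add: accepts_def)
    show "lexlt w' w \<and> \<not> accepts Q Ft w' s" if "lexrank F w' < 0" for s w'
      using that lexrank_nonneg[OF F, of w'] by simp
  qed auto
  finally show "ennreal (\<gamma> * lexrank F w ^ (n - 1)) \<le> \<dots>" .
qed

text \<open>Let z be the time from which w passes its cutoff. Everything below w is rejected before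
  z, so only s < z is counted, with c = p there. Since 1 - t + t p \<ge> p, the inner integral is at
  least z p ^ (n - 1) / t, and integrating over t in [z,1] yields - z ln z times the optimum
  density.\<close>

lemma competitive_robust:
  assumes l: "0 < l1" "l1 \<le> l2" "l2 \<le> 1"
    and early: "\<And>s. s < l1 \<Longrightarrow> 1 \<le> Q s" and late: "\<And>s. l2 < s \<Longrightarrow> Q s < 0"
    and \<beta>: "\<And>z. l1 \<le> z \<Longrightarrow> z \<le> l2 \<Longrightarrow> \<beta> \<le> - z * ln z"
  shows "competitive n (threshold_rule Q Ft) F \<beta>"
proof (rule competitive_threshold_rule)
  fix w and J :: "nat set" assume J: "finite J" "card J = n - 1"
  define p where "p = lexrank F w"
  define m where "m = n - 1"
  have p: "0 \<le> p" "p \<le> 1" using lexrank_nonneg[OF F] lexrank_le_1[OF F] by (auto simp: p_def)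
  \<comment> \<open>Adding \<open>l1\<close> keeps the set nonempty. This is consistent with its
    meaning, as \<open>early\<close> rejects everything before \<open>l1\<close>, whatever the
    predicted rank.\<close>
  define S where "S = insert l1 {t \<in> {l1..l2}. \<not> accepts Q Ft w t}"
  define z where "z = Sup S"
  have S: "S \<noteq> {}" "bdd_above S" "\<And>s. s \<in> S \<Longrightarrow> s \<le> l2"
    using l by (auto simp: S_def bdd_above_def)
  have "l1 \<in> S" by (simp add: S_def)
  then have z: "l1 \<le> z" "z \<le> l2"
    unfolding z_def using S by (simp_all add: cSup_upper cSup_least)
  have acc: "accepts Q Ft w t" if "z < t" for t
  proof (rule ccontr)
    assume na: "\<not> accepts Q Ft w t"
    have "t \<le> l2" using na late[of t] lexrank_nonneg[OF Ft, of w] by (force simp: accepts_def)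
    then have "t \<in> S" using na that z by (simp add: S_def)
    then have "t \<le> z" unfolding z_def using S by (intro cSup_upper)
    then show False using that by simp
  qed
  have rej: "\<not> accepts Q Ft w' s" if "s < z" "lexlt w' w" for s w'
  proof -
    from less_cSupD[OF S(1), of s] that(1) obtain t where t: "t \<in> S" "s < t" unfolding z_def by auto
    show ?thesis
    proof (cases "t = l1")
      case True
      then show ?thesis using early[of s] t lexrank_le_1[OF Ft, of w'] by (simp add: accepts_def)
    next
      case False
      then have "\<not> accepts Q Ft w t" using t by (simp add: S_def)
      then show ?thesis using not_accepts_mono[of w t s w'] t that by simp
    qed
  qed
  \<comment> \<open>After z a lower item may be accepted, so the level 0 claims nothing there: no
    rank is below 0.\<close>
  define c where "c s = (if s < z then p else 0)" for s
  have "ennreal (\<beta> * p ^ m) \<le> ennreal (- z * ln z * p ^ m)"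
    using \<beta>[OF z] p by (intro ennreal_leI mult_right_mono) auto
  also have "\<dots> = ennreal (z * p ^ m * ln 1 - z * p ^ m * ln z)" by (simp add: mult_ac)
  also have "\<dots> = (\<integral>\<^sup>+t. ennreal (z * p ^ m * inverse t) * indicator {z..1} t \<partial>lborel)"
  proof (rule nn_integral_FTC_Icc[symmetric])
    fix t assume t: "t \<in> {z..1}"
    show "((\<lambda>t. z * p ^ m * ln t) has_real_derivative z * p ^ m * inverse t) (at t)"
      using t l z by (auto intro!: derivative_eq_intros simp: field_simps)
    show "0 \<le> z * p ^ m * inverse t" using t l z p by auto
  qed (use l z in auto)
  also have "\<dots> = (\<integral>\<^sup>+t. ennreal (z * p ^ m * inverse t) * indicator {z<..1} t \<partial>lborel)"
    by (rule nn_integral_cong_AE)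
       (use AE_lborel_singleton[of z] in \<open>auto simp: indicator_def elim!: eventually_mono\<close>)
  also have "\<dots> \<le> (\<integral>\<^sup>+t. (\<integral>\<^sup>+s. ennreal ((1 - t + t * c s) ^ card J / t) * indicator {0..t} s \<partial>lborel) * indicator {z<..1} t \<partial>lborel)"
  proof (rule nn_integral_mono)
    fix t
    show "ennreal (z * p ^ m * inverse t) * indicator {z<..1} t
      \<le> (\<integral>\<^sup>+s. ennreal ((1 - t + t * c s) ^ card J / t) * indicator {0..t} s \<partial>lborel) * indicator {z<..1} t"
    proof (cases "z < t \<and> t \<le> 1")
      case True
      then have t: "z < t" "t \<le> 1" "0 < t" using l z by auto
      have "ennreal (z * p ^ m * inverse t) = ennreal (p ^ m / t) * ennreal z"
        using t l z p by (subst ennreal_mult[symmetric]) (auto simp: field_simps)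
      also have "\<dots> = (\<integral>\<^sup>+s. ennreal (p ^ m / t) * indicator {0..<z} s \<partial>lborel)"
        using l z by (subst nn_integral_cmult) auto
      also have "\<dots> \<le> (\<integral>\<^sup>+s. ennreal ((1 - t + t * c s) ^ card J / t) * indicator {0..t} s \<partial>lborel)"
      proof (rule nn_integral_mono)
        fix s
        have "p \<le> 1 - t + t * p" using mult_left_mono[of p 1 "1 - t"] p t by (simp add: algebra_simps)
        then have "p ^ m / t \<le> (1 - t + t * p) ^ card J / t"
          using p t J by (intro divide_right_mono) (auto simp: m_def intro!: power_mono)
        then show "ennreal (p ^ m / t) * indicator {0..<z} s \<le> ennreal ((1 - t + t * c s) ^ card J / t) * indicator {0..t} s"
          using t by (auto simp: indicator_def c_def intro!: ennreal_leI)
      qed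
      finally show ?thesis using True by simp
    qed auto
  qed
  also have "\<dots> \<le> (\<integral>\<^sup>+t. emeasure (PiM J (\<lambda>_. item_space F)) {e \<in> space (PiM J (\<lambda>_. item_space F)). winning Q Ft (w, t) J e} \<partial>unif)"
  proof (rule nn_integral_winning_prob_ge[OF J(1)])
    show "c \<in> borel_measurable borel" unfolding c_def by measurable
    fix s w' assume "lexrank F w' < c s"
    then have "s < z" "lexrank F w' < lexrank F w"
      using lexrank_nonneg[OF F, of w'] by (auto simp: c_def p_def split: if_splits)
    then show "lexlt w' w \<and> \<not> accepts Q Ft w' s" using rej lexlt_of_lexrank_less by blast
  qed (use l z p acc in \<open>auto simp: c_def\<close>)
  finally show "ennreal (\<beta> * lexrank F w ^ (n - 1)) \<le> \<dots>" by (simp add: p_def m_def)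
qed
end

text \<open>By convexity x ln x lies above its tangent at z. If the slope ln z + 1 is nonnegative,
  follow the tangent to the right up to l2, otherwise to the left up to l1; in either direction it
  does not fall below z ln z.\<close>

lemma negxlnx_ge_between:
  fixes l1 l2 z :: real
  assumes l: "0 < l1" "l1 \<le> z" "z \<le> l2" and eq: "- l1 * ln l1 = \<beta>" "- l2 * ln l2 = \<beta>"
  shows "\<beta> \<le> - z * ln z"
proof -
  have tangent: "z * ln z + (ln z + 1) * (x - z) \<le> x * ln x" if "0 < x" for x
  proof -
    have "ln (z / x) \<le> z / x - 1" using that l by (intro ln_le_minus_one) auto
    then have "x * ln (z / x) \<le> x * (z / x - 1)" using that by (intro mult_left_mono) auto
    then have "x * ln z - x * ln x \<le> z - x" using that l by (simp add: ln_div algebra_simps)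
    then show ?thesis by (simp add: algebra_simps)
  qed
  show ?thesis
  proof (cases "0 \<le> ln z + 1")
    case True
    then have "0 \<le> (ln z + 1) * (l2 - z)" using l by simp
    then show ?thesis using tangent[of l2] eq l by simp
  next
    case False
    then have "0 \<le> (ln z + 1) * (l1 - z)" using l by (intro mult_nonpos_nonpos) auto
    then show ?thesis using tangent[of l1] eq l by simp
  qed
qed

section \<open>Consistency\<close>

text \<open>A non-integrable function has Bochner integral 0, so the inequality survives in this
  direction. This is how the integrals of the assumption are turned into nonnegative ones without
  integrability proofs.\<close>

lemma ennreal_integral_le_nn_integral:
  fixes f :: "'a \<Rightarrow> real"
  assumes "\<And>x. 0 \<le> f x"
  shows "ennreal (integral\<^sup>L M f) \<le> (\<integral>\<^sup>+x. ennreal (f x) \<partial>M)"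
proof (cases "integrable M f")
  case True
  then show ?thesis using assms by (simp add: nn_integral_eq_integral)
qed (simp add: not_integrable_integral_eq)

lemma ennreal_LBINT_le_nn_integral:
  fixes a b :: real and f :: "real \<Rightarrow> real"
  assumes ab: "a \<le> b" and f: "\<And>x. a < x \<Longrightarrow> x < b \<Longrightarrow> 0 \<le> f x"
  shows "ennreal (LBINT x=a..b. f x) \<le> (\<integral>\<^sup>+x. ennreal (f x) * indicator {a<..<b} x \<partial>lborel)"
proof -
  have "(LBINT x=a..b. f x) = integral\<^sup>L lborel (\<lambda>x. indicator {a<..<b} x *\<^sub>R f x)"
    using ab by (simp add: interval_lebesgue_integral_def set_lebesgue_integral_def einterval_eq)
  also have "ennreal \<dots> \<le> (\<integral>\<^sup>+x. ennreal (indicator {a<..<b} x *\<^sub>R f x) \<partial>lborel)"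
    by (rule ennreal_integral_le_nn_integral) (use f in \<open>auto simp: indicator_def\<close>)
  also have "\<dots> = (\<integral>\<^sup>+x. ennreal (f x) * indicator {a<..<b} x \<partial>lborel)"
    by (intro nn_integral_cong) (auto simp: indicator_def)
  finally show ?thesis .
qed

lemma LBINT_nonneg:
  fixes a b :: real and f :: "real \<Rightarrow> real"
  assumes ab: "a \<le> b" and f: "\<And>x. a < x \<Longrightarrow> x < b \<Longrightarrow> 0 \<le> f x"
  shows "0 \<le> (LBINT x=a..b. f x)"
proof -
  have "(LBINT x=a..b. f x) = integral\<^sup>L lborel (\<lambda>x. indicator {a<..<b} x *\<^sub>R f x)"
    using ab by (simp add: interval_lebesgue_integral_def set_lebesgue_integral_def einterval_eq)
  moreover have "0 \<le> integral\<^sup>L lborel (\<lambda>x. indicator {a<..<b} x *\<^sub>R f x)"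
    by (rule Bochner_Integration.integral_nonneg) (use f in \<open>auto simp: indicator_def\<close>)
  ultimately show ?thesis by simp
qed

text \<open>Weighted AM-GM for the numbers 1 and q with weights 1 - t and t, raised to the power m.
  It trades the winning probability for the exponent form of the assumption. At q = 0 the left side
  is 0.\<close>

lemma power_powr_le:
  fixes q t :: real
  assumes q: "0 \<le> q" and t: "0 \<le> t" "t \<le> 1" and m: "0 < m"
  shows "(q ^ m) powr t \<le> (1 - t + t * q) ^ m"
proof (cases "q = 0")
  case True
  then show ?thesis using m t by (simp add: zero_power)
next
  case False
  then have q: "0 < q" using q by simp
  have "q powr t \<le> 1 - t + t * q"
    using Youngs_inequality_0[of "1 - t" t 1 q] q t by simp
  then have "(q powr t) ^ m \<le> (1 - t + t * q) ^ m" by (intro power_mono) auto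
  moreover have "(q ^ m) powr t = (q powr t) ^ m"
    using q by (simp add: powr_realpow[symmetric] powr_powr mult.commute)
  ultimately show ?thesis by simp
qed

text \<open>Both interval integrals are replaced one after the other; the inner one has to be
  nonnegative before the outer one can be treated.\<close>

lemma nn_integral_LBINT_ge:
  fixes \<theta> :: "real \<Rightarrow> real"
  assumes z: "0 \<le> z" "z \<le> 1" and \<theta>: "\<And>s. z \<le> s \<Longrightarrow> s \<le> 1 \<Longrightarrow> 0 \<le> \<theta> s"
    and ineq: "\<gamma> \<le> (LBINT t=z..1. (LBINT s=0..t. (1 / t) * \<theta> (max s z) powr t))"
  shows "ennreal \<gamma> \<le> (\<integral>\<^sup>+t. (\<integral>\<^sup>+s. ennreal ((1 / t) * \<theta> (max s z) powr t) * indicator {0<..<t} s \<partial>lborel) * indicator {z<..1} t \<partial>lborel)"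
proof -
  have nn: "0 \<le> (1 / t) * \<theta> (max s z) powr t" if "z < t" for s t :: real
    using that z by simp
  have "ennreal \<gamma> \<le> ennreal (LBINT t=z..1. (LBINT s=0..t. (1 / t) * \<theta> (max s z) powr t))"
    using ineq by (rule ennreal_leI)
  also have "\<dots> \<le> (\<integral>\<^sup>+t. ennreal (LBINT s=0..t. (1 / t) * \<theta> (max s z) powr t) * indicator {z<..<1} t \<partial>lborel)"
    unfolding one_ereal_def zero_ereal_def
  proof (rule ennreal_LBINT_le_nn_integral)
    fix t assume "z < t"
    then show "0 \<le> (LBINT s=ereal 0..ereal t. (1 / t) * \<theta> (max s z) powr t)"
      using z by (intro LBINT_nonneg nn) auto
  qed (use z in auto)
  also have "\<dots> \<le> (\<integral>\<^sup>+t. (\<integral>\<^sup>+s. ennreal ((1 / t) * \<theta> (max s z) powr t) * indicator {0<..<t} s \<partial>lborel) * indicator {z<..1} t \<partial>lborel)"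
  proof (rule nn_integral_mono)
    fix t
    have "ennreal (LBINT s=0..t. (1 / t) * \<theta> (max s z) powr t)
      \<le> (\<integral>\<^sup>+s. ennreal ((1 / t) * \<theta> (max s z) powr t) * indicator {0<..<t} s \<partial>lborel)" if "z < t"
      unfolding zero_ereal_def using that z by (intro ennreal_LBINT_le_nn_integral nn) auto
    then show "ennreal (LBINT s=0..t. (1 / t) * \<theta> (max s z) powr t) * indicator {z<..<1} t
      \<le> (\<integral>\<^sup>+s. ennreal ((1 / t) * \<theta> (max s z) powr t) * indicator {0<..<t} s \<partial>lborel) * indicator {z<..1} t"
      by (auto simp: indicator_def)
  qed
  finally show ?thesis .
qed

locale quantile_curve =
  fixes \<theta> :: "real \<Rightarrow> real" and l1 l2 :: real
  assumes l: "0 \<le> l1" "l1 \<le> l2" "l2 \<le> 1"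
    and unit_range: "\<And>t. t \<in> {l1..l2} \<Longrightarrow> 0 \<le> \<theta> t \<and> \<theta> t \<le> 1"
    and antitone: "\<And>s t. s \<in> {l1..l2} \<Longrightarrow> t \<in> {l1..l2} \<Longrightarrow> s \<le> t \<Longrightarrow> \<theta> t \<le> \<theta> s"
    and leftcont: "\<And>t. t \<in> {l1<..l2} \<Longrightarrow> continuous (at_left t) \<theta>"
    and vanish: "\<And>t. t \<in> {l2<..1} \<Longrightarrow> \<theta> t = 0"
    and start: "\<theta> l1 = 1"
begin

lemma nonneg: "l1 \<le> t \<Longrightarrow> t \<le> 1 \<Longrightarrow> 0 \<le> \<theta> t"
  using unit_range[of t] vanish[of t] by (cases "t \<le> l2") auto

text \<open>The exponent \<open>n - 1\<close> (rather than \<open>n\<close>) makes the probability that none of the other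
  values seen before time \<open>t\<close> exceeds the threshold at least \<open>\<theta> powr t\<close>.
  Ranks are nonnegative, so a cutoff of \<open>-1\<close> accepts everything.\<close>
definition cutoff :: "nat \<Rightarrow> real \<Rightarrow> real" where
  "cutoff n t = (if n \<le> 1 then -1 else if t < l1 then 1 else if t \<le> l2 then root (n - 1) (\<theta> t) else -1)"

lemma cutoff_antimono: "antimono (cutoff n)"
proof (rule antimonoI)
  fix s t :: real assume st: "s \<le> t"
  show "cutoff n t \<le> cutoff n s"
  proof (cases "n \<le> 1")
    case False
    have "root (n - 1) (\<theta> t) \<le> 1" "-1 \<le> root (n - 1) (\<theta> t)" if "t \<in> {l1..l2}" for t
    proof -
      show "root (n - 1) (\<theta> t) \<le> 1" using unit_range[OF that] False by simp
      have "0 \<le> root (n - 1) (\<theta> t)" using unit_range[OF that] by (simp add: real_root_ge_zero)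
      then show "-1 \<le> root (n - 1) (\<theta> t)" by simp
    qed
    moreover have "root (n - 1) (\<theta> t) \<le> root (n - 1) (\<theta> s)" if "s \<in> {l1..l2}" "t \<in> {l1..l2}"
      using antitone[OF that st] False by (intro real_root_le_mono) auto
    ultimately show ?thesis using st l False by (auto simp: cutoff_def)
  qed (simp add: cutoff_def)
qed

text \<open>z is the last time in [l1, l2] at which \<theta> is still at least \<pi>. It exists
  because \<theta> starts at 1 and is left-continuous; it may equal l2, after which the cutoff
  accepts everything.\<close>

lemma crossing:
  assumes "0 < \<pi>" "\<pi> \<le> 1"
  obtains z where "z \<in> {l1..l2}" "\<pi> \<le> \<theta> z" "\<And>t. z < t \<Longrightarrow> t \<le> l2 \<Longrightarrow> \<theta> t < \<pi>"
proof -
  define S where "S = {t \<in> {l1..l2}. \<pi> \<le> \<theta> t}"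
  define z where "z = Sup S"
  have "l1 \<in> S" using assms start l by (simp add: S_def)
  then have S: "S \<noteq> {}" "bdd_above S" "\<And>s. s \<in> S \<Longrightarrow> s \<le> l2"
    by (auto simp: S_def bdd_above_def)
  have z: "l1 \<le> z" "z \<le> l2"
    unfolding z_def using S \<open>l1 \<in> S\<close> by (simp_all add: cSup_upper cSup_least)
  have low: "\<pi> \<le> \<theta> t" if "l1 \<le> t" "t < z" for t
  proof -
    from less_cSupD[OF S(1), of t] that(2) obtain s where "s \<in> S" "t < s" unfolding z_def by auto
    then show ?thesis using antitone[of t s] that by (auto simp: S_def)
  qed
  \<comment> \<open>The supremum is attained: for z > l1 by left continuity, for z = l1 by the value
    1 at the start.\<close>
  have "\<pi> \<le> \<theta> z"
  proof (cases "z = l1")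
    case False
    then have "continuous (at_left z) \<theta>" using z by (intro leftcont) auto
    then have "(\<theta> \<longlongrightarrow> \<theta> z) (at_left z)" by (simp add: continuous_within)
    moreover have "eventually (\<lambda>t. \<pi> \<le> \<theta> t) (at_left z)"
      by (rule eventually_at_leftI[of l1]) (use low z False in auto)
    ultimately show ?thesis by (rule tendsto_lowerbound) simp
  qed (use start assms in simp)
  moreover have "\<theta> t < \<pi>" if "z < t" "t \<le> l2" for t
  proof (rule ccontr)
    assume "\<not> \<theta> t < \<pi>"
    then have "t \<in> S" using that z by (simp add: S_def)
    then have "t \<le> z" unfolding z_def using S by (intro cSup_upper)
    then show False using that by simp
  qed
  ultimately show ?thesis using that z by auto
qed

text \<open>Here acceptance and density use the same rank p, so w is accepted after the crossing
  time z of \<pi> = p ^ (n - 1), and c ^ (n - 1) can be compared with \<theta>(max s z) directly.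
  The assumed inequality at z is then rescaled by \<pi> / \<theta>(z).\<close>

lemma competitive_consistent:
  assumes F: "prior F" and n: "2 \<le> n"
    and ineq: "\<And>z. z \<in> {l1..l2} \<Longrightarrow>
       \<alpha> * \<theta> z \<le> (LBINT t=z..1. (LBINT s=0..t. (1 / t) * \<theta> (max s z) powr t))"
  shows "competitive n (threshold_rule (cutoff n) F) F \<alpha>"
proof -
  interpret threshold_setting F F "cutoff n"
    by standard (use F cutoff_antimono in auto)
  show ?thesis
  proof (rule competitive_threshold_rule)
    fix w and J :: "nat set" assume J: "finite J" "card J = n - 1"
    define p where "p = lexrank F w"
    define m where "m = n - 1"
    have m: "0 < m" using n by (simp add: m_def)
    have p: "0 \<le> p" "p \<le> 1" using lexrank_nonneg[OF F, of w] lexrank_le_1[OF F, of w] by (auto simp: p_def)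
    show "ennreal (\<alpha> * lexrank F w ^ (n - 1)) \<le>
      (\<integral>\<^sup>+t. emeasure (PiM J (\<lambda>_. item_space F)) {e \<in> space (PiM J (\<lambda>_. item_space F)). winning (cutoff n) F (w, t) J e} \<partial>unif)"
      (is "_ \<le> ?rhs")
    proof (cases "p = 0")
      case True
      moreover have "(0 :: real) ^ (n - 1) = 0" using m by (simp add: m_def)
      ultimately show ?thesis by (simp only: p_def) simp
    next
      case False
      then have p0: "0 < p" using p by simp
      define \<pi> where "\<pi> = p ^ m"
      have \<pi>: "0 < \<pi>" "\<pi> \<le> 1" using p0 p by (auto simp: \<pi>_def power_le_one)
      obtain z where z: "z \<in> {l1..l2}" "\<pi> \<le> \<theta> z" "\<And>t. z < t \<Longrightarrow> t \<le> l2 \<Longrightarrow> \<theta> t < \<pi>"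
        using crossing[OF \<pi>] by blast
      have z01: "0 \<le> z" "z \<le> 1" using z l by auto
      define T where "T = \<theta> z"
      have T: "0 < T" "\<pi> \<le> T" using z \<pi> by (auto simp: T_def)
      \<comment> \<open>A rank below \<open>p\<close> puts the item below w, and a rank below the
        cutoff makes it rejected. The clamp at 0 handles the cutoff -1, below which no rank
        lies.\<close>
      define c where "c s = min p (max 0 (cutoff n s))" for s
      have c: "0 \<le> c s" "c s \<le> 1" for s using p by (auto simp: c_def)
      have root_m: "root m \<pi> = p" using p m by (simp add: \<pi>_def real_root_power_cancel)
      have acc: "accepts (cutoff n) F w t" if "z < t" for t
      proof (cases "t \<le> l2")
        case True
        then have "root m (\<theta> t) < p" unfolding root_m[symmetric] using z(3)[of t] that m by simp
        then show ?thesis using True that z(1) n by (simp add: accepts_def cutoff_def m_def p_def)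
      next
        case False
        then show ?thesis using p that z(1) n by (simp add: accepts_def cutoff_def p_def)
      qed
      \<comment> \<open>Pointwise comparison of integrands. For s \<le> z, \<open>c s ^ m\<close> is
        \<pi>, which is written as (\<pi> / T) * T; for z < s \<le> l2 it is \<theta>(s); beyond l2
        the left side vanishes.\<close>
      have key: "\<pi> / T * (1 / t * \<theta> (max s z) powr t) \<le> (1 - t + t * c s) ^ m / t"
        if t: "z < t" "t \<le> 1" and s: "0 < s" "s < t" for s t
      proof -
        have t0: "0 < t" using s by simp
        \<comment> \<open>A number in [0,1] is at most its power with exponent t \<le> 1. This pays
          for a jump of \<theta> across \<pi>, where \<pi> < T.\<close>
        have pt: "\<pi> / T \<le> (\<pi> / T) powr t"
          using T \<pi> t t0 powr_mono'[of t 1 "\<pi> / T"] by simp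
        have "\<pi> / T * \<theta> (max s z) powr t \<le> (c s ^ m) powr t"
        proof (cases "s \<le> z")
          case True
          have "c s = p"
          proof (cases "s < l1")
            case True
            then show ?thesis using p n by (simp add: c_def cutoff_def)
          next
            case False
            have "\<pi> \<le> \<theta> s" using antitone[of s z] z True False by auto
            then have "p \<le> root m (\<theta> s)" using root_m m by (metis real_root_le_iff)
            then show ?thesis using True False z(1) n p by (simp add: c_def cutoff_def m_def)
          qed
          then have "(c s ^ m) powr t = (\<pi> / T * T) powr t" using T by (simp add: \<pi>_def)
          also have "\<dots> = (\<pi> / T) powr t * T powr t" by (rule powr_mult)
          finally show ?thesis
            using mult_right_mono[OF pt, of "T powr t"] True by (simp add: T_def max_absorb2)
        next
          case False
          have le1: "\<pi> / T \<le> 1" using T by simp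
          show ?thesis
          proof (cases "s \<le> l2")
            case True
            have s12: "s \<in> {l1..l2}" using True False z by auto
            have ths: "0 \<le> \<theta> s" "\<theta> s < \<pi>" using unit_range[OF s12] z(3)[of s] True False by auto
            have "root m (\<theta> s) \<le> p" using ths root_m m by (metis less_imp_le real_root_le_iff)
            then have "c s = root m (\<theta> s)"
              using ths n s12 p by (simp add: c_def cutoff_def m_def real_root_ge_zero)
            then have "c s ^ m = \<theta> s" using ths m by (simp add: real_root_pow_pos2)
            then show ?thesis using False le1 mult_right_mono[OF le1, of "\<theta> s powr t"] by simp
          next
            case False': False
            then have "\<theta> s = 0" using s t by (intro vanish) auto
            then show ?thesis using False by simp
          qed
        qed
        also have "\<dots> \<le> (1 - t + t * c s) ^ m"
          by (rule power_powr_le) (use c t t0 m in auto)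
        finally show ?thesis using t0 by (simp add: field_simps)
      qed
      define I where "I t = (\<integral>\<^sup>+s. ennreal ((1 - t + t * c s) ^ card J / t) * indicator {0..t} s \<partial>lborel)" for t
      have c_meas [measurable]: "c \<in> borel_measurable borel"
        using antimono_borel_measurable[OF cutoff_antimono[of n]] unfolding c_def by measurable
      have [measurable]: "I \<in> borel_measurable borel"
      proof -
        have "I = (\<lambda>t. \<integral>\<^sup>+s. (if 0 \<le> s \<and> s \<le> t then ennreal ((1 - t + t * c s) ^ card J / t) else 0) \<partial>lborel)"
          unfolding I_def by (intro ext nn_integral_cong) (auto simp: indicator_def)
        also have "\<dots> \<in> borel_measurable borel" by measurable
        finally show ?thesis .
      qed
      have "ennreal (\<alpha> * T) \<le> (\<integral>\<^sup>+t. (\<integral>\<^sup>+s. ennreal ((1 / t) * \<theta> (max s z) powr t) * indicator {0<..<t} s \<partial>lborel) * indicator {z<..1} t \<partial>lborel)"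
        unfolding T_def using ineq[OF z(1)] z01 z(1)
        by (intro nn_integral_LBINT_ge) (auto intro: nonneg)
      also have "\<dots> \<le> (\<integral>\<^sup>+t. ennreal (T / \<pi>) * (I t * indicator {z<..1} t) \<partial>lborel)"
      proof (rule nn_integral_mono)
        fix t
        show "(\<integral>\<^sup>+s. ennreal ((1 / t) * \<theta> (max s z) powr t) * indicator {0<..<t} s \<partial>lborel) * indicator {z<..1} t
          \<le> ennreal (T / \<pi>) * (I t * indicator {z<..1} t)"
        proof (cases "z < t \<and> t \<le> 1")
          case True
          have "(\<integral>\<^sup>+s. ennreal ((1 / t) * \<theta> (max s z) powr t) * indicator {0<..<t} s \<partial>lborel)
            \<le> (\<integral>\<^sup>+s. ennreal (T / \<pi>) * (ennreal ((1 - t + t * c s) ^ card J / t) * indicator {0..t} s) \<partial>lborel)"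
          proof (rule nn_integral_mono)
            fix s
            show "ennreal ((1 / t) * \<theta> (max s z) powr t) * indicator {0<..<t} s
              \<le> ennreal (T / \<pi>) * (ennreal ((1 - t + t * c s) ^ card J / t) * indicator {0..t} s)"
            proof (cases "0 < s \<and> s < t")
              case s: True
              have "(1 / t) * \<theta> (max s z) powr t \<le> (T / \<pi>) * ((1 - t + t * c s) ^ card J / t)"
                using key[of t s] True s T \<pi> J by (simp add: m_def field_simps)
              then have "ennreal ((1 / t) * \<theta> (max s z) powr t) \<le> ennreal (T / \<pi>) * ennreal ((1 - t + t * c s) ^ card J / t)"
                using T \<pi> by (subst ennreal_mult'[symmetric]) (auto intro: ennreal_leI)
              then show ?thesis using s by simp
            qed simp
          qed
          also have "\<dots> = ennreal (T / \<pi>) * I t"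
            unfolding I_def by (rule nn_integral_cmult) measurable
          finally show ?thesis using True by simp
        qed auto
      qed
      also have "\<dots> = ennreal (T / \<pi>) * (\<integral>\<^sup>+t. I t * indicator {z<..1} t \<partial>lborel)"
        by (rule nn_integral_cmult) measurable
      finally have aT: "ennreal (\<alpha> * T) \<le> ennreal (T / \<pi>) * (\<integral>\<^sup>+t. I t * indicator {z<..1} t \<partial>lborel)" .
      \<comment> \<open>The bound in \<open>aT\<close> carries the factor T / \<pi>; multiplying by
        its reciprocal leaves \<alpha> times the density of the optimum.\<close>
      have "ennreal (\<alpha> * \<pi>) = ennreal (\<pi> / T) * ennreal (\<alpha> * T)"
        using T \<pi> ennreal_mult'[of "\<pi> / T" "\<alpha> * T"] by (simp add: mult.commute)
      also have "\<dots> \<le> ennreal (\<pi> / T) * (ennreal (T / \<pi>) * (\<integral>\<^sup>+t. I t * indicator {z<..1} t \<partial>lborel))"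
        by (rule mult_left_mono[OF aT]) simp
      also have "\<dots> = ennreal (\<pi> / T * (T / \<pi>)) * (\<integral>\<^sup>+t. I t * indicator {z<..1} t \<partial>lborel)"
        using T \<pi> by (subst ennreal_mult) (auto simp: mult.assoc)
      also have "\<dots> = (\<integral>\<^sup>+t. (\<integral>\<^sup>+s. ennreal ((1 - t + t * c s) ^ card J / t) * indicator {0..t} s \<partial>lborel) * indicator {z<..1} t \<partial>lborel)"
        using T \<pi> by (simp add: I_def)
      also have "\<dots> \<le> ?rhs"
      proof (rule nn_integral_winning_prob_ge[OF J(1)])
        show "c \<in> borel_measurable borel" by (rule c_meas)
        fix s w' assume "lexrank F w' < c s"
        then have "lexrank F w' < lexrank F w" "lexrank F w' < max 0 (cutoff n s)"
          by (auto simp: c_def p_def)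
        then show "lexlt w' w \<and> \<not> accepts (cutoff n) F w' s"
          using lexlt_of_lexrank_less lexrank_nonneg[OF F, of w'] by (auto simp: accepts_def max_def split: if_splits)
      qed (use z01 c acc in auto)
      finally show ?thesis by (simp add: \<pi>_def p_def m_def)
    qed
  qed
qed
end

section \<open>Measurability of the algorithm and assembly of the two guarantees\<close>

lemma online_alg_threshold_rule:
  assumes "antimono Q"
  shows "online_alg n (threshold_rule Q)"
  unfolding online_alg_def
proof (intro allI impI)
  fix Ft F assume Ft: "prior Ft" and F: "prior F"
  have sF: "sets F = sets borel" using F by (simp add: prior_def)
  have X: "(\<lambda>x. x i) \<in> borel_measurable (PiM {..<n} (\<lambda>_. F))" for i
    by (rule component_borel_measurable) (rule sF)
  have T: "(\<lambda>x. x i) \<in> borel_measurable (PiM {..<n} (\<lambda>_. unif))" for i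
    by (rule component_borel_measurable) (rule sets_unif)
  have "(\<lambda>\<omega>. fst (fst \<omega>)) \<in> measurable (sample_space n F) (PiM {..<n} (\<lambda>_. F))"
    "(\<lambda>\<omega>. snd (fst \<omega>)) \<in> measurable (sample_space n F) (PiM {..<n} (\<lambda>_. unif))"
    "snd \<in> measurable (sample_space n F) unif"
    unfolding sample_space_def unif_def[symmetric] by measurable
  note comp = measurable_compose[OF this(1) X] measurable_compose[OF this(2) T]
    measurable_compose[OF this(3) measurable_ident_sets[OF sets_unif]]
  show "(\<lambda>\<omega>. alg_value (threshold_rule Q Ft) n (fst (fst \<omega>)) (snd (fst \<omega>)) (snd \<omega>)) \<in> borel_measurable (sample_space n F)"
    by (rule alg_value_measurable[OF Ft assms]) (rule comp)+
qed

theorem mainTheorem1: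
  fixes \<alpha> \<beta> l1 l2 :: real and \<theta> :: "real \<Rightarrow> real"
  assumes beta: "0 \<le> \<beta>" "\<beta> \<le> 1 / exp 1"
    and lam_range: "l1 \<in> {0..1}" "l2 \<in> {0..1}" "l1 \<le> l2"
    and lam_roots: "negxlnx l1 = \<beta>" "negxlnx l2 = \<beta>"
    and lam_extreme: "\<forall>l\<in>{0..1}. negxlnx l = \<beta> \<longrightarrow> l1 \<le> l \<and> l \<le> l2"
    and theta_range: "\<forall>t\<in>{l1..l2}. 0 \<le> \<theta> t \<and> \<theta> t \<le> 1"
    and theta_mono: "\<forall>s\<in>{l1..l2}. \<forall>t\<in>{l1..l2}. s \<le> t \<longrightarrow> \<theta> t \<le> \<theta> s"
    and theta_leftcont: "\<forall>t\<in>{l1<..l2}. continuous (at_left t) \<theta>"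
    and theta_ext: "\<forall>t\<in>{l2<..1}. \<theta> t = 0"
    and theta_start: "\<theta> l1 = 1"
    and ineq: "\<forall>z\<in>{l1..l2}.
       (LBINT t=z..1. (LBINT s=0..t. (1 / t) * \<theta> (max s z) powr t)) \<ge> \<alpha> * \<theta> z"
  shows "\<forall>n::nat. \<exists>A. online_alg n A \<and> consistent n A \<alpha> \<and> robust n A \<beta>"
proof
  fix n :: nat
  interpret quantile_curve \<theta> l1 l2
    by standard (use lam_range theta_range theta_mono theta_leftcont theta_ext theta_start in auto)
  have cutoff_early: "1 \<le> cutoff n s" if "2 \<le> n" "s < l1" for s
    using that by (simp add: cutoff_def)
  have cutoff_late: "cutoff n s < 0" if "l2 < s" for s
    using that lam_range by (simp add: cutoff_def)
  have cutoff_small: "cutoff n s < 0" if "n \<le> 1" for s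
    using that by (simp add: cutoff_def)
  have setting: "threshold_setting F Ft (cutoff n)" if "prior F" "prior Ft" for F Ft
    by standard (use that cutoff_antimono in auto)
  \<comment> \<open>Needed for n \<le> 1, where the guarantee obtained is 1. It follows from the
    assumption at z = l1: there \<theta> is 1, and the inner integral is an average over [0,t] of
    quantities at most 1.\<close>
  have "\<alpha> \<le> 1"
  proof -
    have "l1 \<in> {l1..l2}" using lam_range by simp
    note at_l1 = bspec[OF ineq this, unfolded theta_start mult_1_right]
    have "ennreal \<alpha> \<le> (\<integral>\<^sup>+t. (\<integral>\<^sup>+s. ennreal ((1 / t) * \<theta> (max s l1) powr t) * indicator {0<..<t} s \<partial>lborel) * indicator {l1<..1} t \<partial>lborel)"
      by (rule nn_integral_LBINT_ge[OF _ _ _ at_l1]) (use lam_range in \<open>auto intro: nonneg\<close>)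
    also have "\<dots> \<le> (\<integral>\<^sup>+t. indicator {0..1::real} t \<partial>lborel)"
    proof (rule nn_integral_mono)
      fix t :: real
      show "(\<integral>\<^sup>+s. ennreal ((1 / t) * \<theta> (max s l1) powr t) * indicator {0<..<t} s \<partial>lborel) * indicator {l1<..1} t \<le> indicator {0..1} t"
      proof (cases "l1 < t \<and> t \<le> 1")
        case True
        then have t: "0 < t" using lam_range by auto
        have "(\<integral>\<^sup>+s. ennreal ((1 / t) * \<theta> (max s l1) powr t) * indicator {0<..<t} s \<partial>lborel)
          \<le> (\<integral>\<^sup>+s. ennreal (1 / t) * indicator {0<..<t} s \<partial>lborel)"
        proof (rule nn_integral_mono)
          fix s
          have "\<theta> (max s l1) powr t \<le> 1" if "s < t"
          proof -
            have "max s l1 \<in> {l1..1}" using that True lam_range by auto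
            then have "0 \<le> \<theta> (max s l1)" "\<theta> (max s l1) \<le> 1"
              using nonneg[of "max s l1"] unit_range[of "max s l1"] vanish[of "max s l1"]
              by (cases "max s l1 \<le> l2"; auto)+
            then show ?thesis using t powr_mono2[of t "\<theta> (max s l1)" 1] by simp
          qed
          then show "ennreal ((1 / t) * \<theta> (max s l1) powr t) * indicator {0<..<t} s \<le> ennreal (1 / t) * indicator {0<..<t} s"
            using t by (auto simp: indicator_def intro!: ennreal_leI divide_right_mono)
        qed
        also have "\<dots> = 1" using t by (subst nn_integral_cmult) (auto simp: ennreal_mult[symmetric])
        finally show ?thesis using True t by simp
      qed auto
    qed
    also have "\<dots> = 1" by simp
    finally show ?thesis by simp
  qed
  have "1 \<le> exp (1::real)" by simp
  then have "1 / exp 1 \<le> (1::real)" by simp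
  then have "\<beta> \<le> 1" using beta by linarith
  have "consistent n (threshold_rule (cutoff n)) \<alpha>"
    unfolding consistent_def
  proof (intro allI impI, elim conjE)
    fix F assume F: "prior F"
    show "competitive n (threshold_rule (cutoff n) F) F \<alpha>"
    proof (cases "n \<le> 1")
      case True
      then show ?thesis
        using threshold_setting.competitive_always[OF setting[OF F F]] cutoff_small \<open>\<alpha> \<le> 1\<close> by blast
    next
      case False
      then show ?thesis using competitive_consistent[OF F] ineq by auto
    qed
  qed
  moreover have "robust n (threshold_rule (cutoff n)) \<beta>"
    unfolding robust_def
  proof (intro allI impI, elim conjE)
    fix F Ft assume F: "prior F" and Ft: "prior Ft"
    \<comment> \<open>The case \<beta> = 0 is separated because then l1 = 0 and ln l1 is
      meaningless, while 0-competitiveness is trivial. For \<beta> > 0 neither root is 0, since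
      \<open>negxlnx 0 = 0\<close>.\<close>
    consider "n \<le> 1" | "\<beta> = 0" | "2 \<le> n" "0 < \<beta>" using beta by linarith
    then show "competitive n (threshold_rule (cutoff n) Ft) F \<beta>"
    proof cases
      case 1
      then show ?thesis
        using threshold_setting.competitive_always[OF setting[OF F Ft]] cutoff_small \<open>\<beta> \<le> 1\<close> by blast
    next
      case 2
      then show ?thesis by (simp add: competitive_def)
    next
      case 3
      then have "l1 \<noteq> 0" "l2 \<noteq> 0" using lam_roots by (auto simp: negxlnx_def)
      then have l: "0 < l1" "- l1 * ln l1 = \<beta>" "- l2 * ln l2 = \<beta>"
        using lam_range lam_roots by (auto simp: negxlnx_def)
      show ?thesis
        using lam_range l cutoff_early[OF 3(1)] cutoff_late
        by (intro threshold_setting.competitive_robust[OF setting[OF F Ft], of l1 l2] negxlnx_ge_between[of l1 _ l2]) auto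
    qed
  qed
  ultimately show "\<exists>A. online_alg n A \<and> consistent n A \<alpha> \<and> robust n A \<beta>"
    using online_alg_threshold_rule[OF cutoff_antimono] by blast
qed

end
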